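(* Let $|p|<1$, let $N$ be a positive integer, $m=(m_1,\dots,m_N)$ a tuple of nonnegative integers, and let $a,b,c,d,q,t_1,\dots,t_N\in\mathbb{C}^{\ast}$ be such that both sides below are well defined. Put $t=(t_1,\dots,t_N)$, $\hat a=cd/ab$, and let $s=(s_1,\dots,s_N)$ be given by $s_it_i=q^{-m_i}$ for all $i\in\{1,\dots,N\}$. Then $$ V_m(a;b,c,d;t)= V_m(\hat{a};b,c,d;s) \prod_{i=1}^N \frac{(aqt_i,\ \hat{a}qs_i/c,\ \hat{a}qs_i/d,\ aqt_i/cd)_{m_i}} {(\hat{a}qs_i,\ aqt_i/c,\ aqt_i/d,\ \hat{a}qs_i/cd)_{m_i}}, $$ where $V_m$ is the multiple elliptic hypergeometric series $$ V_m(a;b,c,d;t):= \sum_{k_1=0}^{m_1}\cdots\sum_{k_N=0}^{m_N} \prod_{i=1}^N \left(\frac{\theta(at_iq^{k_i+|k|})}{\theta(at_i)} \frac{(abt_i/c,abt_i/d)_{k_i}}{(aqt_i/c,aqt_i/d)_{k_i}} \frac{(at_i,abq^{m_i}t_i)_{|k|}}{(aqt_i/b,aq^{m_i+1}t_i)_{|k|}} \frac{(aqt_i/b)_{k_i+|k|}}{(abt_i)_{k_i+|k|}}\right) $$ $$ \times\frac{(c,d)_{|k|}}{(cq/b,dq/b)_{|k|}} \left(\frac{q}{b}\right)^{(N+1)|k|} \prod_{i,j=1}^N \frac{(q^{-m_j}t_i/t_j,\ bt_i/t_j)_{k_i}}{(q^{1-m_j}t_i/bt_j,\ qt_i/t_j)_{k_i}}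 \frac{(qt_i/t_j)_{k_i-k_j}}{(bt_i/t_j)_{k_i-k_j}}, $$ with $|k|=k_1+\cdots+k_N$.
   Context: For $|p|<1$ and $x\in\mathbb{C}^{\ast}$, $\theta(x)=\theta(x;p)=\prod_{k=0}^{\infty}(1-xp^k)(1-x^{-1}p^{k+1})$. The theta shifted factorial is $(a)_n=(a;q,p)_n=\prod_{k=0}^{n-1}\theta(aq^k;p)$ for $n\ge0$, extended to negative indices by $(a)_{-n}=1/(aq^{-n})_n$, and $(a_1,\dots,a_k)_n=(a_1)_n\cdots(a_k)_n$. In fractions inside arguments, everything after the slash is in the denominator: $\hat a=cd/(ab)$, $aqt_i/cd=aqt_i/(cd)$, $q^{1-m_j}t_i/bt_j=q^{1-m_j}t_i/(bt_j)$, etc. *)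

theory Defs
  imports "HOL-Analysis.Analysis"
begin

definition etheta :: "complex \<Rightarrow> complex \<Rightarrow> complex" where
  "etheta p x = (\<Prod>k. (1 - x * p ^ k) * (1 - inverse x * p ^ (k + 1)))"

definition tsf_nat :: "complex \<Rightarrow> complex \<Rightarrow> complex \<Rightarrow> nat \<Rightarrow> complex" where
  "tsf_nat q p a n = (\<Prod>k<n. etheta p (a * q ^ k))"

definition tsf :: "complex \<Rightarrow> complex \<Rightarrow> complex \<Rightarrow> int \<Rightarrow> complex" where
  "tsf q p a n =
     (if 0 \<le> n then tsf_nat q p a (nat n) else 1 / tsf_nat q p (a * q powi n) (nat (- n)))"

definition tsfs :: "complex \<Rightarrow> complex \<Rightarrow> complex list \<Rightarrow> int \<Rightarrow> complex" where
  "tsfs q p as n = (\<Prod>a\<leftarrow>as. tsf q p a n)"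

text \<open>
  Well-definedness of a shifted factorial standing in a numerator or in a denominator.
  For a negative index, a factor in the denominator is read as
  \<open>1 / (a)\<^sub>-\<^sub>n = (a q\<^sup>-\<^sup>n)\<^sub>n\<close>, which imposes no condition; with \<open>1 / 0 = 0\<close> this is also the
  value of \<open>1 / tsf q p a (- n)\<close> when \<open>(a q\<^sup>-\<^sup>n)\<^sub>n = 0\<close>.
\<close>

definition tsf_num_ok :: "complex \<Rightarrow> complex \<Rightarrow> complex \<Rightarrow> int \<Rightarrow> bool" where
  "tsf_num_ok q p a n \<longleftrightarrow> (n < 0 \<longrightarrow> tsf_nat q p (a * q powi n) (nat (- n)) \<noteq> 0)"

definition tsf_den_ok :: "complex \<Rightarrow> complex \<Rightarrow> complex \<Rightarrow> int \<Rightarrow> bool" where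
  "tsf_den_ok q p a n \<longleftrightarrow> (0 \<le> n \<longrightarrow> tsf_nat q p a (nat n) \<noteq> 0)"

text \<open>An \<open>N\<close>-tuple is a function on \<open>nat\<close>, of which only the values on \<open>{1..N}\<close> matter.\<close>

definition box :: "nat \<Rightarrow> (nat \<Rightarrow> nat) \<Rightarrow> (nat \<Rightarrow> nat) set" where
  "box N m = (\<Pi>\<^sub>E i\<in>{1..N}. {0..m i})"

definition weight :: "nat \<Rightarrow> (nat \<Rightarrow> nat) \<Rightarrow> nat" where
  "weight N k = (\<Sum>i=1..N. k i)"

definition V_term ::
  "complex \<Rightarrow> complex \<Rightarrow> nat \<Rightarrow> (nat \<Rightarrow> nat) \<Rightarrow> complex \<Rightarrow> complex \<Rightarrow> complex \<Rightarrow> complex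
    \<Rightarrow> (nat \<Rightarrow> complex) \<Rightarrow> (nat \<Rightarrow> nat) \<Rightarrow> complex" where
  "V_term q p N m a b c d t k =
    (\<Prod>i=1..N.
        etheta p (a * t i * q ^ (k i + weight N k)) / etheta p (a * t i)
      * (tsfs q p [a * b * t i / c, a * b * t i / d] (int (k i))
         / tsfs q p [a * q * t i / c, a * q * t i / d] (int (k i)))
      * (tsfs q p [a * t i, a * b * q ^ m i * t i] (int (weight N k))
         / tsfs q p [a * q * t i / b, a * q ^ (m i + 1) * t i] (int (weight N k)))
      * (tsf q p (a * q * t i / b) (int (k i + weight N k))
         / tsf q p (a * b * t i) (int (k i + weight N k))))
    * (tsfs q p [c, d] (int (weight N k))
       / tsfs q p [c * q / b, d * q / b] (int (weight N k)))
    * (q / b) ^ ((N + 1) * weight N k)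
    * (\<Prod>i=1..N. \<Prod>j=1..N.
        tsfs q p [q powi (- int (m j)) * t i / t j, b * t i / t j] (int (k i))
        / tsfs q p [q powi (1 - int (m j)) * t i / (b * t j), q * t i / t j] (int (k i))
      * (tsf q p (q * t i / t j) (int (k i) - int (k j))
         / tsf q p (b * t i / t j) (int (k i) - int (k j))))"

definition V ::
  "complex \<Rightarrow> complex \<Rightarrow> nat \<Rightarrow> (nat \<Rightarrow> nat) \<Rightarrow> complex \<Rightarrow> complex \<Rightarrow> complex \<Rightarrow> complex
    \<Rightarrow> (nat \<Rightarrow> complex) \<Rightarrow> complex" where
  "V q p N m a b c d t = (\<Sum>k\<in>box N m. V_term q p N m a b c d t k)"

text \<open>
  The series is well defined if in each of its terms every factor written in a denominator is
  nonzero and the factors \<open>(q t\<^sub>i / t\<^sub>j)\<close> with negative index \<open>k\<^sub>i - k\<^sub>j\<close> exist.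
\<close>

definition V_well_defined ::
  "complex \<Rightarrow> complex \<Rightarrow> nat \<Rightarrow> (nat \<Rightarrow> nat) \<Rightarrow> complex \<Rightarrow> complex \<Rightarrow> complex \<Rightarrow> complex
    \<Rightarrow> (nat \<Rightarrow> complex) \<Rightarrow> bool" where
  "V_well_defined q p N m a b c d t \<longleftrightarrow>
    (\<forall>k\<in>box N m.
      (\<forall>i\<in>{1..N}.
          etheta p (a * t i) \<noteq> 0
        \<and> tsf_den_ok q p (a * q * t i / c) (int (k i))
        \<and> tsf_den_ok q p (a * q * t i / d) (int (k i))
        \<and> tsf_den_ok q p (a * q * t i / b) (int (weight N k))
        \<and> tsf_den_ok q p (a * q ^ (m i + 1) * t i) (int (weight N k))
        \<and> tsf_den_ok q p (a * b * t i) (int (k i + weight N k)))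
      \<and> tsf_den_ok q p (c * q / b) (int (weight N k))
      \<and> tsf_den_ok q p (d * q / b) (int (weight N k))
      \<and> (\<forall>i\<in>{1..N}. \<forall>j\<in>{1..N}.
          tsf_den_ok q p (q powi (1 - int (m j)) * t i / (b * t j)) (int (k i))
        \<and> tsf_den_ok q p (q * t i / t j) (int (k i))
        \<and> tsf_num_ok q p (q * t i / t j) (int (k i) - int (k j))
        \<and> tsf_den_ok q p (b * t i / t j) (int (k i) - int (k j))))"

end

theory Submission
  imports Defs "HOL-Complex_Analysis.Conformal_Mappings"
    "HOL-Computational_Algebra.Polynomial"
begin

text \<open>
  For \<open>m = (1, \<dots>, 1)\<close> the series is a sum over the subsets \<open>I\<close> of the index set, and the
  transformation becomes a relation between the values of one sum \<open>S X t a u v\<close>, where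
  \<open>u = ab/c\<close> and \<open>v = ab/d\<close>, at the points \<open>a\<close> and \<open>u v / (a b q\<^sup>n)\<close>. Cleared of denominators,
  the difference of the two sides is a theta function in one of the variables, and it vanishes at as
  many points as its degree: at each pole of \<open>S\<close> either the terms cancel in pairs or the residue is
  a sum of the same form in one or two variables less, so that induction applies. Since theta functions
  are handled as sums of products of \<open>\<theta>(\<alpha> x)\<close>, the only analytic ingredient is the three-term
  relation, and the case \<open>p = 0\<close> needs no separate treatment afterwards.

  For general \<open>m\<close> one substitutes the strings \<open>t\<^sub>i, t\<^sub>i q, \<dots>, t\<^sub>i q\<^sup>m\<^sup>i\<^sup>-\<^sup>1\<close> for the variables;
  all terms vanish except those where \<open>I\<close> consists of initial segments of lengths \<open>k\<^sub>i\<close>, and these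
  are the terms of \<open>V\<^sub>m\<close>. All this is done for generic parameters. The general case follows by
  continuity.
\<close>

section \<open>Theta functions\<close>

text \<open>The partner of \<open>a\<close> is u v/(a b q^n) for the following reason: passing from
  a subset to its complement and from each variable t to 1/(q t) carries the sum at that point into
  a sum of the same shape at a b/(u v), with b/v and b/u in place of \<open>u\<close> and
  \<open>v\<close>; and a b/(u v) is c d/(a b). So the duality of \<open>S\<close> becomes the
  transformation of V. The induction rests on an exact balance. With |Y| + 1 variables the cleared
  difference has degree 5|Y| + 4, and there are just as many nodes: three points b^e t_y for each
  other variable, one point each from \<open>u\<close> and \<open>v\<close>, and |Y| + 1 poles each
  for \<open>a\<close> and its partner. A theta function that vanishes at as many points as its
  degree is zero unless the product of these points has one particular value modulo powers of
  \<open>p\<close>; here the discrepancy is b/q, and genericity keeps it away from the zeros of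
  theta. The delicate point is what generic may mean. Strings t, t q, t q^2, ... have to be
  admissible as variables, so ratios of variables may be powers of \<open>q\<close>, and only powers
  of \<open>b\<close> may multiply them in the conditions imposed.\<close>

definition qpoch :: "complex \<Rightarrow> complex \<Rightarrow> complex" where
  "qpoch p x = (\<Prod>k. 1 - x * p ^ k)"

context
  fixes p :: complex
  assumes p: "norm p < 1"
begin

lemma convergent_qpoch: "convergent_prod (\<lambda>k. 1 - x * p ^ k)"
proof -
  have "summable (\<lambda>k. norm x * norm p ^ k)"
    using p by (intro summable_mult summable_geometric) auto
  then have "abs_convergent_prod (\<lambda>k. 1 - x * p ^ k)"
    by (simp add: abs_convergent_prod_conv_summable norm_mult norm_power)
  then show ?thesis
    by (rule abs_convergent_prod_imp_convergent_prod)
qed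

lemma qpoch_step: "qpoch p x = (1 - x) * qpoch p (x * p)"
proof (cases "x = 1")
  case True
  have "(\<lambda>k. 1 - x * p ^ k) has_prod qpoch p x"
    unfolding qpoch_def using convergent_qpoch by (rule convergent_prod_has_prod)
  then have "qpoch p x = 0"
    by (rule has_prod_zeroI[of _ _ 0]) (simp add: True)
  then show ?thesis by (simp add: True)
next
  case False
  have "(\<Prod>n. 1 - x * p ^ Suc n) = qpoch p x / (1 - x * p ^ 0)"
    unfolding qpoch_def
    by (rule prodinf_split_head[OF convergent_qpoch]) (use False in auto)
  then show ?thesis
    using False by (simp add: qpoch_def field_simps)
qed

lemma qpoch_eq_0_iff: "qpoch p x = 0 \<longleftrightarrow> (\<exists>k. x * p ^ k = 1)"
  using has_prod_eq_0_iff[OF convergent_prod_has_prod[OF convergent_qpoch[of x]]]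
  by (auto simp: qpoch_def image_iff)

text \<open>On the closed unit disc around x the factors differ from 1 by at most (|x| + 1) |p|^k,
  so the partial products converge uniformly there.\<close>

lemma qpoch_holomorphic: "qpoch p holomorphic_on UNIV"
proof (rule holomorphic_uniform_sequence[where f = "\<lambda>N x. \<Prod>k<N. 1 - x * p ^ k"])
  fix x :: complex
  let ?A = "cball x 1"
  have "uniformly_convergent_on ?A (\<lambda>N y. \<Sum>k<N. norm ((1 - y * p ^ k) - 1))"
  proof (rule Weierstrass_m_test'[where M = "\<lambda>k. (norm x + 1) * norm p ^ k"])
    fix n y assume "y \<in> ?A"
    then have "norm y \<le> norm x + 1"
      using norm_triangle_ineq2[of y x] by (simp add: dist_norm norm_minus_commute)
    then show "norm (norm (1 - y * p ^ n - 1)) \<le> (norm x + 1) * norm p ^ n"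
      by (simp add: norm_mult norm_power mult_right_mono)
  qed (use p in \<open>intro summable_mult summable_geometric; simp\<close>)
  then have "uniformly_convergent_on ?A (\<lambda>N y. \<Prod>k<N. 1 - y * p ^ k)"
    by (intro uniformly_convergent_on_prod') (auto intro!: continuous_intros)
  then obtain l where l: "uniform_limit ?A (\<lambda>N y. \<Prod>k<N. 1 - y * p ^ k) l sequentially"
    by (auto simp: uniformly_convergent_on_def)
  have "l y = qpoch p y" if "y \<in> ?A" for y
  proof -
    have "(\<lambda>N. \<Prod>k<N. 1 - y * p ^ k) \<longlonglongrightarrow> l y"
      using l that by (rule tendsto_uniform_limitI)
    moreover have "(\<lambda>N. \<Prod>k<N. 1 - y * p ^ k) \<longlonglongrightarrow> qpoch p y"
      unfolding qpoch_def
      by (rule has_prod_imp_tendsto'[OF convergent_prod_has_prod[OF convergent_qpoch]])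
    ultimately show ?thesis by (rule LIMSEQ_unique)
  qed
  then have "uniform_limit ?A (\<lambda>N y. \<Prod>k<N. 1 - y * p ^ k) (qpoch p) sequentially"
    using l uniform_limit_cong'[of ?A "\<lambda>N y. \<Prod>k<N. 1 - y * p ^ k" "\<lambda>N y. \<Prod>k<N. 1 - y * p ^ k" l "qpoch p"]
    by auto
  then show "\<exists>d>0. cball x d \<subseteq> UNIV \<and> uniform_limit (cball x d) (\<lambda>N x. \<Prod>k<N. 1 - x * p ^ k) (qpoch p) sequentially"
    by (intro exI[of _ 1]) auto
qed (auto intro!: holomorphic_intros)

lemma etheta_eq_qpoch: "etheta p x = qpoch p x * qpoch p (p / x)"
proof -
  have "qpoch p x * qpoch p (p / x) = (\<Prod>k. (1 - x * p ^ k) * (1 - p / x * p ^ k))"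
    unfolding qpoch_def by (rule prodinf_mult[OF convergent_qpoch convergent_qpoch])
  then show ?thesis
    unfolding etheta_def by (simp add: field_simps)
qed

lemma etheta_1 [simp]: "etheta p 1 = 0"
  using qpoch_step[of 1] by (simp add: etheta_eq_qpoch)

lemma etheta_inverse:
  assumes "x \<noteq> 0"
  shows "etheta p (1 / x) = - etheta p x / x"
proof (cases "x = 1")
  case False
  have "etheta p (1 / x) = (1 - 1 / x) * qpoch p (p / x) * qpoch p (x * p)"
    using qpoch_step[of "1 / x"] by (simp add: etheta_eq_qpoch mult.commute)
  also have "\<dots> = - ((1 - x) * qpoch p (x * p)) * qpoch p (p / x) / x"
    using assms by (simp add: field_simps)
  also have "\<dots> = - etheta p x / x"
    by (simp add: etheta_eq_qpoch flip: qpoch_step)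
  finally show ?thesis .
qed auto

lemma etheta_swap:
  assumes "x \<noteq> 0" "y \<noteq> 0"
  shows "etheta p (x / y) = - (x / y) * etheta p (y / x)"
  using etheta_inverse[of "y / x"] assms by (simp add: field_simps)

lemma etheta_p_mult:
  assumes "x \<noteq> 0" "p \<noteq> 0"
  shows "etheta p (x * p) = - etheta p x / x"
proof -
  have "etheta p (x * p) = etheta p (1 / x)"
    using assms by (simp add: etheta_eq_qpoch field_simps)
  then show ?thesis
    using etheta_inverse[OF assms(1)] by simp
qed

lemma etheta_holomorphic: "etheta p holomorphic_on - {0}"
proof -
  have "(\<lambda>x. qpoch p x * qpoch p (p / x)) holomorphic_on - {0}"
    by (intro holomorphic_intros holomorphic_on_compose_gen[OF _ qpoch_holomorphic, unfolded o_def]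
        holomorphic_on_subset[OF qpoch_holomorphic]) auto
  then show ?thesis
    by (simp add: etheta_eq_qpoch[abs_def])
qed

lemma tendsto_etheta [tendsto_intros]:
  assumes "(f \<longlongrightarrow> x) F" "x \<noteq> 0"
  shows "((\<lambda>n. etheta p (f n)) \<longlongrightarrow> etheta p x) F"
proof -
  have "continuous_on (- {0}) (etheta p)"
    by (rule holomorphic_on_imp_continuous_on[OF etheta_holomorphic])
  then have "isCont (etheta p) x"
    using assms(2) by (simp add: continuous_on_eq_continuous_at open_Compl)
  then show ?thesis
    using assms(1) by (rule isCont_tendsto_compose)
qed

text \<open>All later choices of generic parameters avoid zeros of theta, and countability of the
  zero set is all that these choices use.\<close>

lemma countable_zeros_etheta: "countable {x. x \<noteq> 0 \<and> etheta p x = 0}"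
proof -
  have "{x. x \<noteq> 0 \<and> etheta p x = 0} \<subseteq> range (\<lambda>k. inverse (p ^ k)) \<union> range (\<lambda>k. p ^ k)"
  proof
    fix x assume "x \<in> {x. x \<noteq> 0 \<and> etheta p x = 0}"
    then have x: "x \<noteq> 0" and "qpoch p x = 0 \<or> qpoch p (p / x) = 0"
      by (auto simp: etheta_eq_qpoch)
    then consider k where "x * p ^ k = 1" | k where "p / x * p ^ k = 1"
      by (auto simp: qpoch_eq_0_iff)
    then show "x \<in> range (\<lambda>k. inverse (p ^ k)) \<union> range (\<lambda>k. p ^ k)"
    proof cases
      case 1
      then show ?thesis by (metis UnI1 inverse_unique mult.commute rangeI)
    next
      case 2
      then have "x = p ^ Suc k" using x by (simp add: field_simps)
      then show ?thesis by blast
    qed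
  qed
  then show ?thesis
    by (rule countable_subset) auto
qed

end

lemma etheta_0: "etheta 0 x = 1 - x"
  using qpoch_step[of 0 x] by (simp add: etheta_eq_qpoch) (simp add: qpoch_def)

subsection \<open>The three-term relation\<close>

context
  fixes p :: complex
  assumes p: "norm p < 1"
begin

text \<open>For nonzero \<open>p\<close> the zeros of theta form the single orbit of 1 under
  multiplication by powers of \<open>p\<close>, so a property invariant under x -> x p needs to be
  checked at 1 only.\<close>

lemma etheta_zero_induct:
  assumes "x \<noteq> 0" "etheta p x = 0" "P 1" and step: "\<And>y. y \<noteq> 0 \<Longrightarrow> P (y * p) \<longleftrightarrow> P y" and "p \<noteq> 0"
  shows "P x"
proof -
  have iter: "P (y * p ^ k) \<longleftrightarrow> P y" if "y \<noteq> 0" for y k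
    using that \<open>p \<noteq> 0\<close> step[of "y * p ^ j" for j]
    by (induction k) (auto simp: mult_ac)
  from assms consider k where "x * p ^ k = 1" | k where "p / x * p ^ k = 1"
    by (auto simp: etheta_eq_qpoch[OF p] qpoch_eq_0_iff[OF p])
  then show ?thesis
  proof cases
    case 1
    then show ?thesis using iter[OF assms(1)] \<open>P 1\<close> by metis
  next
    case 2
    then have "x = 1 * p ^ Suc k" using assms(1) by (simp add: field_simps)
    then show ?thesis using iter[of 1 "Suc k"] \<open>P 1\<close> by simp
  qed
qed

section \<open>Division by theta, and Liouville's theorem on the punctured plane\<close>

lemma qpoch_compose_holomorphic:
  "f holomorphic_on A \<Longrightarrow> (\<lambda>x. qpoch p (f x)) holomorphic_on A"
  using holomorphic_on_compose_gen[OF _ qpoch_holomorphic[OF p], of f A] by (simp add: o_def)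

lemma etheta_compose_holomorphic:
  assumes "f holomorphic_on A" "0 \<notin> f ` A"
  shows "(\<lambda>x. etheta p (f x)) holomorphic_on A"
  using holomorphic_on_compose_gen[OF assms(1) etheta_holomorphic[OF p]] assms(2)
  by (auto simp add: o_def)

lemma etheta_differentiable: "x \<noteq> 0 \<Longrightarrow> (etheta p has_field_derivative deriv (etheta p) x) (at x)"
  by (rule holomorphic_derivI[OF etheta_holomorphic[OF p]]) (auto simp: open_Compl)

text \<open>Differentiate \<theta>(x p) = - \<theta>(x)/x; at a zero the term containing the
  derivative of 1/x drops out.\<close>

lemma deriv_etheta_p_mult:
  assumes "x \<noteq> 0" "p \<noteq> 0" "etheta p x = 0"
  shows "deriv (etheta p) (x * p) * p = - deriv (etheta p) x / x"
proof (rule DERIV_unique)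
  show "((\<lambda>y. etheta p (y * p)) has_field_derivative deriv (etheta p) (x * p) * p) (at x)"
    by (rule DERIV_chain2[OF etheta_differentiable]) (use assms in \<open>auto intro!: derivative_eq_intros\<close>)
  have "((\<lambda>y. - etheta p y / y) has_field_derivative - deriv (etheta p) x / x) (at x)"
    by (rule DERIV_cong[OF DERIV_divide[OF DERIV_minus[OF etheta_differentiable] DERIV_ident]])
      (use assms in \<open>simp_all add: divide_simps\<close>)
  then show "((\<lambda>y. etheta p (y * p)) has_field_derivative - deriv (etheta p) x / x) (at x)"
    by (rule has_field_derivative_transform_within_open[of _ _ _ "- {0}"])
      (use assms etheta_p_mult[OF p] in \<open>auto simp: open_Compl\<close>)
qed

text \<open>At 1 the factor 1 - y splits off and leaves the square of \<open>qpoch p p\<close>,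
  which is not zero. Passing from x to x p multiplies the derivative at a zero by a nonzero number,
  so simplicity spreads over the orbit.\<close>

lemma etheta_simple_zero:
  assumes "x \<noteq> 0" "etheta p x = 0" "p \<noteq> 0"
  shows "deriv (etheta p) x \<noteq> 0"
proof -
  have "etheta p x = 0 \<and> deriv (etheta p) x \<noteq> 0"
  proof (rule etheta_zero_induct[OF assms(1,2)])
    let ?G = "\<lambda>y. qpoch p (y * p) * qpoch p (p / y)"
    have "?G holomorphic_on - {0}"
      by (intro holomorphic_intros qpoch_compose_holomorphic) auto
    then have "(?G has_field_derivative deriv ?G 1) (at 1)"
      by (rule holomorphic_derivI) (auto simp: open_Compl)
    from DERIV_mult[OF DERIV_diff[OF DERIV_const DERIV_ident] this, of 1]
    have "((\<lambda>y. (1 - y) * ?G y) has_field_derivative - ?G 1) (at 1)" by simp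
    moreover have "etheta p = (\<lambda>y. (1 - y) * ?G y)"
      by (rule ext, subst etheta_eq_qpoch[OF p], subst qpoch_step[OF p]) (simp add: mult.assoc)
    ultimately have "deriv (etheta p) 1 = - ?G 1"
      by (simp add: DERIV_imp_deriv)
    moreover have "p * p ^ k \<noteq> 1" for k
    proof
      assume "p * p ^ k = 1"
      then have "norm p ^ Suc k = 1" by (metis norm_one norm_power power_Suc)
      then show False using power_Suc_less_one[of "norm p" k] p \<open>p \<noteq> 0\<close> by simp
    qed
    ultimately show "etheta p 1 = 0 \<and> deriv (etheta p) 1 \<noteq> 0"
      by (auto simp: qpoch_eq_0_iff[OF p] etheta_1[OF p])
  next
    fix y :: complex assume "y \<noteq> 0"
    then show "etheta p (y * p) = 0 \<and> deriv (etheta p) (y * p) \<noteq> 0 \<longleftrightarrow> etheta p y = 0 \<and> deriv (etheta p) y \<noteq> 0"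
      using etheta_p_mult[OF p, of y] deriv_etheta_p_mult[of y] \<open>p \<noteq> 0\<close> by auto
  qed fact
  then show ?thesis by simp
qed

lemma open_nonzero:
  assumes "f holomorphic_on - {0 :: complex}"
  shows "open {x \<in> - {0}. f x \<noteq> 0}"
proof -
  have "open (f -` (- {0}) \<inter> - {0})"
    using continuous_on_open_vimage[of "- {0}" f] holomorphic_on_imp_continuous_on[OF assms]
    by (simp add: open_Compl)
  moreover have "f -` (- {0}) \<inter> - {0} = {x \<in> - {0}. f x \<noteq> 0}" by auto
  ultimately show ?thesis by simp
qed

text \<open>The zeros of theta are simple, so g/\<theta> has only removable singularities; at these
  \<open>r\<close> takes the value given by l'Hopital's rule.\<close>

lemma etheta_divides_1:
  assumes g: "g holomorphic_on - {0}" and zeros: "\<And>x. x \<noteq> 0 \<Longrightarrow> etheta p x = 0 \<Longrightarrow> g x = 0" and "p \<noteq> 0"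
  shows "\<exists>r. r holomorphic_on - {0} \<and> (\<forall>x. x \<noteq> 0 \<longrightarrow> g x = etheta p x * r x)"
proof -
  let ?C = "- {0 :: complex}"
  define r where "r x = (if etheta p x = 0 then deriv g x / deriv (etheta p) x else g x / etheta p x)" for x
  \<comment> \<open>Difference quotients with base point x, completed by the derivative. Around a
    common zero x the quotient g/\<theta> is the quotient of the two slopes, and the lower slope is
    nonzero at x.\<close>
  define slope where "slope f x y = (if y = x then deriv f x else (f y - f x) / (y - x))" for f and x y :: complex
  have slope_hol: "slope f x holomorphic_on ?C" if "f holomorphic_on ?C" "x \<noteq> 0" for f x
    unfolding slope_def by (rule pole_lemma[OF that(1)]) (use that in \<open>simp add: interior_open open_Compl\<close>)
  have diff: "r field_differentiable at x"
    if "f holomorphic_on ?C" "h holomorphic_on ?C" "x \<noteq> 0" "h x \<noteq> 0" "\<And>y. y \<noteq> 0 \<Longrightarrow> h y \<noteq> 0 \<Longrightarrow> f y / h y = r y" for f h x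
  proof (rule holomorphic_on_imp_differentiable_at)
    have "(\<lambda>y. f y / h y) holomorphic_on {y \<in> ?C. h y \<noteq> 0}"
      by (intro holomorphic_on_divide holomorphic_on_subset[OF that(1)] holomorphic_on_subset[OF that(2)]) auto
    then show "r holomorphic_on {y \<in> ?C. h y \<noteq> 0}"
      by (rule holomorphic_transform) (use that(5) in auto)
  qed (use open_nonzero[OF that(2)] that in auto)
  have "r field_differentiable at x" if x: "x \<noteq> 0" for x
  proof (cases "etheta p x = 0")
    case False
    then show ?thesis
      by (intro diff[OF g etheta_holomorphic[OF p] x]) (auto simp: r_def)
  next
    case True
    show ?thesis
      by (rule diff[OF slope_hol[OF g x] slope_hol[OF etheta_holomorphic[OF p] x] x])
        (use etheta_simple_zero[OF x True \<open>p \<noteq> 0\<close>] zeros[OF x True] True in \<open>auto simp: slope_def r_def\<close>)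
  qed
  then have "r holomorphic_on ?C"
    by (auto simp: holomorphic_on_def intro: field_differentiable_at_within)
  moreover have "g x = etheta p x * r x" if "x \<noteq> 0" for x
    using zeros[OF that] by (simp add: r_def)
  ultimately show ?thesis by blast
qed

lemma etheta_divides:
  assumes g: "g holomorphic_on - {0}" and "\<And>x. x \<noteq> 0 \<Longrightarrow> etheta p (\<gamma> * x) = 0 \<Longrightarrow> g x = 0" and "p \<noteq> 0" "\<gamma> \<noteq> 0"
  obtains r where "r holomorphic_on - {0}" "\<And>x. x \<noteq> 0 \<Longrightarrow> g x = etheta p (\<gamma> * x) * r x"
proof -
  have "(\<lambda>x. g (x / \<gamma>)) holomorphic_on - {0}"
    by (intro holomorphic_on_compose_gen[OF _ g, unfolded o_def] holomorphic_intros) (use \<open>\<gamma> \<noteq> 0\<close> in auto)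
  from etheta_divides_1[OF this] obtain r where r: "r holomorphic_on - {0}"
    "\<And>x. x \<noteq> 0 \<Longrightarrow> g (x / \<gamma>) = etheta p x * r x"
    using assms(2)[of "x / \<gamma>" for x] \<open>p \<noteq> 0\<close> \<open>\<gamma> \<noteq> 0\<close> by auto
  have "(\<lambda>x. r (\<gamma> * x)) holomorphic_on - {0}"
    by (intro holomorphic_on_compose_gen[OF _ r(1), unfolded o_def] holomorphic_intros) (use \<open>\<gamma> \<noteq> 0\<close> in auto)
  then show thesis
    using r(2)[of "\<gamma> * x" for x] \<open>\<gamma> \<noteq> 0\<close> by (intro that[of "\<lambda>x. r (\<gamma> * x)"]) auto
qed

text \<open>Moves the modulus of any nonzero point into the fundamental annulus by a power of
  \<open>p\<close>.\<close>

lemma exists_power_int_between: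
  fixes \<rho> y :: real
  assumes "0 < \<rho>" "\<rho> < 1" "0 < y"
  shows "\<exists>k. \<rho> \<le> y * \<rho> powi k \<and> y * \<rho> powi k \<le> 1"
proof -
  define k where "k = \<lceil>ln y / (- ln \<rho>)\<rceil>"
  have l: "ln \<rho> < 0" using assms by simp
  have "ln y / (- ln \<rho>) \<le> k" "k < ln y / (- ln \<rho>) + 1"
    unfolding k_def by linarith+
  then have "ln y + k * ln \<rho> \<le> 0" "ln \<rho> \<le> ln y + k * ln \<rho>"
    using l by (simp_all add: field_simps)
  moreover have "y * \<rho> powi k = exp (ln y + k * ln \<rho>)"
    using assms by (simp add: exp_add powr_real_of_int' powr_def flip: powr_real_of_int')
  ultimately show ?thesis
    using assms by (intro exI[of _ k]) (metis exp_le_cancel_iff exp_ln exp_zero)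
qed

text \<open>All values of \<open>r\<close> are already taken on the compact annulus between the
  radii |p| and 1. Composition with exp turns \<open>r\<close> into a bounded entire function, which
  disposes of the puncture at 0.\<close>

lemma elliptic_holomorphic_constant:
  assumes r: "r holomorphic_on - {0}" and per: "\<And>x. x \<noteq> 0 \<Longrightarrow> r (x * p) = r x" and "p \<noteq> 0"
  obtains c where "\<And>x. x \<noteq> 0 \<Longrightarrow> r x = c"
proof -
  have iter: "r (x * p powi k) = r x" if "x \<noteq> 0" for x k
  proof (induction k rule: int_induct[where k = 0])
    case (step1 i)
    then show ?case using per[of "x * p powi i"] that \<open>p \<noteq> 0\<close> by (simp add: power_int_add mult.assoc)
  next
    case (step2 i)
    then show ?case using per[of "x * p powi (i - 1)"] that \<open>p \<noteq> 0\<close>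
      by (simp add: power_int_diff mult.assoc)
  qed auto
  let ?A = "cball 0 1 - ball 0 (norm p) :: complex set"
  have "compact (r ` ?A)"
    by (intro compact_continuous_image compact_diff holomorphic_on_imp_continuous_on holomorphic_on_subset[OF r])
      (use \<open>p \<noteq> 0\<close> in auto)
  then have bdd: "bounded (r ` ?A)" by (rule compact_imp_bounded)
  have "range (\<lambda>z. r (exp z)) \<subseteq> r ` ?A"
  proof safe
    fix z :: complex
    obtain k where k: "norm p \<le> norm (exp z) * norm p powi k" "norm (exp z) * norm p powi k \<le> 1"
      using exists_power_int_between[of "norm p" "norm (exp z)"] p \<open>p \<noteq> 0\<close> by auto
    have "r (exp z) = r (exp z * p powi k)" using iter by simp
    moreover have "exp z * p powi k \<in> ?A"
      using k by (simp add: norm_mult norm_power_int)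
    ultimately show "r (exp z) \<in> r ` ?A" by blast
  qed
  then have "bounded (range (\<lambda>z. r (exp z)))"
    using bdd bounded_subset by blast
  moreover have "(\<lambda>z. r (exp z)) holomorphic_on UNIV"
    by (intro holomorphic_on_compose_gen[OF _ r, unfolded o_def] holomorphic_intros) auto
  ultimately have "(\<lambda>z. r (exp z)) constant_on UNIV"
    by (intro Liouville_theorem)
  then obtain c where "\<And>z. r (exp z) = c" by (auto simp: constant_on_def)
  then show thesis
    using that[of c] by (metis exp_Ln)
qed

text \<open>Weierstrass's three-term identity, arranged as an exchange: two given factors become a
  product containing the prescribed factor \<theta>(\<gamma> x), up to a multiple of
  \<theta>(x/\<beta>). The difference h of the two sides is multiplied by 1/(\<alpha>1 \<alpha>2
  x^2) under x -> x p, like \<theta>(\<gamma> x) \<theta>(\<alpha>1 \<alpha>2 x/\<gamma>). It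
  vanishes at the zeros of both of these factors, so it is a constant multiple of their product; as
  it also vanishes at \<beta>, where the product does not, the constant is 0. For p = 0 everything
  is a polynomial identity.\<close>

lemma etheta_three_term:
  fixes \<alpha>1 \<alpha>2 \<beta> \<gamma> x :: complex
  assumes nz: "\<alpha>1 \<noteq> 0" "\<alpha>2 \<noteq> 0" "\<beta> \<noteq> 0" "\<gamma> \<noteq> 0" "x \<noteq> 0"
    and gen: "etheta p (\<gamma> * \<gamma> / (\<alpha>1 * \<alpha>2)) \<noteq> 0" "etheta p (\<gamma> * \<beta>) \<noteq> 0" "etheta p (\<alpha>1 * \<alpha>2 * \<beta> / \<gamma>) \<noteq> 0"
  shows "etheta p (\<gamma> * \<beta>) * etheta p (\<alpha>1 * \<alpha>2 * \<beta> / \<gamma>) * (etheta p (\<alpha>1 * x) * etheta p (\<alpha>2 * x)) =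
    etheta p (\<alpha>1 * \<beta>) * etheta p (\<alpha>2 * \<beta>) * (etheta p (\<gamma> * x) * etheta p (\<alpha>1 * \<alpha>2 / \<gamma> * x))
    - \<gamma> * \<beta> * etheta p (\<alpha>1 / \<gamma>) * etheta p (\<alpha>2 / \<gamma>) * (etheta p (x / \<beta>) * etheta p (\<alpha>1 * \<alpha>2 * \<beta> * x))"
proof (cases "p = 0")
  case True
  show ?thesis
    using nz by (simp add: True etheta_0 field_simps)
next
  case False
  define \<nu> where "\<nu> = \<alpha>1 * \<alpha>2"
  have \<nu>: "\<nu> \<noteq> 0" using nz by (simp add: \<nu>_def)
  let ?A = "\<gamma> * \<beta> * etheta p (\<alpha>1 / \<gamma>) * etheta p (\<alpha>2 / \<gamma>)" and ?B = "etheta p (\<gamma> * \<beta>) * etheta p (\<nu> * \<beta> / \<gamma>)"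
  define h where "h x = ?B * (etheta p (\<alpha>1 * x) * etheta p (\<alpha>2 * x))
    - etheta p (\<alpha>1 * \<beta>) * etheta p (\<alpha>2 * \<beta>) * (etheta p (\<gamma> * x) * etheta p (\<nu> / \<gamma> * x))
    + ?A * (etheta p (x / \<beta>) * etheta p (\<nu> * \<beta> * x))" for x
  have pair_step: "etheta p (a * (x * p)) * etheta p (b * (x * p)) = etheta p (a * x) * etheta p (b * x) / (a * b * x * x)"
    if "a \<noteq> 0" "b \<noteq> 0" "x \<noteq> 0" for a b x
    using etheta_p_mult[OF p, of "a * x"] etheta_p_mult[OF p, of "b * x"] that False
    by (simp add: mult_ac)
  have h_step: "h (x * p) = h x / (\<nu> * x * x)" if "x \<noteq> 0" for x
    unfolding h_def
    using pair_step[OF nz(1,2) that] pair_step[of \<gamma> "\<nu> / \<gamma>" x] pair_step[of "1 / \<beta>" "\<nu> * \<beta>" x] that nz \<nu>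
    by (simp add: \<nu>_def[symmetric] add_divide_distrib diff_divide_distrib)
  have h_hol: "h holomorphic_on - {0}"
    unfolding h_def
    by (intro holomorphic_intros etheta_compose_holomorphic) (use nz \<nu> in auto)
  have h0: "h (1 / \<gamma>) = 0"
  proof -
    have "etheta p (1 / (\<beta> * \<gamma>)) = - etheta p (\<beta> * \<gamma>) / (\<beta> * \<gamma>)"
      using etheta_inverse[OF p, of "\<beta> * \<gamma>"] nz by simp
    note E = this
    have "h (1 / \<gamma>) = ?B * (etheta p (\<alpha>1 / \<gamma>) * etheta p (\<alpha>2 / \<gamma>))
        + ?A * (etheta p (1 / (\<beta> * \<gamma>)) * etheta p (\<nu> * \<beta> / \<gamma>))"
      using nz by (simp add: h_def etheta_1[OF p] mult_ac)
    also have "\<dots> = 0"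
      unfolding E using nz by (simp add: mult_ac)
    finally show ?thesis .
  qed
  have h1: "h (\<gamma> / \<nu>) = 0"
  proof -
    have "etheta p (\<alpha>1 * (\<gamma> / \<nu>)) = - \<gamma> / \<alpha>2 * etheta p (\<alpha>2 / \<gamma>)"
      using etheta_swap[OF p, of \<gamma> \<alpha>2] nz by (simp add: \<nu>_def)
    moreover have "etheta p (\<alpha>2 * (\<gamma> / \<nu>)) = - \<gamma> / \<alpha>1 * etheta p (\<alpha>1 / \<gamma>)"
      using etheta_swap[OF p, of \<gamma> \<alpha>1] nz by (simp add: \<nu>_def)
    moreover have "etheta p (\<gamma> / \<nu> / \<beta>) = - \<gamma> / (\<nu> * \<beta>) * etheta p (\<nu> * \<beta> / \<gamma>)"
      using etheta_swap[OF p, of \<gamma> "\<nu> * \<beta>"] nz \<nu> by simp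
    moreover have "h (\<gamma> / \<nu>) = ?B *
          (etheta p (\<alpha>1 * (\<gamma> / \<nu>)) * etheta p (\<alpha>2 * (\<gamma> / \<nu>)))
        + ?A * (etheta p (\<gamma> / \<nu> / \<beta>) * etheta p (\<gamma> * \<beta>))"
      using nz \<nu> by (simp add: h_def etheta_1[OF p] mult_ac)
    ultimately have "h (\<gamma> / \<nu>) = ?B *
          (- \<gamma> / \<alpha>2 * etheta p (\<alpha>2 / \<gamma>) * (- \<gamma> / \<alpha>1 * etheta p (\<alpha>1 / \<gamma>)))
        + ?A * (- \<gamma> / (\<nu> * \<beta>) * etheta p (\<nu> * \<beta> / \<gamma>) * etheta p (\<gamma> * \<beta>))"
      by simp
    also have "\<dots> = 0"
      using nz by (simp add: \<nu>_def field_simps)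
    finally show ?thesis .
  qed
  have h_zero: "h (y / \<delta>) = 0" if "h (1 / \<delta>) = 0" "etheta p y = 0" "y \<noteq> 0" "\<delta> \<noteq> 0" for y \<delta>
    by (rule etheta_zero_induct[of y "\<lambda>y. h (y / \<delta>) = 0"])
      (use that False \<nu> h_step[of "y / \<delta>" for y] in \<open>auto simp: mult_ac\<close>)
  obtain r1 where r1: "r1 holomorphic_on - {0}" "\<And>x. x \<noteq> 0 \<Longrightarrow> h x = etheta p (\<gamma> * x) * r1 x"
  proof (rule etheta_divides[OF h_hol, of \<gamma>])
    fix x assume "x \<noteq> 0" "etheta p (\<gamma> * x) = 0"
    then show "h x = 0" using h_zero[OF h0, of "\<gamma> * x"] nz by simp
  qed (use False nz in auto)
  obtain r where r: "r holomorphic_on - {0}" "\<And>x. x \<noteq> 0 \<Longrightarrow> r1 x = etheta p (\<nu> / \<gamma> * x) * r x"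
  proof (rule etheta_divides[OF r1(1), of "\<nu> / \<gamma>"])
    fix x assume x: "x \<noteq> 0" "etheta p (\<nu> / \<gamma> * x) = 0"
    then have "h x = 0" using h_zero[of "\<nu> / \<gamma>" "\<nu> / \<gamma> * x"] h1 nz \<nu> by simp
    \<comment> \<open>By \<open>gen(1)\<close> the orbits of 1/\<gamma> and \<gamma>/\<nu> are
      disjoint, so the zero of h at x is not due to the factor split off before and must come from
      \<open>r1\<close>.\<close>
    moreover have "etheta p (\<gamma> * x) \<noteq> 0"
    proof -
      have "etheta p (\<gamma> * (y / (\<nu> / \<gamma>))) \<noteq> 0" if "y \<noteq> 0" "etheta p y = 0" for y
      proof (rule etheta_zero_induct[of y "\<lambda>y. etheta p (\<gamma> * (y / (\<nu> / \<gamma>))) \<noteq> 0"])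
        fix y :: complex assume "y \<noteq> 0"
        then show "etheta p (\<gamma> * (y * p / (\<nu> / \<gamma>))) \<noteq> 0 \<longleftrightarrow> etheta p (\<gamma> * (y / (\<nu> / \<gamma>))) \<noteq> 0"
          using etheta_p_mult[OF p, of "\<gamma> * (y / (\<nu> / \<gamma>))"] nz \<nu> False by (simp add: mult_ac)
      qed (use that gen(1) False nz in \<open>auto simp: \<nu>_def mult_ac\<close>)
      from this[of "\<nu> / \<gamma> * x"] show ?thesis using x nz \<nu> by simp
    qed
    ultimately show "r1 x = 0" using r1(2)[OF x(1)] by simp
  qed (use False nz \<nu> in auto)
  have hr: "h x = etheta p (\<gamma> * x) * etheta p (\<nu> / \<gamma> * x) * r x" if "x \<noteq> 0" for x
    using r1(2) r(2) that by simp
  let ?k = "\<lambda>x. etheta p (\<gamma> * x) * etheta p (\<nu> / \<gamma> * x)"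
  \<comment> \<open>Periodicity of r can be read off only where \<open>?k\<close> is nonzero. This
    is an open set containing \<beta>, and the identity theorem extends the equation to the
    punctured plane.\<close>
  have "r (x * p) = r x" if "x \<noteq> 0" for x
  proof (rule analytic_continuation_open[of "{x \<in> - {0}. ?k x \<noteq> 0}" "- {0}" "\<lambda>x. r (x * p)" r])
    show "open {x \<in> - {0}. ?k x \<noteq> 0}"
      by (intro open_nonzero holomorphic_intros etheta_compose_holomorphic) (use nz \<nu> in auto)
    show "{x \<in> - {0}. ?k x \<noteq> 0} \<noteq> {}"
      using gen nz by (auto simp: \<nu>_def mult_ac intro!: exI[of _ \<beta>])
    show "connected (- {0 :: complex})"
      by (rule connected_punctured_universe) simp
    show "(\<lambda>x. r (x * p)) holomorphic_on - {0}"
      by (intro holomorphic_intros holomorphic_on_compose_gen[OF _ r(1), unfolded o_def]) (use False in auto)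
    fix x assume "x \<in> {x \<in> - {0}. ?k x \<noteq> 0}"
    then have x: "x \<noteq> 0" "?k x \<noteq> 0" by auto
    have "?k x / (\<nu> * x * x) * r (x * p) = h (x * p)"
      using hr[of "x * p"] pair_step[of \<gamma> "\<nu> / \<gamma>" x] x(1) nz \<nu> False by simp
    also have "\<dots> = ?k x * r x / (\<nu> * x * x)"
      using h_step[OF x(1)] hr[OF x(1)] by simp
    finally show "r (x * p) = r x"
      using x \<nu> by (simp add: divide_simps)
  qed (use that r in \<open>auto simp: open_Compl\<close>)
  then obtain c where c: "\<And>x. x \<noteq> 0 \<Longrightarrow> r x = c"
    using elliptic_holomorphic_constant[OF r(1)] False by metis
  have "h \<beta> = 0" using nz by (simp add: h_def \<nu>_def etheta_1[OF p] mult_ac)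
  then have "c = 0"
    using hr[of \<beta>] c[of \<beta>] gen nz by (simp add: \<nu>_def mult_ac)
  then have "h x = 0" using hr c nz by simp
  then show ?thesis by (simp add: h_def \<nu>_def algebra_simps)
qed

end

subsection \<open>Spaces of theta functions\<close>

text \<open>For nonzero \<open>p\<close> such a function satisfies f(p x) = (-1)^D f(x)/(\<nu> x^D).
  For p = 0 this says nothing, whereas the products are then polynomials of degree at most D whose
  coefficient at x^D is (-1)^D \<nu> times the constant one. Taking the span of the products as
  definition covers both cases. The last rule disregards the value at 0.\<close>

inductive theta_fun :: "complex \<Rightarrow> nat \<Rightarrow> complex \<Rightarrow> (complex \<Rightarrow> complex) \<Rightarrow> bool" for p where
  theta_fun_prod_list:
    "0 \<notin> set as \<Longrightarrow> theta_fun p (length as) (prod_list as) (\<lambda>x. \<Prod>\<alpha>\<leftarrow>as. etheta p (\<alpha> * x))"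
| theta_fun_zero: "theta_fun p D \<nu> (\<lambda>x. 0)"
| theta_fun_add: "theta_fun p D \<nu> f \<Longrightarrow> theta_fun p D \<nu> g \<Longrightarrow> theta_fun p D \<nu> (\<lambda>x. f x + g x)"
| theta_fun_scale: "theta_fun p D \<nu> f \<Longrightarrow> theta_fun p D \<nu> (\<lambda>x. c * f x)"
| theta_fun_cong: "theta_fun p D \<nu> f \<Longrightarrow> (\<And>x. x \<noteq> 0 \<Longrightarrow> g x = f x) \<Longrightarrow> theta_fun p D \<nu> g"

lemma theta_fun_etheta: "\<alpha> \<noteq> 0 \<Longrightarrow> theta_fun p 1 \<alpha> (\<lambda>x. etheta p (\<alpha> * x))"
  using theta_fun_prod_list[of "[\<alpha>]" p] by simp

lemma theta_fun_1: "theta_fun p 0 1 (\<lambda>x. 1)"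
  using theta_fun_prod_list[of "[]" p] by simp

lemma theta_fun_mult:
  assumes "theta_fun p D \<nu> f" "theta_fun p E \<mu> g"
  shows "theta_fun p (D + E) (\<nu> * \<mu>) (\<lambda>x. f x * g x)"
  using assms
proof (induction rule: theta_fun.induct)
  case (theta_fun_prod_list as)
  from theta_fun_prod_list(2,1) show ?case
  proof (induction rule: theta_fun.induct)
    case (theta_fun_prod_list bs)
    then show ?case
      using theta_fun.theta_fun_prod_list[of "as @ bs" p] by simp
  next
    case (theta_fun_zero D \<nu>)
    then show ?case by (simp add: theta_fun.theta_fun_zero)
  next
    case (theta_fun_add D \<nu> f g)
    then show ?case
      by (auto simp: algebra_simps intro: theta_fun.theta_fun_add)
  next
    case (theta_fun_scale D \<nu> f c)
    then show ?case
      using theta_fun.theta_fun_scale[of p _ _ "\<lambda>x. (\<Prod>\<alpha>\<leftarrow>as. etheta p (\<alpha> * x)) * f x" c]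
      by (simp add: mult_ac)
  next
    case (theta_fun_cong D \<nu> f g)
    then show ?case by (auto intro: theta_fun.theta_fun_cong)
  qed
next
  case (theta_fun_zero D \<nu>)
  then show ?case by (simp add: theta_fun.theta_fun_zero)
next
  case (theta_fun_add D \<nu> f g)
  then show ?case
    by (auto simp: algebra_simps intro: theta_fun.theta_fun_add)
next
  case (theta_fun_scale D \<nu> f c)
  then show ?case
    using theta_fun.theta_fun_scale[of p _ _ "\<lambda>x. f x * g x" c] by (simp add: mult_ac)
next
  case (theta_fun_cong D \<nu> f g)
  then show ?case by (auto intro: theta_fun.theta_fun_cong)
qed

lemma theta_fun_prod:
  assumes "finite J" "\<And>j. j \<in> J \<Longrightarrow> theta_fun p (D j) (\<nu> j) (f j)"
  shows "theta_fun p (\<Sum>j\<in>J. D j) (\<Prod>j\<in>J. \<nu> j) (\<lambda>x. \<Prod>j\<in>J. f j x)"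
  using assms by (induction J) (auto intro: theta_fun_1 theta_fun_mult)

lemma theta_fun_sum:
  assumes "\<And>j. j \<in> J \<Longrightarrow> theta_fun p D \<nu> (f j)"
  shows "theta_fun p D \<nu> (\<lambda>x. \<Sum>j\<in>J. f j x)"
proof (cases "finite J")
  case True
  then show ?thesis
    using assms by (induction J) (auto intro: theta_fun_zero theta_fun_add)
qed (simp add: theta_fun_zero)

section \<open>Zeros of theta functions: a factor theorem and a vanishing criterion\<close>

context
  fixes p :: complex
  assumes p: "norm p < 1"
begin

text \<open>The modulus is strictly monotone along the curve c exp(w r), so the curve meets each of
  the countably many zeros at most once. This serves twice: for the choice of \<gamma> in the
  exchange of parameters, and for the deformation to generic parameters at the end.\<close>

lemma countable_etheta_exp_zero:
  fixes w :: real
  assumes "c \<noteq> 0" "w \<noteq> 0"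
  shows "countable {r. etheta p (c * exp (of_real (w * r))) = 0}"
proof (rule countable_image_inj_on)
  let ?f = "\<lambda>r. c * exp (of_real (w * r)) :: complex"
  show "countable (?f ` {r. etheta p (?f r) = 0})"
    by (rule countable_subset[OF _ countable_zeros_etheta[OF p]]) (use assms in auto)
  have "norm (?f r) = norm c * exp (w * r)" for r
    by (simp add: norm_mult)
  then have "r = r'" if "?f r = ?f r'" for r r'
    using arg_cong[OF that, of norm] assms by simp
  then show "inj_on ?f {r. etheta p (?f r) = 0}"
    by (intro inj_onI)
qed

text \<open>The conditions under which repeated use of the three-term relation turns the factors with
  parameters \<open>\<alpha>\<close>, \<open>as\<close> into factors with parameter \<open>\<gamma>\<close>, up to a multiple of \<open>\<theta>(x/\<beta>)\<close>.\<close>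

fun exchangeable :: "complex \<Rightarrow> complex \<Rightarrow> complex \<Rightarrow> complex list \<Rightarrow> bool" where
  "exchangeable \<beta> \<gamma> \<alpha> [] = True"
| "exchangeable \<beta> \<gamma> \<alpha> (\<alpha>' # as) =
    (etheta p (\<gamma> * \<gamma> / (\<alpha> * \<alpha>')) \<noteq> 0 \<and> etheta p (\<alpha> * \<alpha>' * \<beta> / \<gamma>) \<noteq> 0 \<and> exchangeable \<beta> \<gamma> (\<alpha> * \<alpha>' / \<gamma>) as)"

text \<open>With \<gamma> = exp r the parameter carried along after n exchanges is a constant times
  exp(- n r), whence the form of the statement and the free n in the induction. The conditions
  involve exp((n + 2) r) and exp(- (n + 1) r), and these exponents never degenerate.\<close>

lemma countable_not_exchangeable:
  assumes "\<beta> \<noteq> 0" "\<alpha> \<noteq> 0" "0 \<notin> set as"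
  shows "countable {r. \<not> exchangeable \<beta> (exp (of_real r)) (\<alpha> * exp (of_real (- real n * r))) as}"
  using assms
proof (induction as arbitrary: \<alpha> n)
  case (Cons \<alpha>' as)
  let ?e = "\<lambda>r. exp (of_real r) :: complex"
  let ?bad = "\<lambda>c w. {r. etheta p (c * ?e (w * r)) = 0}"
  have e2: "?e r * ?e r = exp (of_real r * 2)" for r
    by (metis exp_add mult_2_right)
  have eqs: "?e r * ?e r / (\<alpha> * ?e (- real n * r) * \<alpha>') = 1 / (\<alpha> * \<alpha>') * ?e ((real n + 2) * r)"
    "\<alpha> * ?e (- real n * r) * \<alpha>' * \<beta> / ?e r = \<alpha> * \<alpha>' * \<beta> * ?e (- (real n + 1) * r)"
    "\<alpha> * ?e (- real n * r) * \<alpha>' / ?e r = \<alpha> * \<alpha>' * ?e (- real (Suc n) * r)" for r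
    using Cons.prems
    by (simp_all add: field_simps exp_add exp_diff exp_minus e2)
  have "{r. \<not> exchangeable \<beta> (?e r) (\<alpha> * ?e (- real n * r)) (\<alpha>' # as)} \<subseteq>
      ?bad (1 / (\<alpha> * \<alpha>')) (real n + 2) \<union> ?bad (\<alpha> * \<alpha>' * \<beta>) (- (real n + 1)) \<union>
      {r. \<not> exchangeable \<beta> (?e r) (\<alpha> * \<alpha>' * ?e (- real (Suc n) * r)) as}"
    unfolding exchangeable.simps eqs by blast
  moreover have "countable \<dots>"
    by (intro countable_Un countable_etheta_exp_zero Cons.IH) (use Cons.prems in auto)
  ultimately show ?case
    by (rule countable_subset)
qed simp

text \<open>Applied to the carried factor and the next one, the three-term relation yields
  \<theta>(\<gamma> x), the new carried parameter \<alpha> \<alpha>'/\<gamma>, and a multiple of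
  \<theta>(x/\<beta>). The function left at the end depends on the list only through its length and
  its product.\<close>

lemma theta_fun_exchange_list:
  assumes "\<beta> \<noteq> 0" "\<gamma> \<noteq> 0" "\<alpha> \<noteq> 0" "0 \<notin> set as" "etheta p (\<gamma> * \<beta>) \<noteq> 0" "exchangeable \<beta> \<gamma> \<alpha> as"
  shows "\<exists>C h. theta_fun p (length as) (\<alpha> * prod_list as * \<beta>) h \<and>
    (\<forall>x. x \<noteq> 0 \<longrightarrow> (\<Prod>a\<leftarrow>\<alpha> # as. etheta p (a * x)) =
      etheta p (x / \<beta>) * h x + C * (etheta p (\<gamma> * x) ^ length as * etheta p (\<alpha> * prod_list as / \<gamma> ^ length as * x)))"
  using assms
proof (induction as arbitrary: \<alpha>)
  case Nil
  then show ?case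
    by (intro exI[of _ 1] exI[of _ "\<lambda>x. 0"]) (auto intro: theta_fun_zero)
next
  case (Cons \<alpha>' as)
  let ?d = "etheta p (\<gamma> * \<beta>) * etheta p (\<alpha> * \<alpha>' * \<beta> / \<gamma>)"
  define A where "A = - \<gamma> * \<beta> * etheta p (\<alpha> / \<gamma>) * etheta p (\<alpha>' / \<gamma>) / ?d"
  define B where "B = etheta p (\<alpha> * \<beta>) * etheta p (\<alpha>' * \<beta>) / ?d"
  let ?P = "\<lambda>x. \<Prod>a\<leftarrow>as. etheta p (a * x)"
  have nz: "\<alpha>' \<noteq> 0" "0 \<notin> set as" "?d \<noteq> 0" "etheta p (\<gamma> * \<gamma> / (\<alpha> * \<alpha>')) \<noteq> 0"
    using Cons.prems by auto
  from Cons.IH[of "\<alpha> * \<alpha>' / \<gamma>"] Cons.prems obtain C h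
    where h: "theta_fun p (length as) (\<alpha> * \<alpha>' / \<gamma> * prod_list as * \<beta>) h"
      and eq: "\<And>x. x \<noteq> 0 \<Longrightarrow> etheta p (\<alpha> * \<alpha>' / \<gamma> * x) * ?P x =
        etheta p (x / \<beta>) * h x + C * (etheta p (\<gamma> * x) ^ length as * etheta p (\<alpha> * \<alpha>' / \<gamma> * prod_list as / \<gamma> ^ length as * x))"
    by auto
  let ?h = "\<lambda>x. A * (etheta p (\<alpha> * \<alpha>' * \<beta> * x) * ?P x) + B * (etheta p (\<gamma> * x) * h x)"
  have "theta_fun p (1 + length as) (\<alpha> * \<alpha>' * \<beta> * prod_list as) (\<lambda>x. etheta p (\<alpha> * \<alpha>' * \<beta> * x) * ?P x)"
    using nz Cons.prems by (intro theta_fun_mult theta_fun_etheta theta_fun_prod_list) auto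
  moreover have "theta_fun p (1 + length as) (\<gamma> * (\<alpha> * \<alpha>' / \<gamma> * prod_list as * \<beta>)) (\<lambda>x. etheta p (\<gamma> * x) * h x)"
    using nz Cons.prems by (intro theta_fun_mult theta_fun_etheta h) auto
  ultimately have "theta_fun p (length (\<alpha>' # as)) (\<alpha> * prod_list (\<alpha>' # as) * \<beta>) ?h"
    using Cons.prems by (intro theta_fun_add theta_fun_scale) (simp_all add: mult_ac)
  moreover have "(\<Prod>a\<leftarrow>\<alpha> # \<alpha>' # as. etheta p (a * x)) = etheta p (x / \<beta>) * ?h x + B * C *
      (etheta p (\<gamma> * x) ^ length (\<alpha>' # as) * etheta p (\<alpha> * prod_list (\<alpha>' # as) / \<gamma> ^ length (\<alpha>' # as) * x))"
    if x: "x \<noteq> 0" for x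
  proof -
    have "?d * (etheta p (\<alpha> * x) * etheta p (\<alpha>' * x)) =
        etheta p (\<alpha> * \<beta>) * etheta p (\<alpha>' * \<beta>) * (etheta p (\<gamma> * x) * etheta p (\<alpha> * \<alpha>' / \<gamma> * x))
        - \<gamma> * \<beta> * etheta p (\<alpha> / \<gamma>) * etheta p (\<alpha>' / \<gamma>) * (etheta p (x / \<beta>) * etheta p (\<alpha> * \<alpha>' * \<beta> * x))"
      by (rule etheta_three_term[OF p]) (use Cons.prems x in auto)
    then have "etheta p (\<alpha> * x) * etheta p (\<alpha>' * x) =
        (etheta p (\<alpha> * \<beta>) * etheta p (\<alpha>' * \<beta>) * (etheta p (\<gamma> * x) * etheta p (\<alpha> * \<alpha>' / \<gamma> * x))
        - \<gamma> * \<beta> * etheta p (\<alpha> / \<gamma>) * etheta p (\<alpha>' / \<gamma>) * (etheta p (x / \<beta>) * etheta p (\<alpha> * \<alpha>' * \<beta> * x))) / ?d"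
      using nz(3) by (subst nonzero_eq_divide_eq[OF nz(3)]) (simp only: mult.commute)
    then have three: "etheta p (\<alpha> * x) * etheta p (\<alpha>' * x) =
        B * (etheta p (\<gamma> * x) * etheta p (\<alpha> * \<alpha>' / \<gamma> * x)) + A * (etheta p (x / \<beta>) * etheta p (\<alpha> * \<alpha>' * \<beta> * x))"
      by (simp add: A_def B_def diff_divide_distrib)
    have "(\<Prod>a\<leftarrow>\<alpha> # \<alpha>' # as. etheta p (a * x)) = etheta p (\<alpha> * x) * etheta p (\<alpha>' * x) * ?P x"
      by simp
    also have "\<dots> = B * etheta p (\<gamma> * x) * (etheta p (\<alpha> * \<alpha>' / \<gamma> * x) * ?P x)
        + A * (etheta p (x / \<beta>) * etheta p (\<alpha> * \<alpha>' * \<beta> * x)) * ?P x"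
      unfolding three by (simp add: distrib_right mult.assoc)
    also have "\<dots> = etheta p (x / \<beta>) * ?h x + B * C * (etheta p (\<gamma> * x) ^ Suc (length as)
        * etheta p (\<alpha> * \<alpha>' / \<gamma> * prod_list as / \<gamma> ^ length as * x))"
      unfolding eq[OF x] power_Suc by (simp only: distrib_left distrib_right mult_ac add_ac)
    finally show ?thesis by (simp add: mult_ac)
  qed
  ultimately show ?case by blast
qed

text \<open>The remainder is a multiple of one function determined by D, \<nu> and r, so the
  remainders of several summands can be added. This requires the same r for all summands; hence r is
  a parameter, to be chosen outside a countable set, and not an existential witness for each
  summand.\<close>

definition reduces_at :: "complex \<Rightarrow> nat \<Rightarrow> complex \<Rightarrow> (complex \<Rightarrow> complex) \<Rightarrow> real \<Rightarrow> bool" where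
  "reduces_at \<beta> D \<nu> g r \<longleftrightarrow> (\<exists>C h. theta_fun p D (\<nu> * \<beta>) h \<and> (\<forall>x. x \<noteq> 0 \<longrightarrow> g x = etheta p (x / \<beta>) * h x
      + C * (etheta p (exp (of_real r) * x) ^ D * etheta p (\<nu> / exp (of_real r) ^ D * x))))"

lemma theta_fun_exchange:
  assumes "theta_fun p (Suc D) \<nu> g" "\<beta> \<noteq> 0"
  shows "\<exists>B. countable B \<and> (\<forall>r. r \<notin> B \<longrightarrow> reduces_at \<beta> D \<nu> g r)"
  using assms
proof (induction "Suc D" \<nu> g rule: theta_fun.induct)
  case (theta_fun_prod_list as)
  then obtain \<alpha> bs where as: "as = \<alpha> # bs" by (cases as) auto
  let ?B = "{r. \<not> exchangeable \<beta> (exp (of_real r)) (\<alpha> * exp (of_real (- real 0 * r))) bs} \<union>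
    {r. etheta p (\<beta> * exp (of_real (1 * r))) = 0}"
  have "countable ?B"
    by (intro countable_Un countable_not_exchangeable countable_etheta_exp_zero) (use theta_fun_prod_list as in auto)
  moreover have "reduces_at \<beta> D (prod_list as) (\<lambda>x. \<Prod>\<alpha>\<leftarrow>as. etheta p (\<alpha> * x)) r" if "r \<notin> ?B" for r
    using theta_fun_exchange_list[of \<beta> "exp (of_real r)" \<alpha> bs] that theta_fun_prod_list as
    by (simp add: mult_ac reduces_at_def)
  ultimately show ?case by blast
next
  case (theta_fun_zero \<nu>)
  have "reduces_at \<beta> D \<nu> (\<lambda>x. 0) r" for r
    unfolding reduces_at_def by (auto intro!: exI[of _ 0] exI[of _ "\<lambda>x. 0"] theta_fun.theta_fun_zero)
  then show ?case by blast
next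
  case (theta_fun_add \<nu> f g)
  then obtain B1 B2 where B: "countable B1" "countable B2"
    "\<And>r. r \<notin> B1 \<Longrightarrow> reduces_at \<beta> D \<nu> f r" "\<And>r. r \<notin> B2 \<Longrightarrow> reduces_at \<beta> D \<nu> g r"
    by metis
  have "reduces_at \<beta> D \<nu> (\<lambda>x. f x + g x) r" if red: "reduces_at \<beta> D \<nu> f r" "reduces_at \<beta> D \<nu> g r" for r
  proof -
    let ?q = "\<lambda>x. etheta p (exp (of_real r) * x) ^ D * etheta p (\<nu> / exp (of_real r) ^ D * x)"
    from red obtain C1 h1 C2 h2 where
      "theta_fun p D (\<nu> * \<beta>) h1" "\<And>x. x \<noteq> 0 \<Longrightarrow> f x = etheta p (x / \<beta>) * h1 x + C1 * ?q x"
      "theta_fun p D (\<nu> * \<beta>) h2" "\<And>x. x \<noteq> 0 \<Longrightarrow> g x = etheta p (x / \<beta>) * h2 x + C2 * ?q x"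
      unfolding reduces_at_def by blast
    then show ?thesis
      unfolding reduces_at_def
      by (intro exI[of _ "C1 + C2"] exI[of _ "\<lambda>x. h1 x + h2 x"])
        (auto simp: distrib_left distrib_right intro: theta_fun.theta_fun_add)
  qed
  then show ?case using B by (intro exI[of _ "B1 \<union> B2"]) auto
next
  case (theta_fun_scale \<nu> f c)
  then obtain B where B: "countable B" "\<And>r. r \<notin> B \<Longrightarrow> reduces_at \<beta> D \<nu> f r"
    by metis
  have "reduces_at \<beta> D \<nu> (\<lambda>x. c * f x) r" if red: "reduces_at \<beta> D \<nu> f r" for r
  proof -
    let ?q = "\<lambda>x. etheta p (exp (of_real r) * x) ^ D * etheta p (\<nu> / exp (of_real r) ^ D * x)"
    from red obtain C h where
      "theta_fun p D (\<nu> * \<beta>) h" "\<And>x. x \<noteq> 0 \<Longrightarrow> f x = etheta p (x / \<beta>) * h x + C * ?q x"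
      unfolding reduces_at_def by blast
    then show ?thesis
      unfolding reduces_at_def by (intro exI[of _ "c * C"] exI[of _ "\<lambda>x. c * h x"])
        (auto simp: distrib_left mult_ac intro: theta_fun.theta_fun_scale)
  qed
  then show ?case using B by (intro exI[of _ B]) auto
next
  case (theta_fun_cong \<nu> f g)
  then show ?case by (simp add: reduces_at_def)
qed

text \<open>In the reduction at \<beta> the remainder function is nonzero at \<beta> for suitable r,
  so g(\<beta>) = 0 forces C = 0. For D = 0 that function is \<theta>(\<nu> x), on which r has no
  influence; this explains the alternative in the last assumption.\<close>

lemma theta_fun_factor:
  assumes g: "theta_fun p (Suc D) \<nu> g" and "\<nu> \<noteq> 0" "\<beta> \<noteq> 0" "g \<beta> = 0" and D: "D > 0 \<or> etheta p (\<nu> * \<beta>) \<noteq> 0"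
  obtains h where "theta_fun p D (\<nu> * \<beta>) h" "\<And>x. x \<noteq> 0 \<Longrightarrow> g x = etheta p (x / \<beta>) * h x"
proof -
  from theta_fun_exchange[OF g \<open>\<beta> \<noteq> 0\<close>] obtain B where "countable B"
    and B: "\<And>r. r \<notin> B \<Longrightarrow> reduces_at \<beta> D \<nu> g r"
    by metis
  let ?e = "\<lambda>r. exp (of_real r) :: complex"
  let ?B1 = "{r. etheta p (\<beta> * ?e (1 * r)) = 0}" and ?B2 = "{r. etheta p (\<nu> * \<beta> * ?e (- real D * r)) = 0}"
  have "countable ?B1"
    by (rule countable_etheta_exp_zero) (use assms in auto)
  moreover have "countable ?B2"
  proof (cases "D = 0")
    case False
    then show ?thesis
      by (intro countable_etheta_exp_zero) (use assms in auto)
  qed (use D in simp)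
  ultimately have "countable (B \<union> ?B1 \<union> ?B2)"
    using \<open>countable B\<close> by blast
  then have "B \<union> ?B1 \<union> ?B2 \<noteq> UNIV"
    using uncountable_UNIV_real by metis
  then obtain r where r: "r \<notin> B" "r \<notin> ?B1" "r \<notin> ?B2"
    by blast
  from B[OF r(1)] obtain C h where h: "theta_fun p D (\<nu> * \<beta>) h" and eq: "\<And>x. x \<noteq> 0 \<Longrightarrow> g x = etheta p (x / \<beta>) * h x
      + C * (etheta p (?e r * x) ^ D * etheta p (\<nu> / ?e r ^ D * x))"
    unfolding reduces_at_def by blast
  have "?e (- real D * r) = 1 / ?e r ^ D"
    by (simp add: exp_minus exp_of_nat_mult field_simps)
  then have "etheta p (?e r * \<beta>) ^ D * etheta p (\<nu> / ?e r ^ D * \<beta>) \<noteq> 0"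
    using r(2,3) by (simp add: mult_ac)
  then have "C = 0"
    using eq[OF \<open>\<beta> \<noteq> 0\<close>] assms by (auto simp: etheta_1[OF p])
  then show thesis
    using that[OF h] eq by simp
qed

lemma theta_fun_degree_1:
  assumes "theta_fun p (Suc 0) \<nu> g"
  shows "\<exists>C. \<forall>x. x \<noteq> 0 \<longrightarrow> g x = C * etheta p (\<nu> * x)"
  using assms
proof (induction "Suc 0" \<nu> g rule: theta_fun.induct)
  case (theta_fun_prod_list as)
  then show ?case by (cases as) (auto intro: exI[of _ 1])
next
  case (theta_fun_add \<nu> f g)
  then obtain C1 C2 where "\<forall>x. x \<noteq> 0 \<longrightarrow> f x = C1 * etheta p (\<nu> * x)" "\<forall>x. x \<noteq> 0 \<longrightarrow> g x = C2 * etheta p (\<nu> * x)"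
    by auto
  then show ?case by (intro exI[of _ "C1 + C2"]) (simp add: distrib_right)
next
  case (theta_fun_scale \<nu> f c)
  then obtain C where "\<forall>x. x \<noteq> 0 \<longrightarrow> f x = C * etheta p (\<nu> * x)" by auto
  then show ?case by (intro exI[of _ "c * C"]) simp
qed (auto intro: exI[of _ 0])

text \<open>Splitting off a node lowers the degree by one and multiplies \<nu> by that node. What
  remains for the last node is a multiple of a single \<theta>(\<mu> x), where \<mu> is \<nu> times
  all the other nodes; by the condition on the product this theta is nonzero at the last node, so
  the multiple is 0.\<close>

theorem theta_fun_vanish:
  assumes "finite J" "J \<noteq> {}" "theta_fun p (card J) \<nu> g" "\<nu> \<noteq> 0"
    and "\<And>j. j \<in> J \<Longrightarrow> \<beta> j \<noteq> 0" "\<And>j. j \<in> J \<Longrightarrow> g (\<beta> j) = 0"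
    and "\<And>i j. i \<in> J \<Longrightarrow> j \<in> J \<Longrightarrow> i \<noteq> j \<Longrightarrow> etheta p (\<beta> i / \<beta> j) \<noteq> 0"
    and "etheta p (\<nu> * (\<Prod>j\<in>J. \<beta> j)) \<noteq> 0" "x \<noteq> 0"
  shows "g x = 0"
  using assms(1,2,3-)
proof (induction J arbitrary: \<nu> g x rule: finite_ne_induct)
  case (singleton j)
  have "theta_fun p (Suc 0) \<nu> g" using singleton by simp
  from theta_fun_degree_1[OF this] obtain C where C: "\<And>x. x \<noteq> 0 \<Longrightarrow> g x = C * etheta p (\<nu> * x)"
    by auto
  from C[of "\<beta> j"] singleton have "C = 0" by simp
  then show ?case using C singleton by simp
next
  case (insert j J)
  have "theta_fun p (Suc (card J)) \<nu> g"
    using insert.prems insert.hyps by simp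
  from theta_fun_factor[OF this, of "\<beta> j"] insert.prems insert.hyps obtain h
    where h: "theta_fun p (card J) (\<nu> * \<beta> j) h" "\<And>x. x \<noteq> 0 \<Longrightarrow> g x = etheta p (x / \<beta> j) * h x"
    by (auto simp: card_gt_0_iff)
  have "h x = 0"
  proof (rule insert.IH[OF h(1)])
    fix i assume "i \<in> J"
    then show "h (\<beta> i) = 0"
      using h(2)[of "\<beta> i"] insert.prems insert.hyps by (metis insertCI mult_eq_0_iff)
  qed (use insert in \<open>auto simp: mult_ac\<close>)
  then show ?case using h(2) insert.prems by simp
qed

end

section \<open>The identity for sums over subsets\<close>

lemma sum_Pow_remove:
  assumes "finite Y" "y \<in> Y"
  shows "(\<Sum>J\<in>Pow Y. f J) = (\<Sum>J\<in>Pow (Y - {y}). f J + f (insert y J))"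
proof -
  have Y: "Y = insert y (Y - {y})" using assms by auto
  have inj: "inj_on (insert y) (Pow (Y - {y}))"
    by (rule inj_onI) (metis Diff_insert_absorb Pow_iff subset_Diff_insert)
  have "(\<Sum>J\<in>Pow Y. f J) = (\<Sum>J\<in>Pow (Y - {y}). f J) + (\<Sum>J\<in>insert y ` Pow (Y - {y}). f J)"
    by (subst Y, subst Pow_insert, rule sum.union_disjoint) (use assms in auto)
  then show ?thesis
    by (simp add: sum.reindex[OF inj] sum.distrib)
qed

locale theta_params =
  fixes p q b :: complex
  assumes p: "norm p < 1" and q_nz [simp]: "q \<noteq> 0" and b_nz [simp]: "b \<noteq> 0"
begin

abbreviation \<theta> where "\<theta> \<equiv> etheta p"
abbreviation poch where "poch \<equiv> tsf_nat q p"

lemma \<theta>_1 [simp]: "\<theta> 1 = 0"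
  by (rule etheta_1[OF p])

lemmas \<theta>_swap = etheta_swap[OF p]

lemma poch_0 [simp]: "poch x 0 = 1"
  by (simp add: tsf_nat_def)

lemma poch_Suc: "poch x (Suc n) = poch x n * \<theta> (x * q ^ n)"
  by (simp add: tsf_nat_def)

lemma poch_Suc': "poch x (Suc n) = \<theta> x * poch (x * q) n"
  unfolding tsf_nat_def by (subst prod.lessThan_Suc_shift) (simp add: mult_ac)

text \<open>A member i and a non-member j of the subset interact through \<phi>(t_i/t_j), which
  vanishes for t_i = q t_j. The functions \<open>e1\<close> and \<open>e0\<close> are the factors of
  a single member and of a single non-member, taken at a q^|I| t; \<psi> collects what depends on
  \<open>u\<close> and \<open>v\<close>.\<close>

definition \<phi> where "\<phi> z = \<theta> (z / q) * \<theta> (q * z / b) / (\<theta> z * \<theta> (z / b))"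
definition e1 where "e1 y = \<theta> (q * y / b) / \<theta> y"
definition e0 where "e0 y = \<theta> (b * y) / \<theta> (q * y)"
definition \<psi> where "\<psi> u v x = \<theta> (u * x) * \<theta> (v * x) / (\<theta> (q * u * x / b) * \<theta> (q * v * x / b))"

text \<open>For u = a b/c and v = a b/d the four arguments are c, d, c q/b and d q/b, as in the
  factor of V that depends on |k| alone.\<close>

definition w where
  "w a u v n = (q / b) ^ n * (poch (a * b / u) n * poch (a * b / v) n) / (poch (a * q / u) n * poch (a * q / v) n)"

definition subset_term :: "'i set \<Rightarrow> ('i \<Rightarrow> complex) \<Rightarrow> complex \<Rightarrow> complex \<Rightarrow> complex \<Rightarrow> 'i set \<Rightarrow> complex" where
  "subset_term X t u v A I = (\<Prod>i\<in>I. \<psi> u v (t i) * e1 (A * t i)) * (\<Prod>j\<in>X - I. e0 (A * t j))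
     * (\<Prod>i\<in>I. \<Prod>j\<in>X - I. \<phi> (t i / t j))"

definition S :: "'i set \<Rightarrow> ('i \<Rightarrow> complex) \<Rightarrow> complex \<Rightarrow> complex \<Rightarrow> complex \<Rightarrow> complex" where
  "S X t a u v = (\<Sum>I\<in>Pow X. w a u v (card I) * subset_term X t u v (a * q ^ card I) I)"

text \<open>Common denominator of \<open>\<phi> z\<close> and \<open>\<phi> (1 / z)\<close>, and the corresponding numerators.\<close>

definition den where "den z = \<theta> z * \<theta> (z / b) * \<theta> (b * z)"
definition num1 where "num1 z = \<theta> (z / q) * \<theta> (q * z / b) * \<theta> (b * z)"
definition num0 where "num0 z = \<theta> (q * z) * \<theta> (b * z / q) * \<theta> (z / b)"

lemma \<phi>_den: "\<theta> z \<noteq> 0 \<Longrightarrow> \<theta> (z / b) \<noteq> 0 \<Longrightarrow> \<phi> z * den z = num1 z"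
  by (simp add: \<phi>_def den_def num1_def)

lemma \<phi>_inverse:
  assumes "z \<noteq> 0"
  shows "\<phi> (1 / z) = \<theta> (q * z) * \<theta> (b * z / q) / (\<theta> z * \<theta> (b * z))"
proof -
  have r1: "\<theta> (1 / z / q) = - (1 / (q * z)) * \<theta> (q * z)"
    using \<theta>_swap[of 1 "q * z"] assms by (simp add: mult_ac)
  have r2: "\<theta> (q * (1 / z) / b) = - (q / (b * z)) * \<theta> (b * z / q)"
    using \<theta>_swap[of q "b * z"] assms by (simp add: mult_ac)
  have r3: "\<theta> (1 / z) = - (1 / z) * \<theta> z"
    using \<theta>_swap[of 1 z] assms by simp
  have r4: "\<theta> (1 / z / b) = - (1 / (b * z)) * \<theta> (b * z)"
    using \<theta>_swap[of 1 "b * z"] assms by (simp add: mult_ac)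
  show ?thesis
    unfolding \<phi>_def r1 r2 r3 r4 using assms by (simp add: divide_simps)
qed

lemma \<phi>_inverse_den: "z \<noteq> 0 \<Longrightarrow> \<theta> z \<noteq> 0 \<Longrightarrow> \<theta> (b * z) \<noteq> 0 \<Longrightarrow> \<phi> (1 / z) * den z = num0 z"
  by (simp add: \<phi>_inverse den_def num0_def)

text \<open>For z = x/t_i and x = 1/(a q^(k+1)) the arguments 1/z and 1/(q z) are a q^(k+1) t_i and
  a q^k t_i. Thus the factors of a member i in the term containing the new variable x are traded for
  those in the term without it; \<open>e0_num1\<close> does the same for non-members.\<close>

lemma e1_den:
  assumes "z \<noteq> 0" "\<theta> z \<noteq> 0" "\<theta> (q * z) \<noteq> 0"
  shows "e1 (1 / z) * den z = e1 (1 / (q * z)) * num0 z"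
proof -
  have r1: "\<theta> (q * (1 / z) / b) = - (q / (b * z)) * \<theta> (b * z / q)"
    using \<theta>_swap[of q "b * z"] assms by (simp add: mult_ac)
  have r2: "\<theta> (1 / z) = - (1 / z) * \<theta> z"
    using \<theta>_swap[of 1 z] assms by simp
  have r3: "\<theta> (q * (1 / (q * z)) / b) = - (1 / (b * z)) * \<theta> (b * z)"
    using \<theta>_swap[of 1 "b * z"] assms by (simp add: mult_ac)
  have r4: "\<theta> (1 / (q * z)) = - (1 / (q * z)) * \<theta> (q * z)"
    using \<theta>_swap[of 1 "q * z"] assms by simp
  show ?thesis
    unfolding e1_def den_def num0_def r1 r2 r3 r4 using assms by (simp add: divide_simps)
qed

lemma e0_num1:
  assumes "z \<noteq> 0" "\<theta> z \<noteq> 0" "\<theta> (z / q) \<noteq> 0"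
  shows "e0 (1 / z) * num1 z = e0 (1 / (q * z)) * den z"
proof -
  have r1: "\<theta> (b * (1 / z)) = - (b / z) * \<theta> (z / b)"
    using \<theta>_swap[of b z] assms by simp
  have r2: "\<theta> (q * (1 / z)) = - (q / z) * \<theta> (z / q)"
    using \<theta>_swap[of q z] assms by simp
  have r3: "\<theta> (b * (1 / (q * z))) = - (b / (q * z)) * \<theta> (q * z / b)"
    using \<theta>_swap[of b "q * z"] assms by simp
  have r4: "\<theta> (q * (1 / (q * z))) = - (1 / z) * \<theta> z"
    using \<theta>_swap[of 1 z] assms by simp
  show ?thesis
    unfolding e0_def den_def num1_def r1 r2 r3 r4 using assms by (simp add: divide_simps)
qed

text \<open>The sign responsible for the cancellation in pairs when two variables coincide.\<close>

lemma num1_1: "num1 1 = - num0 1"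
proof -
  have r1: "\<theta> (1 / q) = - (1 / q) * \<theta> q" "\<theta> (1 / b) = - (1 / b) * \<theta> b" "\<theta> (q / b) = - (q / b) * \<theta> (b / q)"
    using \<theta>_swap[of 1 q] \<theta>_swap[of 1 b] \<theta>_swap[of q b] by simp_all
  show ?thesis
    by (simp add: num1_def num0_def r1)
qed

lemma den_b: "z \<noteq> 0 \<Longrightarrow> \<theta> z \<noteq> 0 \<Longrightarrow> \<theta> (b * z) \<noteq> 0 \<Longrightarrow> \<phi> (1 / z) * den (b * z) = num1 (b * z)"
  by (simp add: \<phi>_inverse den_def num1_def)

lemma den_inverse_b: "\<theta> z \<noteq> 0 \<Longrightarrow> \<theta> (z / b) \<noteq> 0 \<Longrightarrow> \<phi> z * den (z / b) = num0 (z / b)"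
  by (simp add: \<phi>_def den_def num0_def)

lemma e0_e1: "\<theta> (b * y) \<noteq> 0 \<Longrightarrow> \<theta> (q * y) \<noteq> 0 \<Longrightarrow> e0 y * e1 (b * y) = 1"
  by (simp add: e0_def e1_def)

lemma e1_e0: "\<theta> y \<noteq> 0 \<Longrightarrow> \<theta> (q * y / b) \<noteq> 0 \<Longrightarrow> e1 y * e0 (y / b) = 1"
  by (simp add: e0_def e1_def)

text \<open>For a new variable at b/(q u), its interaction with t amounts to a shift of
  \<open>u\<close> to u q in the factor of t.\<close>

lemma \<psi>_den:
  assumes "x = b / (q * u)" "u \<noteq> 0" "t \<noteq> 0" "\<theta> (u * t) \<noteq> 0" "\<theta> (q * u * t / b) \<noteq> 0" "\<theta> (q * u * t) \<noteq> 0"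
    "\<theta> (q * (q * u) * t / b) \<noteq> 0"
  shows "\<psi> u v t * den (x / t) = \<psi> (u * q) v t * num1 (x / t)"
proof -
  have x: "x \<noteq> 0" and u: "u = b / (q * x)" using assms by auto
  have r: "\<theta> (x / t) = - (x / t) * \<theta> (t / x)" "\<theta> (x / t / b) = - (x / (b * t)) * \<theta> (b * t / x)"
    "\<theta> (x / t / q) = - (x / (q * t)) * \<theta> (q * t / x)" "\<theta> (q * (x / t) / b) = - (q * x / (b * t)) * \<theta> (b * t / (q * x))"
    using \<theta>_swap[of x t] \<theta>_swap[of x "b * t"] \<theta>_swap[of x "q * t"] \<theta>_swap[of "q * x" "b * t"] assms x
    by (simp_all add: mult_ac)
  have nz: "\<theta> (t / x) \<noteq> 0" "\<theta> (b * t / x) \<noteq> 0" "\<theta> (q * t / x) \<noteq> 0" "\<theta> (b * t / (q * x)) \<noteq> 0"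
    using assms(4-7) x by (simp_all add: u mult_ac)
  have eqs: "\<psi> u v t = \<theta> (b * t / (q * x)) * \<theta> (v * t) / (\<theta> (t / x) * \<theta> (q * v * t / b))"
    "\<psi> (u * q) v t = \<theta> (b * t / x) * \<theta> (v * t) / (\<theta> (q * t / x) * \<theta> (q * v * t / b))"
    unfolding \<psi>_def using x by (simp_all add: u mult_ac)
  show ?thesis
    unfolding den_def num1_def r eqs using nz assms(3) x by (simp add: divide_simps)
qed

lemma w_Suc: "w a u v (Suc n) = w a u v n * ((q / b) * (\<theta> (a * b * q ^ n / u) * \<theta> (a * b * q ^ n / v))
    / (\<theta> (a * q ^ Suc n / u) * \<theta> (a * q ^ Suc n / v)))"
  by (simp add: w_def poch_Suc mult_ac)

text \<open>The first factor of \<open>w\<close>, whose removal leaves \<open>w\<close> at a q. In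
  \<kappa>1 only the part with \<open>v\<close> is removed from the front; the part with
  \<open>u\<close> is removed from the back, where it cancels the factor \<open>e1\<close> of a
  variable at b/(q u).\<close>

definition \<kappa>2 where "\<kappa>2 a u v = (q / b) * (\<theta> (a * b / u) * \<theta> (a * b / v)) / (\<theta> (a * q / u) * \<theta> (a * q / v))"
definition \<kappa>1 where "\<kappa>1 a v = (q / b) * \<theta> (a * b / v) / \<theta> (a * q / v)"

lemma w_Suc_\<kappa>2: "w a u v (Suc n) = \<kappa>2 a u v * w (a * q) u v n"
  by (simp add: w_def poch_Suc' \<kappa>2_def mult_ac)

lemma w_Suc_\<kappa>1:
  assumes "u \<noteq> 0" "\<theta> (a * b * q ^ n / u) \<noteq> 0" "\<theta> (a * q ^ Suc n / u) \<noteq> 0"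
  shows "w a u v (Suc n) * e1 (a * q ^ Suc n * (b / (q * u))) = \<kappa>1 a v * w (a * q) (u * q) v n"
proof -
  have "w a u v (Suc n) = (q / b) ^ Suc n * (poch (a * b / u) n * \<theta> (a * b * q ^ n / u) * (\<theta> (a * b / v) * poch (a * b / v * q) n))
     / (poch (a * q / u) n * \<theta> (a * q ^ Suc n / u) * (\<theta> (a * q / v) * poch (a * q / v * q) n))"
    unfolding w_def poch_Suc[of "_ / u"] poch_Suc'[of "_ / v"] by (simp add: mult_ac)
  moreover have "e1 (a * q ^ Suc n * (b / (q * u))) = \<theta> (a * q ^ Suc n / u) / \<theta> (a * b * q ^ n / u)"
    unfolding e1_def using assms by (simp add: mult_ac)
  moreover have "w (a * q) (u * q) v n = (q / b) ^ n * (poch (a * b / u) n * poch (a * b / v * q) n)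
     / (poch (a * q / u) n * poch (a * q / v * q) n)"
    unfolding w_def by (simp add: mult_ac)
  ultimately show ?thesis
    unfolding \<kappa>1_def using assms by (simp add: mult_ac)
qed

text \<open>Inverting all arguments of theta shows that the first factor of \<open>w\<close> at a'
  is the reciprocal of the last factor of \<open>w a u v (Suc n)\<close>.\<close>

lemma w_\<kappa>2_dual:
  assumes "a \<noteq> 0" "u \<noteq> 0" "v \<noteq> 0" and a': "a' = u * v / (a * b * q ^ Suc n)"
    and "\<theta> (a * b * q ^ n / u) \<noteq> 0" "\<theta> (a * b * q ^ n / v) \<noteq> 0"
     "\<theta> (a * q ^ Suc n / u) \<noteq> 0" "\<theta> (a * q ^ Suc n / v) \<noteq> 0"
  shows "w a u v n = w a u v (Suc n) * \<kappa>2 a' u v"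
proof -
  have r: "\<theta> (a' * b / u) = - (v / (a * q ^ Suc n)) * \<theta> (a * q ^ Suc n / v)"
    "\<theta> (a' * b / v) = - (u / (a * q ^ Suc n)) * \<theta> (a * q ^ Suc n / u)"
    "\<theta> (a' * q / u) = - (v / (a * b * q ^ n)) * \<theta> (a * b * q ^ n / v)"
    "\<theta> (a' * q / v) = - (u / (a * b * q ^ n)) * \<theta> (a * b * q ^ n / u)"
    using assms \<theta>_swap[of v "a * q ^ Suc n"] \<theta>_swap[of u "a * q ^ Suc n"] \<theta>_swap[of v "a * b * q ^ n"]
      \<theta>_swap[of u "a * b * q ^ n"] unfolding a'
    by (simp_all add: mult_ac)
  have "\<kappa>2 a' u v = (b / q) * (\<theta> (a * q ^ Suc n / u) * \<theta> (a * q ^ Suc n / v)) /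
     (\<theta> (a * b * q ^ n / u) * \<theta> (a * b * q ^ n / v))"
    unfolding \<kappa>2_def r using assms by (simp add: divide_simps)
  then show ?thesis
    unfolding w_Suc using assms by simp
qed

lemma w_\<kappa>1_dual:
  assumes "a \<noteq> 0" "u \<noteq> 0" "v \<noteq> 0" and a': "a' = u * v / (a * b * q ^ Suc n)"
    and "\<theta> (a * b * q ^ n / u) \<noteq> 0" "\<theta> (a * q ^ Suc n / u) \<noteq> 0"
  shows "\<kappa>1 a v * w (a * q) (u * q) v n = w a u v (Suc n) * \<kappa>1 a' v"
proof -
  have r: "\<theta> (a' * b / v) = - (u / (a * q ^ Suc n)) * \<theta> (a * q ^ Suc n / u)"
    "\<theta> (a' * q / v) = - (u / (a * b * q ^ n)) * \<theta> (a * b * q ^ n / u)"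
    using assms \<theta>_swap[of u "a * q ^ Suc n"] \<theta>_swap[of u "a * b * q ^ n"] unfolding a'
    by (simp_all add: mult_ac)
  have "\<kappa>1 a' v = \<theta> (a * q ^ Suc n / u) / \<theta> (a * b * q ^ n / u)"
    unfolding \<kappa>1_def r using assms by (simp add: divide_simps)
  moreover have "e1 (a * q ^ Suc n * (b / (q * u))) = \<theta> (a * q ^ Suc n / u) / \<theta> (a * b * q ^ n / u)"
    unfolding e1_def using assms by (simp add: mult_ac)
  ultimately show ?thesis
    using w_Suc_\<kappa>1[of u a n v] assms by simp
qed

section \<open>Generic parameters\<close>

definition monomial where
  "monomial a u v = (\<lambda>(i, j, k, l, r). a powi i * b powi j * u powi k * v powi l * q powi r)"

text \<open>Constants and single variables are tested against all monomials, but ratios of variables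
  only against powers of \<open>b\<close>. Powers of \<open>q\<close> are left out there because the
  variables will be specialized to strings t, t q, t q^2, ..., whose ratios are powers of
  \<open>q\<close>.\<close>

definition generic :: "complex \<Rightarrow> complex \<Rightarrow> complex \<Rightarrow> 'i set \<Rightarrow> ('i \<Rightarrow> complex) \<Rightarrow> bool" where
  "generic a u v X t \<longleftrightarrow> a \<noteq> 0 \<and> u \<noteq> 0 \<and> v \<noteq> 0 \<and> (\<forall>e. e \<noteq> (0, 0, 0, 0, 0) \<longrightarrow> \<theta> (monomial a u v e) \<noteq> 0)
     \<and> (\<forall>x\<in>X. t x \<noteq> 0 \<and> (\<forall>e. \<theta> (monomial a u v e * t x) \<noteq> 0))
     \<and> (\<forall>x\<in>X. \<forall>y\<in>X. x \<noteq> y \<longrightarrow> (\<forall>j. \<theta> (b powi j * t x / t y) \<noteq> 0))"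

lemma generic_nz:
  assumes "generic a u v X t"
  shows "a \<noteq> 0" "u \<noteq> 0" "v \<noteq> 0" "x \<in> X \<Longrightarrow> t x \<noteq> 0"
  using assms by (simp_all add: generic_def)

lemma generic_const:
  assumes "generic a u v X t" "y = a powi i * b powi j * u powi k * v powi l * q powi r" "(i, j, k, l, r) \<noteq> (0, 0, 0, 0, 0)"
  shows "\<theta> y \<noteq> 0"
proof -
  have "\<forall>e. e \<noteq> (0, 0, 0, 0, 0) \<longrightarrow> \<theta> (monomial a u v e) \<noteq> 0"
    using assms(1) by (simp only: generic_def) simp
  from this[rule_format, OF assms(3)] show ?thesis
    by (simp add: monomial_def assms(2))
qed

lemma generic_var:
  assumes "generic a u v X t" "x \<in> X" "y = a powi i * b powi j * u powi k * v powi l * q powi r * t x"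
  shows "\<theta> y \<noteq> 0"
proof -
  have "\<forall>e. \<theta> (monomial a u v e * t x) \<noteq> 0"
    using assms(1,2) by (simp only: generic_def) simp
  from this[rule_format, of "(i, j, k, l, r)"] show ?thesis
    by (simp add: monomial_def assms(3))
qed

lemma generic_ratio:
  assumes "generic a u v X t" "x \<in> X" "x' \<in> X" "x \<noteq> x'" "y = b powi j * t x / t x'"
  shows "\<theta> y \<noteq> 0"
  using assms(1) assms(2-) by (simp only: generic_def) simp

lemma generic_const_nz:
  assumes g: "generic a u v X t"
  shows "\<theta> (a * b * q ^ k / u) \<noteq> 0" "\<theta> (a * b * q ^ k / v) \<noteq> 0" "\<theta> (a * q ^ Suc k / u) \<noteq> 0" "\<theta> (a * q ^ Suc k / v) \<noteq> 0"
  by (rule generic_const[OF g, of _ 1 1 "-1" 0 "int k"] generic_const[OF g, of _ 1 1 0 "-1" "int k"]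
      generic_const[OF g, of _ 1 0 "-1" 0 "int (Suc k)"] generic_const[OF g, of _ 1 0 0 "-1" "int (Suc k)"];
      (simp only: power_int_of_nat)?; simp add: field_simps)+

lemma generic_var_nz:
  assumes g: "generic a u v X t" and x: "x \<in> X"
  shows "\<theta> (a * q ^ k * t x) \<noteq> 0" "\<theta> (q * u * t x / b) \<noteq> 0" "\<theta> (q * v * t x / b) \<noteq> 0"
  by (rule generic_var[OF g x, of _ 1 0 0 0 "int k"] generic_var[OF g x, of _ 0 "-1" 1 0 1]
      generic_var[OF g x, of _ 0 "-1" 0 1 1]; simp add: field_simps)+

lemma generic_ratio_nz:
  assumes g: "generic a u v X t" and x: "x \<in> X" "y \<in> X" "x \<noteq> y"
  shows "\<theta> (t x / t y) \<noteq> 0" "\<theta> (t x / t y / b) \<noteq> 0" "\<theta> (b * (t x / t y)) \<noteq> 0"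
  by (rule generic_ratio[OF g x, of _ 0] generic_ratio[OF g x, of _ "-1"] generic_ratio[OF g x, of _ 1]; simp add: field_simps)+

lemma generic_subset: "generic a u v X t \<Longrightarrow> Y \<subseteq> X \<Longrightarrow> generic a u v Y t"
  by (simp only: generic_def) (meson subsetD)

text \<open>Replacing \<open>a\<close>, \<open>u\<close>, \<open>v\<close> by monomials amounts to a
  map f on exponent vectors. If f sends only the zero vector to zero, nontrivial monomials stay
  nontrivial; the condition on single variables concerns all vectors anyway.\<close>

lemma generic_change:
  assumes g: "generic a u v X t" and "a' \<noteq> 0" "u' \<noteq> 0" "v' \<noteq> 0"
    and m: "\<And>e. monomial a' u' v' e = monomial a u v (f e)" "\<And>e. f e = (0, 0, 0, 0, 0) \<Longrightarrow> e = (0, 0, 0, 0, 0)"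
  shows "generic a' u' v' X t"
proof -
  have "\<forall>e. e \<noteq> (0, 0, 0, 0, 0) \<longrightarrow> \<theta> (monomial a u v e) \<noteq> 0" "\<forall>x\<in>X. t x \<noteq> 0 \<and> (\<forall>e. \<theta> (monomial a u v e * t x) \<noteq> 0)"
    "\<forall>x\<in>X. \<forall>y\<in>X. x \<noteq> y \<longrightarrow> (\<forall>j. \<theta> (b powi j * t x / t y) \<noteq> 0)"
    using g unfolding generic_def by - (elim conjE, assumption)+
  then show ?thesis
    unfolding generic_def m(1) using assms(2-4) m(2) by (intro conjI) meson+
qed

lemma generic_shift:
  assumes g: "generic a u v X t"
  shows "generic (a * q) u v X t" "generic (a * q) (u * q) v X t"
proof -
  note nz = generic_nz[OF g]
  show "generic (a * q) u v X t"
  proof (rule generic_change[OF g])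
    show "monomial (a * q) u v e = monomial a u v ((\<lambda>(i, j, k, l, r). (i, j, k, l, r + i)) e)" for e
      using nz by (simp add: monomial_def power_int_mult_distrib power_int_add mult_ac split: prod.splits)
  qed (use nz in \<open>auto split: prod.splits\<close>)
  show "generic (a * q) (u * q) v X t"
  proof (rule generic_change[OF g])
    show "monomial (a * q) (u * q) v e = monomial a u v ((\<lambda>(i, j, k, l, r). (i, j, k, l, r + i + k)) e)" for e
      using nz by (simp add: monomial_def power_int_mult_distrib power_int_add mult_ac split: prod.splits)
  qed (use nz in \<open>auto split: prod.splits\<close>)
qed

lemma generic_swap:
  assumes g: "generic a u v X t"
  shows "generic a v u X t"
proof (rule generic_change[OF g])
  show "monomial a v u e = monomial a u v ((\<lambda>(i, j, k, l, r). (i, j, l, k, r)) e)" for e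
    by (simp add: monomial_def mult_ac split: prod.splits)
qed (use generic_nz[OF g] in \<open>auto split: prod.splits\<close>)

lemma generic_dual:
  assumes g: "generic a u v X t"
  shows "generic (u * v / (a * b * q ^ n)) u v X t"
proof (rule generic_change[OF g])
  note nz = generic_nz[OF g]
  have "(q ^ n) powi i = (q powi i) ^ n" for i
    by (metis mult.commute power_int_mult power_int_of_nat)
  note pow = this
  show "monomial (u * v / (a * b * q ^ n)) u v e = monomial a u v ((\<lambda>(i, j, k, l, r). (- i, j - i, k + i, l + i, r - int n * i)) e)" for e
    using nz by (simp add: monomial_def power_int_mult_distrib power_int_divide_distrib power_int_add power_int_diff
        power_int_minus power_int_mult pow field_simps split: prod.splits)
qed (use generic_nz[OF g] in \<open>auto split: prod.splits\<close>)

subsection \<open>Values at the poles\<close>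

text \<open>The thetas that \<open>e1\<close> and \<open>e0\<close> can bring into the denominator
  for the new variable x. For |J| = k the term with x and the term without x both have the pole with
  l = k + 1, which is therefore the factor left out.\<close>

definition poles_but where "poles_but n k a x = (\<Prod>l\<in>{1..n} - {Suc k}. \<theta> (a * q ^ l * x))"
definition poles where "poles n a x = (\<Prod>l\<in>{1..n}. \<theta> (a * q ^ l * x))"

lemma poles_Q: "k < n \<Longrightarrow> poles n a x = \<theta> (a * q ^ Suc k * x) * poles_but n k a x"
  unfolding poles_def poles_but_def by (rule prod.remove) auto

lemma poles_but_e1:
  assumes "k < n" "\<theta> (a * q ^ Suc k * x) \<noteq> 0"
  shows "\<theta> (q * (a * q ^ Suc k * x) / b) * poles_but n k a x = e1 (a * q ^ Suc k * x) * poles n a x"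
  using assms by (simp add: poles_Q e1_def)

lemma poles_but_e0:
  assumes "k < n" "\<theta> (a * q ^ Suc k * x) \<noteq> 0"
  shows "\<theta> (b * (a * q ^ k * x)) * poles_but n k a x = e0 (a * q ^ k * x) * poles n a x"
  using assms by (simp add: poles_Q e0_def mult_ac)

text \<open>\<open>cl_in\<close> belongs to the subset J together with the new variable, whence
  \<open>Suc (card J)\<close>, and \<open>cl_out\<close> to J alone. Both are multiplied by the
  common denominator and defined as functions of x, so that they can be evaluated where
  \<open>S\<close> itself has a pole.\<close>

definition cl_in where
  "cl_in Y t a u v J x = w a u v (Suc (card J)) * subset_term Y t u v (a * q ^ Suc (card J)) J * (\<theta> (u * x) * \<theta> (v * x))
    * (\<theta> (q * (a * q ^ Suc (card J) * x) / b) * poles_but (Suc (card Y)) (card J) a x)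
    * ((\<Prod>j\<in>Y - J. num1 (x / t j)) * (\<Prod>i\<in>J. den (x / t i)))"

definition cl_out where
  "cl_out Y t a u v J x = w a u v (card J) * subset_term Y t u v (a * q ^ card J) J * (\<theta> (q * u * x / b) * \<theta> (q * v * x / b))
    * (\<theta> (b * (a * q ^ card J * x)) * poles_but (Suc (card Y)) (card J) a x)
    * ((\<Prod>j\<in>Y - J. den (x / t j)) * (\<Prod>i\<in>J. num0 (x / t i)))"

text \<open>The sum \<open>S (insert z Y)\<close> as a function of \<open>x = t z\<close>, cleared of denominators.\<close>

definition cleared where
  "cleared Y t a u v x = (\<Sum>J\<in>Pow Y. cl_in Y t a u v J x + cl_out Y t a u v J x)"

lemma subset_term_remove:
  assumes "finite Y" "y \<in> Y" "J \<subseteq> Y - {y}"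
  shows "subset_term Y t u v A J = subset_term (Y - {y}) t u v A J * (e0 (A * t y) * (\<Prod>i\<in>J. \<phi> (t i / t y)))"
proof -
  have *: "(\<Prod>j\<in>Y - J. f j) = f y * (\<Prod>j\<in>Y - {y} - J. f j)" for f :: "_ \<Rightarrow> complex"
  proof -
    have "Y - J = insert y (Y - {y} - J)" using assms by auto
    then show ?thesis using assms by simp
  qed
  show ?thesis
    unfolding subset_term_def * by (simp add: prod.distrib mult_ac)
qed

lemma subset_term_insert:
  assumes "finite Y" "y \<in> Y" "J \<subseteq> Y - {y}"
  shows "subset_term Y t u v A (insert y J) = subset_term (Y - {y}) t u v A J
    * (\<psi> u v (t y) * e1 (A * t y) * (\<Prod>j\<in>Y - {y} - J. \<phi> (t y / t j)))"
proof -
  have "finite J" "y \<notin> J" and *: "Y - insert y J = Y - {y} - J"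
    using assms by (auto intro: finite_subset)
  then show ?thesis
    unfolding subset_term_def * by (simp add: mult_ac)
qed

lemma cleared_eq_S:
  assumes "finite Y" "z \<notin> Y" and g: "generic a u v (insert z Y) t"
  shows "cleared Y t a u v (t z) = S (insert z Y) t a u v * (\<Prod>j\<in>Y. den (t z / t j))
    * (\<theta> (q * u * t z / b) * \<theta> (q * v * t z / b)) * poles (Suc (card Y)) a (t z)"
proof -
  let ?x = "t z"
  note nz = generic_var_nz(1)[OF g insertI1] and nzu = generic_var_nz(2,3)[OF g insertI1]
  have nzb: "\<theta> (?x / t j) \<noteq> 0" "\<theta> (?x / t j / b) \<noteq> 0" "\<theta> (b * (?x / t j)) \<noteq> 0" if "j \<in> Y" for j
    using generic_ratio_nz[OF g insertI1, of j] that assms(2) by auto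
  have tnz: "t z \<noteq> 0" "\<And>j. j \<in> Y \<Longrightarrow> t j \<noteq> 0"
    using generic_nz[OF g] by auto
  have ins: "insert z Y - {z} = Y" using assms by auto
  let ?D = "(\<Prod>j\<in>Y. den (t z / t j)) * (\<theta> (q * u * t z / b) * \<theta> (q * v * t z / b)) * poles (Suc (card Y)) a (t z)"
  have D: "(\<Prod>j\<in>Y. f j) = (\<Prod>j\<in>Y - J. f j) * (\<Prod>j\<in>J. f j)" if "J \<subseteq> Y" for f :: "_ \<Rightarrow> complex" and J
    using prod.subset_diff[OF that assms(1)] .
  have cin: "cl_in Y t a u v J ?x = w a u v (card (insert z J)) * subset_term (insert z Y) t u v (a * q ^ card (insert z J)) (insert z J) * ?D"
    if "J \<in> Pow Y" for J
  proof -
    have J: "J \<subseteq> Y" "card J < Suc (card Y)" "card (insert z J) = Suc (card J)"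
      using that assms by (auto simp: less_Suc_eq_le intro: card_mono finite_subset) (metis card_insert_disjoint finite_subset subsetD)
    have "(\<Prod>j\<in>Y - J. num1 (?x / t j)) = (\<Prod>j\<in>Y - J. \<phi> (?x / t j)) * (\<Prod>j\<in>Y - J. den (?x / t j))"
      unfolding prod.distrib[symmetric] using nzb by (intro prod.cong) (auto simp: \<phi>_den)
    moreover have "subset_term (insert z Y) t u v A (insert z J) = subset_term Y t u v A J
      * (\<psi> u v ?x * e1 (A * ?x) * (\<Prod>j\<in>Y - J. \<phi> (?x / t j)))" for A
      using subset_term_insert[of "insert z Y" z J t u v A] assms J unfolding ins by auto
    moreover have "\<theta> (u * ?x) * \<theta> (v * ?x) = \<psi> u v ?x * (\<theta> (q * u * t z / b) * \<theta> (q * v * t z / b))"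
      using nzu by (simp add: \<psi>_def)
    ultimately show ?thesis
      unfolding cl_in_def poles_but_e1[OF J(2) nz] J(3) D[OF J(1), of "\<lambda>j. den (?x / t j)"] by (simp only: mult_ac)
  qed
  have cout: "cl_out Y t a u v J ?x = w a u v (card J) * subset_term (insert z Y) t u v (a * q ^ card J) J * ?D"
    if "J \<in> Pow Y" for J
  proof -
    have J: "J \<subseteq> Y" "card J < Suc (card Y)"
      using that assms by (auto simp: less_Suc_eq_le intro: card_mono finite_subset)
    have "\<phi> (t j / ?x) * den (?x / t j) = num0 (?x / t j)" if "j \<in> J" for j
      using \<phi>_inverse_den[of "?x / t j"] nzb[of j] tnz that J by auto
    then have "(\<Prod>j\<in>J. num0 (?x / t j)) = (\<Prod>j\<in>J. \<phi> (t j / ?x)) * (\<Prod>j\<in>J. den (?x / t j))"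
      unfolding prod.distrib[symmetric] by (intro prod.cong) auto
    moreover have "subset_term (insert z Y) t u v A J = subset_term Y t u v A J
      * (e0 (A * ?x) * (\<Prod>j\<in>J. \<phi> (t j / ?x)))" for A
      using subset_term_remove[of "insert z Y" z J t u v A] assms J unfolding ins by auto
    ultimately show ?thesis
      unfolding cl_out_def poles_but_e0[OF J(2) nz] D[OF J(1), of "\<lambda>j. den (?x / t j)"] by (simp only: mult_ac)
  qed
  have "cleared Y t a u v ?x = (\<Sum>J\<in>Pow Y. w a u v (card J) * subset_term (insert z Y) t u v (a * q ^ card J) J
     + w a u v (card (insert z J)) * subset_term (insert z Y) t u v (a * q ^ card (insert z J)) (insert z J)) * ?D"
    unfolding cleared_def sum_distrib_right using cin cout by (intro sum.cong) (simp_all add: distrib_right)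
  also have "\<dots> = S (insert z Y) t a u v * ?D"
    unfolding S_def by (subst sum_Pow_remove[of "insert z Y" z]) (simp_all add: assms(1) ins)
  finally show ?thesis by (simp only: mult_ac)
qed

text \<open>If |J| differs from l - 1, then \<open>poles_but\<close> retains the factor \<theta>(a
  q^l x) = \<theta>(1) = 0. If |J| = l - 1, the terms with and without the new variable cancel:
  \<open>e1_den\<close> and \<open>e0_num1\<close> match their products over Y, and the recursion of
  \<open>w\<close> matches the constants.\<close>

lemma cleared_pole:
  assumes "finite Y" and g: "generic a u v Y t" and l: "l \<in> {1..Suc (card Y)}" and x: "x = 1 / (a * q ^ l)"
  shows "cleared Y t a u v x = 0"
  unfolding cleared_def
proof (rule sum.neutral, rule ballI)
  fix J assume "J \<in> Pow Y"
  then have J: "J \<subseteq> Y" "finite J" "card J < Suc (card Y)"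
    using assms by (auto simp: less_Suc_eq_le intro: card_mono finite_subset)
  note nz = generic_nz[OF g]
  have xnz: "x \<noteq> 0" using nz x by simp
  let ?k = "card J"
  show "cl_in Y t a u v J x + cl_out Y t a u v J x = 0"
  proof (cases "l = Suc ?k")
    case False
    have "poles_but (Suc (card Y)) ?k a x = 0"
      unfolding poles_but_def
    proof (rule prod_zero)
      show "\<exists>l'\<in>{1..Suc (card Y)} - {Suc ?k}. \<theta> (a * q ^ l' * x) = 0"
        using l False nz(1) by (intro bexI[of _ l]) (simp_all add: x)
    qed simp
    then show ?thesis by (simp add: cl_in_def cl_out_def)
  next
    case True
    have ax: "a * q ^ Suc ?k * x = 1" "a * q ^ ?k * x = 1 / q"
      using x nz True by simp_all
    have A: "a * q ^ Suc ?k * t i = 1 / (x / t i)" "a * q ^ ?k * t i = 1 / (q * (x / t i))" for i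
      using x nz True by simp_all
    have zn: "\<theta> (x / t i) \<noteq> 0" "\<theta> (q * (x / t i)) \<noteq> 0" "\<theta> (x / t i / q) \<noteq> 0" if "i \<in> Y" for i
    proof -
      have *: "\<theta> (a * q powi r * t i) \<noteq> 0" for r
        by (rule generic_var[OF g that, of _ 1 0 0 0 r]) simp
      have **: "\<theta> (1 / (a * q powi r * t i)) \<noteq> 0" for r
        using etheta_inverse[OF p, of "a * q powi r * t i"] *[of r] nz that by simp
      have eqs: "x / t i = 1 / (a * q powi (int l) * t i)" "q * (x / t i) = 1 / (a * q powi (int l - 1) * t i)"
        "x / t i / q = 1 / (a * q powi (int l + 1) * t i)"
        using x nz that by (simp_all add: power_int_diff power_int_add mult_ac)
      show "\<theta> (x / t i) \<noteq> 0" "\<theta> (q * (x / t i)) \<noteq> 0" "\<theta> (x / t i / q) \<noteq> 0"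
        unfolding eqs(2,3) unfolding eqs(1) by (rule **)+
    qed
    \<comment> \<open>M is first written with the factors of the term containing x, and afterwards
      rewritten with those of the term without x.\<close>
    define M where "M = (\<Prod>i\<in>J. \<psi> u v (t i)) * (\<Prod>i\<in>J. \<Prod>j\<in>Y - J. \<phi> (t i / t j))
        * (\<Prod>i\<in>J. e1 (1 / (x / t i)) * den (x / t i)) * (\<Prod>j\<in>Y - J. e0 (1 / (x / t j)) * num1 (x / t j)) * poles_but (Suc (card Y)) ?k a x"
    have "cl_in Y t a u v J x = w a u v (Suc ?k) * (\<theta> (u * x) * \<theta> (v * x)) * \<theta> (q / b) * M"
      unfolding cl_in_def subset_term_def ax A M_def prod.distrib by (simp add: mult_ac)
    moreover have "M = (\<Prod>i\<in>J. \<psi> u v (t i)) * (\<Prod>i\<in>J. \<Prod>j\<in>Y - J. \<phi> (t i / t j))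
        * (\<Prod>i\<in>J. e1 (1 / (q * (x / t i))) * num0 (x / t i)) * (\<Prod>j\<in>Y - J. e0 (1 / (q * (x / t j))) * den (x / t j)) * poles_but (Suc (card Y)) ?k a x"
    proof -
      have "(\<Prod>i\<in>J. e1 (1 / (x / t i)) * den (x / t i)) = (\<Prod>i\<in>J. e1 (1 / (q * (x / t i))) * num0 (x / t i))"
        using J nz xnz zn by (intro prod.cong e1_den) auto
      moreover have "(\<Prod>j\<in>Y - J. e0 (1 / (x / t j)) * num1 (x / t j)) = (\<Prod>j\<in>Y - J. e0 (1 / (q * (x / t j))) * den (x / t j))"
        using J nz xnz zn by (intro prod.cong e0_num1) auto
      ultimately show ?thesis unfolding M_def by simp
    qed
    then have "cl_out Y t a u v J x = w a u v ?k * (\<theta> (q * u * x / b) * \<theta> (q * v * x / b)) * \<theta> (b / q) * M"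
      unfolding cl_out_def subset_term_def ax A prod.distrib by (simp add: mult_ac)
    \<comment> \<open>The minus sign stems from \<theta>(q/b) = - (q/b) \<theta>(b/q); the other
      reflections occur twice on each side, so their signs cancel.\<close>
    moreover have "w a u v (Suc ?k) * (\<theta> (u * x) * \<theta> (v * x)) * \<theta> (q / b) = - (w a u v ?k * (\<theta> (q * u * x / b) * \<theta> (q * v * x / b)) * \<theta> (b / q))"
    proof -
      note nn = generic_const_nz(3,4)[OF g, of ?k]
      have r: "\<theta> (u * x) = - (u / (a * q ^ Suc ?k)) * \<theta> (a * q ^ Suc ?k / u)"
        "\<theta> (v * x) = - (v / (a * q ^ Suc ?k)) * \<theta> (a * q ^ Suc ?k / v)"
        "\<theta> (q * u * x / b) = - (u / (a * b * q ^ ?k)) * \<theta> (a * b * q ^ ?k / u)"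
        "\<theta> (q * v * x / b) = - (v / (a * b * q ^ ?k)) * \<theta> (a * b * q ^ ?k / v)"
        "\<theta> (q / b) = - (q / b) * \<theta> (b / q)"
        using \<theta>_swap[of u "a * q ^ Suc ?k"] \<theta>_swap[of v "a * q ^ Suc ?k"] \<theta>_swap[of u "a * b * q ^ ?k"]
          \<theta>_swap[of v "a * b * q ^ ?k"] \<theta>_swap[of q b] nz x True by (simp_all add: mult_ac)
      show ?thesis
        unfolding w_Suc r using nn nz by (simp add: mult_ac)
    qed
    ultimately show ?thesis by simp
  qed
qed

text \<open>For x = t_y the new variable and y are interchangeable. Terms containing both or neither
  of them have the factor \<open>den 1\<close> = 0; the term with only the new variable and the one
  with only y are opposite by \<open>num1_1\<close>.\<close>

lemma cleared_diagonal:
  assumes "finite Y" and g: "generic a u v Y t" and y: "y \<in> Y"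
  shows "cleared Y t a u v (t y) = 0"
  unfolding cleared_def sum_Pow_remove[OF assms(1) y]
proof (rule sum.neutral, rule ballI)
  let ?x = "t y" and ?n = "Suc (card Y)"
  note nz = generic_nz[OF g]
  fix J assume "J \<in> Pow (Y - {y})"
  then have J: "J \<subseteq> Y - {y}" "finite J" "y \<notin> J"
    using assms by (auto intro: finite_subset)
  then have card: "card (insert y J) = Suc (card J)" by simp
  have lt: "Suc (card J) < ?n"
  proof -
    have "insert y J \<subseteq> Y" using J y by auto
    from card_mono[OF assms(1) this] show ?thesis unfolding card by simp
  qed
  have b0: "den (?x / t y) = 0" using nz y by (simp add: den_def)
  have pp: "num1 (?x / t y) = - num0 (?x / t y)" using num1_1 nz y by simp
  have Z: "(\<Prod>j\<in>Y - J. den (?x / t j)) = 0" "(\<Prod>j\<in>insert y J. den (?x / t j)) = 0"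
    using b0 assms(1) J y by (blast intro: prod_zero)+
  have "cl_out Y t a u v J ?x = 0" "cl_in Y t a u v (insert y J) ?x = 0"
    unfolding cl_in_def cl_out_def Z by (simp_all only: mult_zero_left mult_zero_right)
  moreover have "cl_in Y t a u v J ?x = - cl_out Y t a u v (insert y J) ?x"
  proof -
    let ?A = "a * q ^ Suc (card J)"
    have zn: "\<theta> (?x / t i) \<noteq> 0" "\<theta> (?x / t i / b) \<noteq> 0" "\<theta> (b * (?x / t i)) \<noteq> 0" if "i \<in> Y - {y}" for i
      using generic_ratio_nz[OF g y, of i] that by auto
    note Av = generic_var_nz(1)[OF g y] and uv = generic_var_nz(2,3)[OF g y]
    have "\<phi> (t i / ?x) * den (?x / t i) = num0 (?x / t i)" if "i \<in> J" for i
      using \<phi>_inverse_den[of "?x / t i"] zn[of i] nz y that J by auto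
    then have po: "(\<Prod>i\<in>J. num0 (?x / t i)) = (\<Prod>i\<in>J. \<phi> (t i / ?x)) * (\<Prod>i\<in>J. den (?x / t i))"
      unfolding prod.distrib[symmetric] by (intro prod.cong) auto
    have pi: "(\<Prod>j\<in>Y - {y} - J. num1 (?x / t j)) = (\<Prod>j\<in>Y - {y} - J. \<phi> (?x / t j)) * (\<Prod>j\<in>Y - {y} - J. den (?x / t j))"
      unfolding prod.distrib[symmetric] using zn by (intro prod.cong) (auto simp: \<phi>_den)
    have Yy: "Y - insert y J = Y - {y} - J" by auto
    have YJ: "(\<Prod>j\<in>Y - J. num1 (?x / t j)) = num1 (?x / t y) * (\<Prod>j\<in>Y - {y} - J. num1 (?x / t j))"
    proof -
      have "Y - J = insert y (Y - {y} - J)" using J y by auto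
      then show ?thesis using assms by simp
    qed
    have u': "\<theta> (u * ?x) * \<theta> (v * ?x) = \<psi> u v ?x * (\<theta> (q * u * ?x / b) * \<theta> (q * v * ?x / b))"
      using uv by (simp add: \<psi>_def)
    have q1: "\<theta> (q * (?A * ?x) / b) * poles_but ?n (card J) a ?x = e1 (?A * ?x) * poles ?n a ?x"
      by (rule poles_but_e1[OF _ Av]) (use lt in simp)
    have q0: "\<theta> (b * (?A * ?x)) * poles_but ?n (Suc (card J)) a ?x = e0 (?A * ?x) * poles ?n a ?x"
      by (rule poles_but_e0[OF _ Av]) (use lt in simp)
    show ?thesis
      unfolding cl_in_def cl_out_def subset_term_remove[OF assms(1) y J(1)] subset_term_insert[OF assms(1) y J(1)]
        card Yy YJ q1 q0 u' prod.insert[OF J(2,3)] po pi pp by (simp add: mult_ac)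
  qed
  ultimately show "cl_in Y t a u v J ?x + cl_out Y t a u v J ?x +
      (cl_in Y t a u v (insert y J) ?x + cl_out Y t a u v (insert y J) ?x) = 0"
    by simp
qed

lemma cleared_sum_remove:
  assumes "finite Y" "y \<in> Y" and "\<And>J. J \<in> Pow (Y - {y}) \<Longrightarrow>
    cl_in Y t a u v J x + cl_out Y t a u v J x + (cl_in Y t a u v (insert y J) x + cl_out Y t a u v (insert y J) x)
      = C * K * (w (a * q) u v (card J) * subset_term (Y - {y}) t u v (a * q * q ^ card J) J)"
  shows "cleared Y t a u v x = C * (K * S (Y - {y}) t (a * q) u v)"
  unfolding cleared_def sum_Pow_remove[OF assms(1,2)] S_def using assms(3)
  by (simp add: sum_distrib_left mult.assoc)

text \<open>Both \<open>den\<close> and \<open>num0\<close> vanish at b, so only the terms with the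
  new variable inside the subset and y outside survive. Their factors \<open>e1\<close> and
  \<open>e0\<close> are inverse to each other, the interactions with the remaining variables do not
  depend on J, and the one certain member of the subset shifts \<open>a\<close> to a q.\<close>

lemma cleared_shifted_up:
  assumes "finite Y" and g: "generic a u v Y t" and y: "y \<in> Y"
  shows "cleared Y t a u v (b * t y) = num1 b * (\<theta> (u * (b * t y)) * \<theta> (v * (b * t y)))
    * poles (Suc (card Y)) a (b * t y) * (\<Prod>j\<in>Y - {y}. num1 (b * t y / t j))
    * (\<kappa>2 a u v * S (Y - {y}) t (a * q) u v)"
proof -
  let ?x = "b * t y" and ?n = "Suc (card Y)"
  let ?C = "num1 b * (\<theta> (u * ?x) * \<theta> (v * ?x)) * poles ?n a ?x * (\<Prod>j\<in>Y - {y}. num1 (?x / t j))"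
  note nz = generic_nz[OF g]
  have "cl_in Y t a u v J ?x + cl_out Y t a u v J ?x + (cl_in Y t a u v (insert y J) ?x + cl_out Y t a u v (insert y J) ?x)
      = ?C * \<kappa>2 a u v * (w (a * q) u v (card J) * subset_term (Y - {y}) t u v (a * q * q ^ card J) J)"
    if "J \<in> Pow (Y - {y})" for J
  proof -
    have J: "J \<subseteq> Y - {y}" "finite J" "y \<notin> J"
      using that assms by (auto intro: finite_subset)
    have lt: "card J < ?n"
      using J(1) card_mono[OF assms(1)] by (meson Diff_subset le_imp_less_Suc order_trans)
    have "den (?x / t y) = 0" "num0 (?x / t y) = 0" using nz y by (simp_all add: den_def num0_def)
    then have Z: "(\<Prod>j\<in>Y - J. den (?x / t j)) = 0" "(\<Prod>j\<in>insert y J. den (?x / t j)) = 0" "(\<Prod>j\<in>insert y J. num0 (?x / t j)) = 0"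
      using assms(1) J y by (blast intro: prod_zero)+
    have zero: "cl_out Y t a u v J ?x = 0" "cl_in Y t a u v (insert y J) ?x = 0" "cl_out Y t a u v (insert y J) ?x = 0"
      unfolding cl_in_def cl_out_def Z by (simp_all only: mult_zero_left mult_zero_right)
    let ?A = "a * q ^ Suc (card J)"
    have nA: "\<theta> (?A * ?x) \<noteq> 0" "\<theta> (b * (?A * t y)) \<noteq> 0" "\<theta> (q * (?A * t y)) \<noteq> 0"
      by (rule generic_var[OF g y, of _ 1 1 0 0 "int (Suc (card J))"]
          generic_var[OF g y, of _ 1 0 0 0 "int (Suc (Suc (card J)))"]; (simp only: power_int_of_nat)?; simp add: mult_ac)+
    have q1: "\<theta> (q * (?A * ?x) / b) * poles_but ?n (card J) a ?x = e1 (?A * ?x) * poles ?n a ?x"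
      by (rule poles_but_e1) (use lt nA in auto)
    have ee: "e0 (?A * t y) * e1 (?A * ?x) = 1"
      using e0_e1[OF nA(2,3)] by (simp add: mult_ac)
    have pi: "num1 (?x / t i) = \<phi> (t i / t y) * den (?x / t i)" if "i \<in> J" for i
    proof -
      have "i \<in> Y" "y \<noteq> i" using that J by auto
      then show ?thesis
        using generic_ratio_nz(1,3)[OF g y, of i] den_b[of "t y / t i"] nz \<open>i \<in> Y\<close> y by simp
    qed
    have Yy: "Y - J = insert y (Y - {y} - J)" using J y by auto
    have "(\<Prod>j\<in>Y - {y}. num1 (?x / t j)) = (\<Prod>j\<in>Y - {y} - J. num1 (?x / t j)) * (\<Prod>j\<in>J. num1 (?x / t j))"
      using assms J by (intro prod.subset_diff) auto
    also have "(\<Prod>j\<in>J. num1 (?x / t j)) = (\<Prod>i\<in>J. \<phi> (t i / t y)) * (\<Prod>i\<in>J. den (?x / t i))"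
      unfolding prod.distrib[symmetric] using pi by (intro prod.cong) auto
    finally have P: "(\<Prod>j\<in>Y - {y}. num1 (?x / t j)) = (\<Prod>j\<in>Y - {y} - J. num1 (?x / t j)) * ((\<Prod>i\<in>J. \<phi> (t i / t y)) * (\<Prod>i\<in>J. den (?x / t i)))" .
    have P': "(\<Prod>j\<in>Y - J. num1 (?x / t j)) = num1 b * (\<Prod>j\<in>Y - {y} - J. num1 (?x / t j))"
      unfolding Yy using assms nz y by simp
    have "cl_in Y t a u v J ?x = (e0 (?A * t y) * e1 (?A * ?x)) *
      (?C * \<kappa>2 a u v * (w (a * q) u v (card J) * subset_term (Y - {y}) t u v ?A J))"
      unfolding cl_in_def subset_term_remove[OF assms(1) y J(1)] q1 P P' w_Suc_\<kappa>2 by (simp only: mult_ac)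
    then show ?thesis unfolding ee zero by (simp add: mult_ac)
  qed
  from cleared_sum_remove[OF assms(1) y this] show ?thesis .
qed

text \<open>The mirror image: at 1/b the functions \<open>den\<close> and \<open>num1\<close>
  vanish, so y is inside the subset and the new variable outside.\<close>

lemma cleared_shifted_down:
  assumes "finite Y" and g: "generic a u v Y t" and y: "y \<in> Y"
  shows "cleared Y t a u v (t y / b) = num0 (1 / b) * (\<theta> (q * u * (t y / b) / b) * \<theta> (q * v * (t y / b) / b)) * \<psi> u v (t y)
    * poles (Suc (card Y)) a (t y / b) * (\<Prod>j\<in>Y - {y}. num0 (t y / b / t j))
    * (\<kappa>2 a u v * S (Y - {y}) t (a * q) u v)"
proof -
  let ?x = "t y / b" and ?n = "Suc (card Y)"
  let ?C = "num0 (1 / b) * (\<theta> (q * u * ?x / b) * \<theta> (q * v * ?x / b)) * \<psi> u v (t y) * poles ?n a ?x * (\<Prod>j\<in>Y - {y}. num0 (?x / t j))"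
  note nz = generic_nz[OF g]
  have "cl_in Y t a u v J ?x + cl_out Y t a u v J ?x + (cl_in Y t a u v (insert y J) ?x + cl_out Y t a u v (insert y J) ?x)
      = ?C * \<kappa>2 a u v * (w (a * q) u v (card J) * subset_term (Y - {y}) t u v (a * q * q ^ card J) J)"
    if "J \<in> Pow (Y - {y})" for J
  proof -
    have J: "J \<subseteq> Y - {y}" "finite J" "y \<notin> J"
      using that assms by (auto intro: finite_subset)
    then have card: "card (insert y J) = Suc (card J)" by simp
    have lt: "Suc (card J) < ?n"
    proof -
      have "insert y J \<subseteq> Y" using J y by auto
      from card_mono[OF assms(1) this] show ?thesis unfolding card by simp
    qed
    have "den (?x / t y) = 0" "num1 (?x / t y) = 0" using nz y by (simp_all add: den_def num1_def)
    then have Z: "(\<Prod>j\<in>Y - J. num1 (?x / t j)) = 0" "(\<Prod>j\<in>Y - J. den (?x / t j)) = 0" "(\<Prod>j\<in>insert y J. den (?x / t j)) = 0"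
      using assms(1) J y by (blast intro: prod_zero)+
    have zero: "cl_in Y t a u v J ?x = 0" "cl_out Y t a u v J ?x = 0" "cl_in Y t a u v (insert y J) ?x = 0"
      unfolding cl_in_def cl_out_def Z by (simp_all only: mult_zero_left mult_zero_right)
    let ?A = "a * q ^ Suc (card J)"
    have nA: "\<theta> (?A * t y) \<noteq> 0" "\<theta> (a * q ^ Suc (Suc (card J)) * ?x) \<noteq> 0" "\<theta> (q * (?A * t y) / b) \<noteq> 0"
      by (rule generic_var[OF g y, of _ 1 0 0 0 "int (Suc (card J))"] generic_var[OF g y, of _ 1 "-1" 0 0 "int (Suc (Suc (card J)))"];
          (simp only: power_int_of_nat)?; simp add: field_simps)+
    have q0: "\<theta> (b * (?A * ?x)) * poles_but ?n (Suc (card J)) a ?x = e0 (?A * ?x) * poles ?n a ?x"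
      by (rule poles_but_e0) (use lt nA in auto)
    have ee: "e1 (?A * t y) * e0 (?A * ?x) = 1"
      using e1_e0[OF nA(1,3)] by (simp add: mult_ac)
    have pi: "num0 (?x / t j) = \<phi> (t y / t j) * den (?x / t j)" if "j \<in> Y - {y} - J" for j
    proof -
      have "j \<in> Y" "y \<noteq> j" using that J by auto
      then show ?thesis
        using generic_ratio_nz(1,2)[OF g y, of j] den_inverse_b[of "t y / t j"] by (simp add: mult_ac)
    qed
    have Yy: "Y - insert y J = Y - {y} - J" by auto
    have "(\<Prod>j\<in>Y - {y}. num0 (?x / t j)) = (\<Prod>j\<in>Y - {y} - J. num0 (?x / t j)) * (\<Prod>j\<in>J. num0 (?x / t j))"
      using assms J by (intro prod.subset_diff) auto
    also have "(\<Prod>j\<in>Y - {y} - J. num0 (?x / t j)) = (\<Prod>i\<in>Y - {y} - J. \<phi> (t y / t i)) * (\<Prod>i\<in>Y - {y} - J. den (?x / t i))"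
      unfolding prod.distrib[symmetric] using pi by (intro prod.cong) auto
    finally have P: "(\<Prod>j\<in>Y - {y}. num0 (?x / t j)) = (\<Prod>i\<in>Y - {y} - J. \<phi> (t y / t i)) * (\<Prod>i\<in>Y - {y} - J. den (?x / t i)) * (\<Prod>j\<in>J. num0 (?x / t j))" .
    have P': "(\<Prod>j\<in>insert y J. num0 (?x / t j)) = num0 (1 / b) * (\<Prod>j\<in>J. num0 (?x / t j))"
      using J nz y by simp
    have "cl_out Y t a u v (insert y J) ?x = (e1 (?A * t y) * e0 (?A * ?x)) *
      (?C * \<kappa>2 a u v * (w (a * q) u v (card J) * subset_term (Y - {y}) t u v ?A J))"
      unfolding cl_out_def subset_term_insert[OF assms(1) y J(1)] card q0 P P' Yy w_Suc_\<kappa>2 by (simp only: mult_ac)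
    then show ?thesis unfolding ee zero by (simp add: mult_ac)
  qed
  from cleared_sum_remove[OF assms(1) y this] show ?thesis .
qed

text \<open>Here \<theta>(q u x/b) = \<theta>(1) = 0 removes the terms without the new variable. In
  the others that variable is absorbed into the shifts of \<open>a\<close> and \<open>u\<close> by
  q, through \<open>\<psi>_den\<close> and \<open>w_Suc_\<kappa>1\<close>. The point b/(q v) is
  reduced to this one by the symmetry in \<open>u\<close> and \<open>v\<close>.\<close>

lemma cleared_u:
  assumes "finite Y" and g: "generic a u v Y t" and x: "x = b / (q * u)"
  shows "cleared Y t a u v x = (\<theta> (u * x) * \<theta> (v * x)) * poles (Suc (card Y)) a x * (\<Prod>j\<in>Y. num1 (x / t j))
    * (\<kappa>1 a v * S Y t (a * q) (u * q) v)"
proof -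
  let ?n = "Suc (card Y)"
  let ?C = "(\<theta> (u * x) * \<theta> (v * x)) * poles ?n a x * (\<Prod>j\<in>Y. num1 (x / t j))"
  note nz = generic_nz[OF g]
  have "cl_in Y t a u v J x + cl_out Y t a u v J x
      = ?C * \<kappa>1 a v * (w (a * q) (u * q) v (card J) * subset_term Y t (u * q) v (a * q * q ^ card J) J)"
    if "J \<in> Pow Y" for J
  proof -
    have J: "J \<subseteq> Y" "finite J"
      using that assms by (auto intro: finite_subset)
    have lt: "card J < ?n"
      using card_mono[OF assms(1), of J] J by auto
    have zero: "cl_out Y t a u v J x = 0"
      using nz by (simp add: cl_out_def x)
    let ?A = "a * q ^ Suc (card J)"
    note nA = generic_const_nz(1,3)[OF g, of "card J"]
    have nA': "\<theta> (?A * x) \<noteq> 0"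
      using nA(1) nz by (simp add: x mult_ac)
    have q1: "\<theta> (q * (?A * x) / b) * poles_but ?n (card J) a x = e1 (?A * x) * poles ?n a x"
      by (rule poles_but_e1) (use lt nA' in auto)
    have we: "w a u v (Suc (card J)) * e1 (?A * x) = \<kappa>1 a v * w (a * q) (u * q) v (card J)"
      unfolding x by (rule w_Suc_\<kappa>1[OF nz(2) nA])
    have pb: "\<psi> u v (t i) * den (x / t i) = \<psi> (u * q) v (t i) * num1 (x / t i)" if "i \<in> J" for i
    proof (rule \<psi>_den[OF x])
      have i: "i \<in> Y" using that J by auto
      show "\<theta> (u * t i) \<noteq> 0" "\<theta> (q * u * t i / b) \<noteq> 0" "\<theta> (q * u * t i) \<noteq> 0" "\<theta> (q * (q * u) * t i / b) \<noteq> 0"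
        by (rule generic_var[OF g i, of _ 0 0 1 0 0] generic_var[OF g i, of _ 0 "-1" 1 0 1]
          generic_var[OF g i, of _ 0 0 1 0 1] generic_var[OF g i, of _ 0 "-1" 1 0 2]; simp add: field_simps power2_eq_square)+
    qed (use nz that J in auto)
    have P: "(\<Prod>i\<in>J. \<psi> u v (t i)) * (\<Prod>i\<in>J. den (x / t i)) = (\<Prod>i\<in>J. \<psi> (u * q) v (t i)) * (\<Prod>i\<in>J. num1 (x / t i))"
      unfolding prod.distrib[symmetric] using pb by (intro prod.cong) auto
    have P': "(\<Prod>j\<in>Y. num1 (x / t j)) = (\<Prod>j\<in>Y - J. num1 (x / t j)) * (\<Prod>j\<in>J. num1 (x / t j))"
      using assms J by (intro prod.subset_diff) auto
    have "cl_in Y t a u v J x = (w a u v (Suc (card J)) * e1 (?A * x)) * ((\<Prod>i\<in>J. \<psi> u v (t i)) * (\<Prod>i\<in>J. den (x / t i)))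
       * ((\<Prod>i\<in>J. e1 (?A * t i)) * (\<Prod>j\<in>Y - J. e0 (?A * t j)) * (\<Prod>i\<in>J. \<Prod>j\<in>Y - J. \<phi> (t i / t j)))
       * ((\<theta> (u * x) * \<theta> (v * x)) * poles ?n a x * (\<Prod>j\<in>Y - J. num1 (x / t j)))"
      unfolding cl_in_def q1 subset_term_def prod.distrib by (simp only: mult_ac)
    also have "\<dots> = ?C * \<kappa>1 a v * (w (a * q) (u * q) v (card J) * subset_term Y t (u * q) v ?A J)"
      unfolding we P P' subset_term_def prod.distrib by (simp only: mult_ac)
    finally show ?thesis unfolding zero by (simp add: mult_ac)
  qed
  then have "cleared Y t a u v x = (\<Sum>J\<in>Pow Y. ?C * \<kappa>1 a v * (w (a * q) (u * q) v (card J) * subset_term Y t (u * q) v (a * q * q ^ card J) J))"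
    unfolding cleared_def by (intro sum.cong) auto
  then show ?thesis
    unfolding S_def by (simp add: sum_distrib_left mult_ac)
qed

lemma \<psi>_swap: "\<psi> u v = \<psi> v u"
  by (rule ext) (simp add: \<psi>_def mult_ac)

lemma w_swap: "w a u v = w a v u"
  by (rule ext) (simp add: w_def mult_ac)

lemma subset_term_swap: "subset_term X t u v = subset_term X t v u"
  unfolding subset_term_def by (subst \<psi>_swap) simp

lemma cleared_swap: "cleared Y t a u v x = cleared Y t a v u x"
  unfolding cleared_def cl_in_def cl_out_def
  by (subst (1 2) w_swap, subst (1 2) subset_term_swap) (simp only: mult_ac)

subsection \<open>The induction\<close>

lemma theta_fun_etheta': "\<alpha> \<noteq> 0 \<Longrightarrow> (\<And>x. f x = \<alpha> * x) \<Longrightarrow> theta_fun p 1 \<alpha> (\<lambda>x. \<theta> (f x))"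
  using theta_fun_etheta[of \<alpha> p] by simp

lemma theta_fun_eqI: "theta_fun p D \<nu> f \<Longrightarrow> D = D' \<Longrightarrow> \<nu> = \<nu>' \<Longrightarrow> theta_fun p D' \<nu>' f"
  by simp

lemma theta_fun_den:
  assumes "t \<noteq> 0"
  shows "theta_fun p 3 (1 / t ^ 3) (\<lambda>x. den (x / t))"
    "theta_fun p 3 (1 / t ^ 3) (\<lambda>x. num1 (x / t))"
    "theta_fun p 3 (1 / t ^ 3) (\<lambda>x. num0 (x / t))"
proof -
  have mult3: "theta_fun p 3 (1 / t ^ 3) (\<lambda>x. \<theta> (f x) * \<theta> (g x) * \<theta> (h x))"
    if "\<And>x. f x = \<alpha> * x" "\<And>x. g x = \<beta> * x" "\<And>x. h x = \<gamma> * x" "\<alpha> * \<beta> * \<gamma> = 1 / t ^ 3" for f g h \<alpha> \<beta> \<gamma>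
  proof -
    have nz: "\<alpha> \<noteq> 0" "\<beta> \<noteq> 0" "\<gamma> \<noteq> 0" using that(4) assms by auto
    show ?thesis
      by (rule theta_fun_eqI[OF theta_fun_mult[OF theta_fun_mult[OF theta_fun_etheta'[OF nz(1)] theta_fun_etheta'[OF nz(2)]]
        theta_fun_etheta'[OF nz(3)]]]) (use that in simp_all)
  qed
  show "theta_fun p 3 (1 / t ^ 3) (\<lambda>x. den (x / t))"
    unfolding den_def by (rule mult3[of _ "1 / t" _ "1 / (t * b)" _ "b / t"]) (use assms in \<open>simp_all add: power3_eq_cube\<close>)
  show "theta_fun p 3 (1 / t ^ 3) (\<lambda>x. num1 (x / t))"
    unfolding num1_def by (rule mult3[of _ "1 / (t * q)" _ "q / (t * b)" _ "b / t"]) (use assms in \<open>simp_all add: power3_eq_cube\<close>)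
  show "theta_fun p 3 (1 / t ^ 3) (\<lambda>x. num0 (x / t))"
    unfolding num0_def by (rule mult3[of _ "q / t" _ "b / (t * q)" _ "1 / (t * b)"]) (use assms in \<open>simp_all add: power3_eq_cube\<close>)
qed

lemma theta_fun_poles:
  assumes "a \<noteq> 0"
  shows "theta_fun p n (\<Prod>l\<in>{1..n}. a * q ^ l) (poles n a)"
proof -
  have "theta_fun p (\<Sum>l\<in>{1..n}. 1) (\<Prod>l\<in>{1..n}. a * q ^ l) (\<lambda>x. \<Prod>l\<in>{1..n}. \<theta> (a * q ^ l * x))"
    by (rule theta_fun_prod, simp, rule theta_fun_etheta') (use assms in simp_all)
  then show ?thesis by (simp add: poles_def[abs_def])
qed

lemma theta_fun_poles_but:
  assumes "a \<noteq> 0" "k < n"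
  shows "theta_fun p (n - 1) ((\<Prod>l\<in>{1..n}. a * q ^ l) / (a * q ^ Suc k)) (poles_but n k a)"
proof -
  have "theta_fun p (\<Sum>l\<in>{1..n} - {Suc k}. 1) (\<Prod>l\<in>{1..n} - {Suc k}. a * q ^ l) (\<lambda>x. \<Prod>l\<in>{1..n} - {Suc k}. \<theta> (a * q ^ l * x))"
    by (rule theta_fun_prod, simp, rule theta_fun_etheta') (use assms in simp_all)
  moreover have "(\<Prod>l\<in>{1..n}. a * q ^ l) = (a * q ^ Suc k) * (\<Prod>l\<in>{1..n} - {Suc k}. a * q ^ l)"
    by (rule prod.remove) (use assms in auto)
  ultimately show ?thesis using assms by (simp add: poles_but_def[abs_def])
qed

text \<open>The multiplier must be the same for all terms: the power a q^|J| in the factor from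
  \<open>e1\<close> or \<open>e0\<close> cancels against the parameter missing in
  \<open>poles_but\<close>, and u v q/b remains in \<open>cl_in\<close> as well as in
  \<open>cl_out\<close>. The degree consists of 3 for each y in Y, 2 from \<psi>, and |Y| + 1 from
  the poles.\<close>

lemma theta_fun_cleared:
  assumes "finite Y" and g: "generic a u v Y t"
  shows "theta_fun p (Suc (card Y) + 2 + 3 * card Y)
    (u * v * q / b * (\<Prod>l\<in>{1..Suc (card Y)}. a * q ^ l) * (\<Prod>j\<in>Y. 1 / t j ^ 3)) (cleared Y t a u v)"
proof -
  note nz = generic_nz[OF g]
  let ?n = "Suc (card Y)"
  let ?P = "\<Prod>l\<in>{1..?n}. a * q ^ l"
  let ?\<nu> = "u * v * q / b * ?P * (\<Prod>j\<in>Y. 1 / t j ^ 3)"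
  have part: "theta_fun p (3 * card Y) (\<Prod>j\<in>Y. 1 / t j ^ 3) (\<lambda>x. (\<Prod>j\<in>Y - J. f (x / t j)) * (\<Prod>j\<in>J. f' (x / t j)))"
    if "J \<subseteq> Y" and f: "\<And>j. j \<in> Y \<Longrightarrow> theta_fun p 3 (1 / t j ^ 3) (\<lambda>x. f (x / t j))"
      "\<And>j. j \<in> Y \<Longrightarrow> theta_fun p 3 (1 / t j ^ 3) (\<lambda>x. f' (x / t j))" for J f f'
  proof -
    have "finite J" using that assms finite_subset by blast
    have "theta_fun p ((\<Sum>j\<in>Y - J. 3) + (\<Sum>j\<in>J. 3)) ((\<Prod>j\<in>Y - J. 1 / t j ^ 3) * (\<Prod>j\<in>J. 1 / t j ^ 3))
        (\<lambda>x. (\<Prod>j\<in>Y - J. f (x / t j)) * (\<Prod>j\<in>J. f' (x / t j)))"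
      using that assms \<open>finite J\<close> by (intro theta_fun_mult theta_fun_prod) auto
    moreover have "(\<Sum>j\<in>Y - J. 3) + (\<Sum>j\<in>J. 3) = (3 * card Y :: nat)"
      using sum.subset_diff[OF that(1) assms(1), of "\<lambda>j. 3 :: nat"] by simp
    ultimately show ?thesis
      using prod.subset_diff[OF that(1) assms(1), of "\<lambda>j. 1 / t j ^ 3"] by simp
  qed
  have "theta_fun p (?n + 2 + 3 * card Y) ?\<nu> (cl_in Y t a u v J)" if "J \<in> Pow Y" for J
  proof -
    have J: "J \<subseteq> Y" using that by simp
    have lt: "card J < ?n"
      using card_mono[OF assms(1) J] by simp
    have "theta_fun p ((1 + 1) + (1 + (?n - 1)) + 3 * card Y) ((u * v) * ((q * (a * q ^ Suc (card J)) / b) * (?P / (a * q ^ Suc (card J))))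
        * (\<Prod>j\<in>Y. 1 / t j ^ 3)) (\<lambda>x. (\<theta> (u * x) * \<theta> (v * x)) * (\<theta> (q * (a * q ^ Suc (card J) * x) / b) * poles_but ?n (card J) a x)
         * ((\<Prod>j\<in>Y - J. num1 (x / t j)) * (\<Prod>i\<in>J. den (x / t i))))"
      using nz by (intro theta_fun_mult theta_fun_etheta' theta_fun_poles_but part theta_fun_den J lt) auto
    from theta_fun_scale[OF this, of "w a u v (Suc (card J)) * subset_term Y t u v (a * q ^ Suc (card J)) J"]
    show ?thesis
      unfolding cl_in_def[abs_def] by (rule theta_fun_cong[OF theta_fun_eqI]) (use nz in \<open>simp_all add: mult_ac\<close>)
  qed
  moreover have "theta_fun p (?n + 2 + 3 * card Y) ?\<nu> (cl_out Y t a u v J)" if "J \<in> Pow Y" for J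
  proof -
    have J: "J \<subseteq> Y" using that by simp
    have lt: "card J < ?n"
      using card_mono[OF assms(1) J] by simp
    have "theta_fun p ((1 + 1) + (1 + (?n - 1)) + 3 * card Y) (((q * u / b) * (q * v / b)) * ((b * (a * q ^ card J)) * (?P / (a * q ^ Suc (card J))))
        * (\<Prod>j\<in>Y. 1 / t j ^ 3)) (\<lambda>x. (\<theta> (q * u * x / b) * \<theta> (q * v * x / b)) * (\<theta> (b * (a * q ^ card J * x)) * poles_but ?n (card J) a x)
         * ((\<Prod>j\<in>Y - J. den (x / t j)) * (\<Prod>i\<in>J. num0 (x / t i))))"
      using nz by (intro theta_fun_mult theta_fun_etheta' theta_fun_poles_but part theta_fun_den J lt) auto
    from theta_fun_scale[OF this, of "w a u v (card J) * subset_term Y t u v (a * q ^ card J) J"]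
    show ?thesis
      unfolding cl_out_def[abs_def] by (rule theta_fun_cong[OF theta_fun_eqI]) (use nz in \<open>simp_all add: mult_ac\<close>)
  qed
  ultimately show ?thesis
    unfolding cleared_def[abs_def] by (intro theta_fun_sum theta_fun_add)
qed

definition dual where "dual n a u v = u * v / (a * b * q ^ n)"

text \<open>The difference of the two sides of \<open>S_dual\<close>, cleared of denominators. Each
  \<open>cleared\<close> accounts for the poles of its own point only, so each is multiplied by the
  poles of the other point.\<close>

definition gap where
  "gap Y t a u v x = cleared Y t a u v x * poles (Suc (card Y)) (dual (Suc (card Y)) a u v) x
    - w a u v (Suc (card Y)) * cleared Y t (dual (Suc (card Y)) a u v) u v x * poles (Suc (card Y)) a x"

text \<open>Exponent vectors of b/(q u), b/(q v), 1/(a q^l) and 1/(a' q^l), where a' is the dual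
  point. With vectors in place of complex numbers, that nodes are distinct modulo powers of
  \<open>p\<close> reduces to integer vectors being distinct.\<close>

definition const_nodes :: "nat \<Rightarrow> (int \<times> int \<times> int \<times> int \<times> int) set" where
  "const_nodes n = {(0, 1, -1, 0, -1), (0, 1, 0, -1, -1)} \<union> (\<lambda>l. (-1, 0, 0, 0, - int l)) ` {1..n}
    \<union> (\<lambda>l. (1, 1, -1, -1, int n - int l)) ` {1..n}"

lemma const_nodes_split:
  fixes f :: "_ \<Rightarrow> 'c :: comm_monoid_mult"
  shows "(\<Prod>e\<in>const_nodes n. f e) = f (0, 1, -1, 0, -1) * f (0, 1, 0, -1, -1) * (\<Prod>l\<in>{1..n}. f (-1, 0, 0, 0, - int l))
    * (\<Prod>l\<in>{1..n}. f (1, 1, -1, -1, int n - int l))"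
  and "card (const_nodes n) = 2 + 2 * n"
proof -
  show "(\<Prod>e\<in>const_nodes n. f e) = f (0, 1, -1, 0, -1) * f (0, 1, 0, -1, -1) * (\<Prod>l\<in>{1..n}. f (-1, 0, 0, 0, - int l))
    * (\<Prod>l\<in>{1..n}. f (1, 1, -1, -1, int n - int l))"
    unfolding const_nodes_def
    by (subst prod.union_disjoint; (subst prod.union_disjoint)?) (auto simp: prod.reindex inj_on_def)
  show "card (const_nodes n) = 2 + 2 * n"
    unfolding const_nodes_def
    by (subst card_Un_disjoint; (subst card_Un_disjoint)?) (auto simp: card_image inj_on_def)
qed

lemma finite_const_nodes: "finite (const_nodes n)"
  by (simp add: const_nodes_def)

definition node :: "complex \<Rightarrow> complex \<Rightarrow> complex \<Rightarrow> ('i \<Rightarrow> complex) \<Rightarrow> 'i \<times> int + int \<times> int \<times> int \<times> int \<times> int \<Rightarrow> complex" where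
  "node a u v t = case_sum (\<lambda>(y, e). b powi e * t y) (monomial a u v)"

definition nodes :: "'i set \<Rightarrow> ('i \<times> int + int \<times> int \<times> int \<times> int \<times> int) set" where
  "nodes Y = (Y \<times> {-1, 0, 1}) <+> const_nodes (Suc (card Y))"

lemma node_ratio:
  assumes g: "generic a u v Y t" and "i \<in> nodes Y" "j \<in> nodes Y" "i \<noteq> j"
  shows "\<theta> (node a u v t i / node a u v t j) \<noteq> 0"
proof -
  note nz = generic_nz[OF g]
  have mixed: "\<theta> (b powi e * t y / monomial a u v c) \<noteq> 0" if "y \<in> Y" for y e c
  proof -
    obtain i j k l r where c: "c = (i, j, k, l, r)" by (cases c) auto
    show ?thesis
      by (rule generic_var[OF g that, of _ "- i" "e - j" "- k" "- l" "- r"])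
        (use nz in \<open>simp add: c monomial_def power_int_minus power_int_diff field_simps\<close>)
  qed
  have nzn: "b powi e * t y \<noteq> 0" if "y \<in> Y" for y e using nz(4)[OF that] by simp
  have nzm: "monomial a u v c \<noteq> 0" for c using nz by (cases c) (simp add: monomial_def)
  show ?thesis
  proof (cases i; cases j)
    fix ye ye' assume ij: "i = Inl ye" "j = Inl ye'"
    obtain y e y' e' where y: "ye = (y, e)" "ye' = (y', e')" by (cases ye, cases ye') auto
    have Y: "y \<in> Y" "y' \<in> Y" using assms ij y by (auto simp: nodes_def)
    show ?thesis
    proof (cases "y = y'")
      case True
      then have "e - e' \<noteq> 0" using assms ij y by auto
      moreover have "node a u v t i / node a u v t j = a powi 0 * b powi (e - e') * u powi 0 * v powi 0 * q powi 0"
        using nz Y True by (simp add: node_def ij y power_int_diff)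
      ultimately show ?thesis using generic_const[OF g] by blast
    next
      case False
      have "node a u v t i / node a u v t j = b powi (e - e') * t y / t y'"
        by (simp add: node_def ij y power_int_diff)
      then show ?thesis using generic_ratio[OF g Y False] by blast
    qed
  next
    fix ye c assume ij: "i = Inl ye" "j = Inr c"
    obtain y e where y: "ye = (y, e)" by (cases ye) auto
    with assms ij have "y \<in> Y" by (auto simp: nodes_def)
    with mixed show ?thesis by (simp add: node_def ij y)
  next
    fix c ye assume ij: "i = Inr c" "j = Inl ye"
    obtain y e where y: "ye = (y, e)" by (cases ye) auto
    with assms ij have "y \<in> Y" by (auto simp: nodes_def)
    then show ?thesis
      using mixed nzn nzm \<theta>_swap[of "monomial a u v c" "b powi e * t y"] by (simp add: node_def ij y)
  next
    fix c c' assume ij: "i = Inr c" "j = Inr c'"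
    obtain i1 i2 i3 i4 i5 j1 j2 j3 j4 j5 where c: "c = (i1, i2, i3, i4, i5)" "c' = (j1, j2, j3, j4, j5)"
      by (cases c, cases c') auto
    have "node a u v t i / node a u v t j = a powi (i1 - j1) * b powi (i2 - j2) * u powi (i3 - j3) * v powi (i4 - j4) * q powi (i5 - j5)"
      using nz by (simp add: node_def ij c monomial_def power_int_diff)
    moreover have "(i1 - j1, i2 - j2, i3 - j3, i4 - j4, i5 - j5) \<noteq> (0, 0, 0, 0, 0)"
      using assms ij c by auto
    ultimately show ?thesis using generic_const[OF g] by blast
  qed
qed

lemma poles_zero:
  assumes "l \<in> {1..n}" "a \<noteq> 0" "x = 1 / (a * q ^ l)"
  shows "poles n a x = 0"
  unfolding poles_def
  by (rule prod_zero, simp, rule bexI[of _ l]) (use assms in simp_all)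

lemma S_empty: "S {} t a u v = 1"
  by (simp add: S_def subset_term_def w_def)

theorem S_dual:
  assumes "finite X" "generic a u v X t"
  shows "S X t a u v = w a u v (card X) * S X t (dual (card X) a u v) u v"
  using assms
proof (induction "card X" arbitrary: X a u v rule: less_induct)
  case less
  note g = less.prems(2)
  note nz = generic_nz[OF g]
  show ?case
  proof (cases "X = {}")
    case True
    then show ?thesis by (simp add: S_empty w_def)
  next
    case False
    then obtain z where z: "z \<in> X" by auto
    define Y where "Y = X - {z}"
    have X: "X = insert z Y" and Y: "finite Y" "z \<notin> Y" and cX: "card X = Suc (card Y)"
      using z less.prems card_Suc_Diff1[OF less.prems(1) z] by (auto simp: Y_def)
    have gY: "generic a u v Y t" using g by (rule generic_subset) (auto simp: Y_def)
    let ?n = "Suc (card Y)"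
    define a' where "a' = dual ?n a u v"
    have g': "generic a' u v X t" and gY': "generic a' u v Y t"
      unfolding a'_def dual_def by (rule generic_dual[OF g], rule generic_dual[OF gY])
    note nz' = generic_nz[OF g']
    \<comment> \<open>For one variable less and \<open>a\<close> replaced by a q the dual point is
      a' q, so the induction hypothesis relates exactly the two sums that occur at b t_y, and again
      at t_y/b. The constants agree by \<open>w_\<kappa>2_dual\<close>.\<close>
    have IH: "\<kappa>2 a u v * S (Y - {y}) t (a * q) u v = w a u v ?n * (\<kappa>2 a' u v * S (Y - {y}) t (a' * q) u v)"
      if y: "y \<in> Y" for y
    proof -
      have c: "card Y = Suc (card (Y - {y}))" using card_Suc_Diff1[OF Y(1) y] by simp
      have "S (Y - {y}) t (a * q) u v = w (a * q) u v (card (Y - {y})) * S (Y - {y}) t (dual (card (Y - {y})) (a * q) u v) u v"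
        by (rule less.hyps) (use c cX Y gY in \<open>auto intro: generic_subset generic_shift\<close>)
      moreover have "dual (card (Y - {y})) (a * q) u v = a' * q"
        using nz by (simp add: a'_def dual_def c)
      moreover have "\<kappa>2 a u v * w (a * q) u v (card (Y - {y})) = w a u v ?n * \<kappa>2 a' u v"
        unfolding w_Suc_\<kappa>2[symmetric] c[symmetric]
      proof (rule w_\<kappa>2_dual[OF nz(1-3)])
        show "a' = u * v / (a * b * q ^ Suc (card Y))" by (simp add: a'_def dual_def)
      qed (rule generic_const_nz[OF g])+
      ultimately show ?thesis by (simp add: mult_ac)
    qed
    \<comment> \<open>Here \<open>u\<close> and \<open>v\<close> are bound anew, since the statement
      is also needed with the two exchanged, for the node b/(q v).\<close>
    have IH1: "\<kappa>1 a v * S Y t (a * q) (u * q) v = w a u v ?n * (\<kappa>1 (dual ?n a u v) v * S Y t (dual ?n a u v * q) (u * q) v)"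
      if g: "generic a u v Y t" for u v
    proof -
      note nz = generic_nz[OF g]
      have "S Y t (a * q) (u * q) v = w (a * q) (u * q) v (card Y) * S Y t (dual (card Y) (a * q) (u * q) v) (u * q) v"
        by (rule less.hyps) (use cX Y g in \<open>auto intro: generic_shift\<close>)
      moreover have "dual (card Y) (a * q) (u * q) v = dual ?n a u v * q"
        using nz by (simp add: dual_def)
      moreover have "\<kappa>1 a v * w (a * q) (u * q) v (card Y) = w a u v ?n * \<kappa>1 (dual ?n a u v) v"
      proof (rule w_\<kappa>1_dual[OF nz(1-3)])
        show "dual ?n a u v = u * v / (a * b * q ^ Suc (card Y))" by (simp add: dual_def)
      qed (rule generic_const_nz[OF g])+
      ultimately show ?thesis by (simp add: mult_ac)
    qed
    have gap: "gap Y t a u v x = cleared Y t a u v x * poles ?n a' x - w a u v ?n * cleared Y t a' u v x * poles ?n a x" for x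
      by (simp add: gap_def a'_def)
    have gap_up: "gap Y t a u v (b * t y) = 0" if y: "y \<in> Y" for y
      unfolding gap cleared_shifted_up[OF Y(1) gY y] cleared_shifted_up[OF Y(1) gY' y] IH[OF y]
      by (simp only: mult_ac diff_self)
    have gap_down: "gap Y t a u v (t y / b) = 0" if y: "y \<in> Y" for y
      unfolding gap cleared_shifted_down[OF Y(1) gY y] cleared_shifted_down[OF Y(1) gY' y] IH[OF y]
      by (simp only: mult_ac diff_self)
    have gap_diagonal: "gap Y t a u v (t y) = 0" if y: "y \<in> Y" for y
      unfolding gap cleared_diagonal[OF Y(1) gY y] cleared_diagonal[OF Y(1) gY' y] by simp
    have gap_u: "gap Y t a u v (b / (q * u)) = 0" if g: "generic a u v Y t" for u v
    proof -
      have g': "generic (dual ?n a u v) u v Y t"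
        unfolding dual_def by (rule generic_dual[OF g])
      show ?thesis
        unfolding gap_def cleared_u[OF Y(1) g refl] cleared_u[OF Y(1) g' refl] IH1[OF g]
        by (simp only: mult_ac diff_self)
    qed
    have gap_swap: "gap Y t a u v x = gap Y t a v u x" for x
      unfolding gap_def cleared_swap[of Y t _ u v] w_swap[of a u v] by (simp add: dual_def mult_ac)
    let ?\<nu> = "u * v * q / b * (\<Prod>l\<in>{1..?n}. a * q ^ l) * (\<Prod>l\<in>{1..?n}. a' * q ^ l) * (\<Prod>j\<in>Y. 1 / t j ^ 3)"
    have "gap Y t a u v (t z) = 0"
    proof (rule theta_fun_vanish[OF p, where J = "nodes Y" and \<beta> = "node a u v t" and \<nu> = ?\<nu> and g = "gap Y t a u v" and x = "t z"])
      show "finite (nodes Y)"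
        using Y finite_const_nodes by (auto simp: nodes_def)
      show "nodes Y \<noteq> {}"
        by (auto simp: nodes_def const_nodes_def)
      have card: "card (nodes Y) = ?n + 2 + 3 * card Y + ?n"
        using Y finite_const_nodes by (simp add: nodes_def card_Plus card_cartesian_product const_nodes_split(2))
      have "theta_fun p (card (nodes Y)) ?\<nu> (\<lambda>x. cleared Y t a u v x * poles ?n a' x)"
        using theta_fun_mult[OF theta_fun_cleared[OF Y(1) gY] theta_fun_poles[OF nz'(1), of ?n]]
        by (rule theta_fun_eqI) (simp_all only: card mult_ac)
      moreover have "theta_fun p (card (nodes Y)) ?\<nu> (\<lambda>x. - w a u v ?n * (cleared Y t a' u v x * poles ?n a x))"
        using theta_fun_scale[OF theta_fun_mult[OF theta_fun_cleared[OF Y(1) gY'] theta_fun_poles[OF nz(1), of ?n]]]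
        by (rule theta_fun_eqI) (simp_all only: card mult_ac)
      ultimately show "theta_fun p (card (nodes Y)) ?\<nu> (gap Y t a u v)"
        by (rule theta_fun_cong[OF theta_fun_add]) (simp add: gap)
      show "?\<nu> \<noteq> 0"
        using nz nz' Y by (auto simp: Y_def)
      show "node a u v t j \<noteq> 0" if "j \<in> nodes Y" for j
        using that nz by (auto simp: node_def nodes_def monomial_def Y_def split: sum.splits prod.splits)
      show "gap Y t a u v (node a u v t j) = 0" if "j \<in> nodes Y" for j
      proof -
        from that consider (Y) y e where "y \<in> Y" "e \<in> {-1, 0, 1}" "j = Inl (y, e)"
          | (u) "j = Inr (0, 1, -1, 0, -1)" | (v) "j = Inr (0, 1, 0, -1, -1)"
          | (a) l where "l \<in> {1..?n}" "j = Inr (-1, 0, 0, 0, - int l)"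
          | (a') l where "l \<in> {1..?n}" "j = Inr (1, 1, -1, -1, int ?n - int l)"
          unfolding nodes_def const_nodes_def by blast
        then show ?thesis
        proof cases
          case Y
          then show ?thesis
            using gap_up gap_down gap_diagonal by (auto simp: node_def power_int_minus divide_inverse mult.commute)
        next
          case u
          then have "node a u v t j = b / (q * u)"
            by (simp add: node_def monomial_def power_int_minus divide_inverse mult_ac)
          then show ?thesis using gap_u[OF gY] by simp
        next
          case v
          then have "node a u v t j = b / (q * v)"
            by (simp add: node_def monomial_def power_int_minus divide_inverse mult_ac)
          then show ?thesis using gap_u[OF generic_swap[OF gY]] gap_swap by simp
        next
          \<comment> \<open>Both summands of \<open>gap\<close> vanish: one because its terms cancel
            in pairs, the other because of its factor \<open>poles\<close>.\<close>
          case a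
          then have x: "node a u v t j = 1 / (a * q ^ l)"
            by (simp add: node_def monomial_def power_int_minus divide_inverse mult_ac)
          show ?thesis
            unfolding gap using poles_zero[OF a(1) nz(1) x] cleared_pole[OF Y(1) gY a(1) x] by simp
        next
          case a'
          then have x: "node a u v t j = 1 / (a' * q ^ l)"
            using nz by (simp add: node_def monomial_def power_int_minus a'_def dual_def power_int_diff power_int_add field_simps)
          show ?thesis
            unfolding gap using poles_zero[OF a'(1) nz'(1) x] cleared_pole[OF Y(1) gY' a'(1) x] by simp
        qed
      qed
      show "\<theta> (node a u v t i / node a u v t j) \<noteq> 0" if "i \<in> nodes Y" "j \<in> nodes Y" "i \<noteq> j" for i j
        by (rule node_ratio[OF gY that])
      have m1: "monomial a u v (-1, 0, 0, 0, - int l) = 1 / (a * q ^ l)" for l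
        by (simp add: monomial_def power_int_minus divide_inverse mult_ac)
      have m2: "monomial a u v (1, 1, -1, -1, int ?n - int l) = 1 / (a' * q ^ l)" for l
        using nz by (simp add: monomial_def power_int_minus a'_def dual_def power_int_diff power_int_add field_simps)
      have m3: "monomial a u v (0, 1, -1, 0, -1) = b / (q * u)" "monomial a u v (0, 1, 0, -1, -1) = b / (q * v)"
        by (simp_all add: monomial_def power_int_minus divide_inverse mult_ac)
      have E: "(\<Prod>e\<in>const_nodes ?n. monomial a u v e) = (b / (q * u)) * (b / (q * v))
          * (\<Prod>l\<in>{1..?n}. 1 / (a * q ^ l)) * (\<Prod>l\<in>{1..?n}. 1 / (a' * q ^ l))"
        unfolding const_nodes_split(1) m1 m2 m3 ..
      have "(\<Prod>i\<in>Y \<times> {-1, 0, 1}. case i of (y, e) \<Rightarrow> b powi e * t y) = (\<Prod>y\<in>Y. \<Prod>e\<in>{-1, 0, 1}. b powi e * t y)"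
        by (rule prod.Sigma[symmetric]) (use Y in auto)
      also have "\<dots> = (\<Prod>y\<in>Y. t y ^ 3)"
        by (intro prod.cong) (simp_all add: power_int_minus power3_eq_cube)
      finally have "(\<Prod>i\<in>nodes Y. node a u v t i) = (\<Prod>y\<in>Y. t y ^ 3) * ((b / (q * u)) * (b / (q * v))
          * (\<Prod>l\<in>{1..?n}. 1 / (a * q ^ l)) * (\<Prod>l\<in>{1..?n}. 1 / (a' * q ^ l)))"
        unfolding nodes_def node_def E[symmetric] using Y finite_const_nodes[of ?n]
        by (subst prod.Plus) simp_all
      moreover have "(\<Prod>l\<in>{1..?n}. a * q ^ l) \<noteq> 0" "(\<Prod>l\<in>{1..?n}. a' * q ^ l) \<noteq> 0" "(\<Prod>y\<in>Y. t y ^ 3) \<noteq> 0"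
        using nz nz' Y by (auto simp: Y_def)
      \<comment> \<open>The cubes of t_y and the two products over l cancel, and u v q/b times
        b^2/(q^2 u v) is b/q.\<close>
      ultimately have "?\<nu> * (\<Prod>i\<in>nodes Y. node a u v t i) = b / q"
        using nz by (simp add: prod_dividef field_simps del: prod.cl_ivl_Suc)
      moreover have "\<theta> (b / q) \<noteq> 0"
        by (rule generic_const[OF g, of _ 0 1 0 0 "-1"]) (simp_all add: field_simps)
      ultimately show "\<theta> (?\<nu> * (\<Prod>i\<in>nodes Y. node a u v t i)) \<noteq> 0" by simp
      show "t z \<noteq> 0" using nz z by blast
    qed
    moreover have "gap Y t a u v (t z) = (\<Prod>j\<in>Y. den (t z / t j)) * (\<theta> (q * u * t z / b) * \<theta> (q * v * t z / b))
        * poles ?n a (t z) * poles ?n a' (t z) * (S X t a u v - w a u v ?n * S X t a' u v)"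
      unfolding gap cleared_eq_S[OF Y g[unfolded X]] cleared_eq_S[OF Y g'[unfolded X]] X[symmetric]
      by (simp add: algebra_simps)
    moreover have "(\<Prod>j\<in>Y. den (t z / t j)) \<noteq> 0"
    proof -
      have "den (t z / t j) \<noteq> 0" if "j \<in> Y" for j
      proof -
        have j: "j \<in> X" "z \<noteq> j" using that Y X by auto
        show ?thesis using generic_ratio_nz[OF g z j] by (simp add: den_def)
      qed
      then show ?thesis using Y by simp
    qed
    moreover note generic_var_nz(2,3)[OF g z]
    moreover have "poles ?n a (t z) \<noteq> 0" if g: "generic a u v X t" for a
      unfolding poles_def using generic_var_nz(1)[OF g z] by (simp del: prod.cl_ivl_Suc)
    ultimately show ?thesis
      using g g' by (simp add: cX a'_def)
  qed
qed

section \<open>Specialization to geometric strings\<close>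

lemma poch_add: "poch x (m + n) = poch x m * poch (x * q ^ m) n"
  by (induction n) (simp_all add: poch_Suc power_add mult_ac)

lemma poch_reflect:
  assumes "y \<noteq> 0"
  shows "poch y n = (\<Prod>r<n. - y * q ^ r) * poch (q powi (1 - int n) / y) n"
proof -
  have "\<theta> (y * q ^ (n - Suc r)) = - y * q ^ (n - Suc r) * \<theta> (q powi (1 - int n) / y * q ^ r)" if "r < n" for r
  proof -
    have "q powi (1 - int n) / y * q ^ r = 1 / (y * q ^ (n - Suc r))"
    proof -
      have "q powi (1 - int n) * q ^ r * q ^ (n - Suc r) = q powi (1 - int n + int r + int (n - Suc r))"
        by (simp add: power_int_add)
      also have "1 - int n + int r + int (n - Suc r) = 0" using that by simp
      finally show ?thesis using assms by (simp add: field_simps)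
    qed
    then show ?thesis
      using \<theta>_swap[of "y * q ^ (n - Suc r)" 1] assms by simp
  qed
  then have "(\<Prod>r<n. \<theta> (y * q ^ (n - Suc r))) = (\<Prod>r<n. - y * q ^ (n - Suc r)) * poch (q powi (1 - int n) / y) n"
    unfolding tsf_nat_def prod.distrib[symmetric] by (intro prod.cong) auto
  then show ?thesis
    using prod.nat_diff_reindex[of "\<lambda>r. \<theta> (y * q ^ r)" n] prod.nat_diff_reindex[of "\<lambda>r. - y * q ^ r" n]
    by (simp add: tsf_nat_def)
qed

lemma tsf_of_nat [simp]: "tsf q p x (int n) = poch x n"
  by (simp add: tsf_def)

lemma tsfs_of_nat: "tsfs q p xs (int n) = (\<Prod>x\<leftarrow>xs. poch x n)"
  by (simp add: tsfs_def)

text \<open>A single formula for both signs of k - l, as needed for the indices k_i - k_j.\<close>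

lemma tsf_diff:
  assumes nz: "poch (y * q powi (int k - int l)) l \<noteq> 0" "poch y k \<noteq> 0"
  shows "tsf q p y (int k - int l) = poch y k / poch (y * q powi (int k - int l)) l"
proof (cases "l \<le> k")
  case True
  then have "int k - int l = int (k - l)" by simp
  then show ?thesis
    using poch_add[of y "k - l" l] True nz by (simp only: tsf_of_nat power_int_of_nat) simp
next
  case False
  then have e: "tsf q p y (int k - int l) = 1 / poch (y * q powi (int k - int l)) (l - k)"
    by (simp add: tsf_def nat_diff_distrib')
  have "poch (y * q powi (int k - int l)) l = poch (y * q powi (int k - int l)) (l - k) * poch (y * q powi (int k - int l) * q ^ (l - k)) k"
    using poch_add[of "y * q powi (int k - int l)" "l - k" k] False by simp
  also have "y * q powi (int k - int l) * q ^ (l - k) = y * q powi (int k - int l + int (l - k))"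
    by (simp add: power_int_add)
  also have "\<dots> = y" using False by simp
  finally show ?thesis
    using nz by (simp add: e)
qed

section \<open>Strings of cells and the subsets that survive\<close>

definition cells :: "nat \<Rightarrow> (nat \<Rightarrow> nat) \<Rightarrow> (nat \<times> nat) set" where
  "cells N m = (SIGMA i:{1..N}. {..<m i})"

definition q_string :: "(nat \<Rightarrow> complex) \<Rightarrow> nat \<times> nat \<Rightarrow> complex" where
  "q_string t = (\<lambda>(i, r). t i * q ^ r)"

lemma finite_cells [simp]: "finite (cells N m)"
  by (simp add: cells_def)

lemma card_cells: "card (cells N m) = weight N m"
  by (simp add: cells_def weight_def)

text \<open>In contrast to \<open>generic\<close>, powers of \<open>q\<close> do multiply the ratios
  here: variables in different strings must not be related by powers of \<open>q\<close>, while
  those within one string are.\<close>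

definition generic_strings :: "complex \<Rightarrow> complex \<Rightarrow> complex \<Rightarrow> nat \<Rightarrow> (nat \<Rightarrow> complex) \<Rightarrow> bool" where
  "generic_strings a u v N t \<longleftrightarrow> a \<noteq> 0 \<and> u \<noteq> 0 \<and> v \<noteq> 0 \<and> (\<forall>e. e \<noteq> (0, 0, 0, 0, 0) \<longrightarrow> \<theta> (monomial a u v e) \<noteq> 0)
     \<and> (\<forall>x\<in>{1..N}. t x \<noteq> 0 \<and> (\<forall>e. \<theta> (monomial a u v e * t x) \<noteq> 0))
     \<and> (\<forall>x\<in>{1..N}. \<forall>y\<in>{1..N}. x \<noteq> y \<longrightarrow> (\<forall>j r. \<theta> (b powi j * q powi r * t x / t y) \<noteq> 0))"

lemma generic_stringsD:
  assumes "generic_strings a u v N t"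
  shows "a \<noteq> 0" "u \<noteq> 0" "v \<noteq> 0" "e \<noteq> (0, 0, 0, 0, 0) \<Longrightarrow> \<theta> (monomial a u v e) \<noteq> 0"
    "x \<in> {1..N} \<Longrightarrow> t x \<noteq> 0" "x \<in> {1..N} \<Longrightarrow> \<theta> (monomial a u v e * t x) \<noteq> 0"
    "x \<in> {1..N} \<Longrightarrow> y \<in> {1..N} \<Longrightarrow> x \<noteq> y \<Longrightarrow> \<theta> (b powi j * q powi r * t x / t y) \<noteq> 0"
  using assms unfolding generic_strings_def by blast+

lemma generic_strings_ratio:
  assumes g: "generic_strings a u v N t" and "x \<in> {1..N}" "y \<in> {1..N}" and "x = y \<Longrightarrow> j \<noteq> 0 \<or> r \<noteq> 0"
  shows "\<theta> (b powi j * q powi r * t x / t y) \<noteq> 0"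
proof (cases "x = y")
  case True
  then show ?thesis
    using generic_stringsD(4)[OF g, of "(0, j, 0, 0, r)"] generic_stringsD(5)[OF g] assms by (auto simp: monomial_def)
next
  case False
  then show ?thesis using generic_stringsD(7)[OF g] assms by blast
qed

lemma generic_q_string:
  assumes g: "generic_strings a u v N t"
  shows "generic a u v (cells N m) (q_string t)"
  unfolding generic_def
proof (intro conjI ballI allI impI)
  fix x assume x: "x \<in> cells N m"
  obtain i r where ir: "x = (i, r)" by (cases x) auto
  have i: "i \<in> {1..N}" using x by (auto simp: cells_def ir)
  show "q_string t x \<noteq> 0" using generic_stringsD(5)[OF g i] by (simp add: q_string_def ir)
  show "\<theta> (monomial a u v e * q_string t x) \<noteq> 0" for e
  proof -
    obtain e1 e2 e3 e4 e5 where e: "e = (e1, e2, e3, e4, e5)" by (cases e) auto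
    show ?thesis
      using generic_stringsD(6)[OF g i, of "(e1, e2, e3, e4, e5 + int r)"]
      by (simp add: monomial_def e q_string_def ir power_int_add mult_ac)
  qed
  fix y j assume y: "y \<in> cells N m" and ne: "x \<noteq> y"
  obtain i' r' where ir': "y = (i', r')" by (cases y) auto
  have i': "i' \<in> {1..N}" using y by (auto simp: cells_def ir')
  have "q_string t x / q_string t y = q powi (int r - int r') * t i / t i'"
    by (simp add: q_string_def ir ir' power_int_diff mult_ac)
  then have "b powi j * q_string t x / q_string t y = b powi j * q powi (int r - int r') * t i / t i'"
    by (metis mult.assoc times_divide_eq_right)
  moreover have "\<theta> (b powi j * q powi (int r - int r') * t i / t i') \<noteq> 0"
    by (rule generic_strings_ratio[OF g i i']) (use ne ir ir' in auto)
  ultimately show "\<theta> (b powi j * q_string t x / q_string t y) \<noteq> 0" by simp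
qed (use generic_stringsD(1-4)[OF g] in blast)+

lemma downward_closed_nat:
  fixes A :: "nat set"
  assumes "finite A" "\<And>r. Suc r \<in> A \<Longrightarrow> r \<in> A"
  shows "A = {..<card A}"
proof -
  have down: "s \<in> A" if "r \<in> A" "s \<le> r" for r s
    using that(2,1) by (induction r rule: dec_induct) (auto dest: assms(2))
  have "A \<subseteq> {..<card A}"
  proof
    fix r assume "r \<in> A"
    then have "{..r} \<subseteq> A" using down by auto
    then have "card {..r} \<le> card A" using assms(1) by (rule card_mono[rotated])
    then show "r \<in> {..<card A}" by simp
  qed
  then show ?thesis
    by (intro card_subset_eq) auto
qed

lemma box_le: "k \<in> box N m \<Longrightarrow> i \<in> {1..N} \<Longrightarrow> k i \<le> m i"
  by (auto simp: box_def)

text \<open>Since \<open>\<phi> q = 0\<close>, only the initial segments of the strings contribute.\<close>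

lemma S_q_string:
  "S (cells N m) (q_string t) a u v =
    (\<Sum>k\<in>box N m. w a u v (weight N k) * subset_term (cells N m) (q_string t) u v (a * q ^ weight N k) (cells N k))"
  if t: "\<And>i. i \<in> {1..N} \<Longrightarrow> t i \<noteq> 0"
proof -
  let ?X = "cells N m"
  let ?f = "\<lambda>I. w a u v (card I) * subset_term ?X (q_string t) u v (a * q ^ card I) I"
  have inj: "inj_on (cells N) (box N m)"
  proof (rule inj_onI)
    fix k k' assume k: "k \<in> box N m" "k' \<in> box N m" and eq: "cells N k = cells N k'"
    have "k i = k' i" if "i \<in> {1..N}" for i
    proof -
      have "(i, r) \<in> cells N k \<longleftrightarrow> r < k i" "(i, r) \<in> cells N k' \<longleftrightarrow> r < k' i" for r
        using that by (auto simp: cells_def)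
      then have "r < k i \<longleftrightarrow> r < k' i" for r using eq by simp
      then show ?thesis by (metis linorder_neqE_nat order_less_irrefl)
    qed
    then show "k = k'" using k unfolding box_def by (intro PiE_ext[of k "{1..N}" _ k']) blast+
  qed
  have zero: "?f I = 0" if I: "I \<in> Pow ?X - cells N ` box N m" for I
  proof -
    have IX: "I \<subseteq> ?X" and fin: "finite I" using I finite_subset[OF _ finite_cells] by auto
    define A where "A i = {r. (i, r) \<in> I}" for i
    have finA: "finite (A i)" for i
      unfolding A_def by (rule finite_subset[OF _ finite_imageI[OF fin, of snd]]) force
    have "\<exists>i r. (i, Suc r) \<in> I \<and> (i, r) \<notin> I"
    proof (rule ccontr)
      assume "\<nexists>i r. (i, Suc r) \<in> I \<and> (i, r) \<notin> I"
      then have A: "A i = {..<card (A i)}" for i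
        by (intro downward_closed_nat finA) (auto simp: A_def)
      define k where "k = restrict (\<lambda>i. card (A i)) {1..N}"
      have Asub: "A i \<subseteq> {..<m i}" for i
        using I by (auto simp: A_def cells_def)
      have "k \<in> box N m"
        using card_mono[OF _ Asub] by (auto simp: box_def k_def)
      moreover have "I = cells N k"
      proof -
        have "(i, r) \<in> I \<longleftrightarrow> (i, r) \<in> cells N k" for i r
          using I A[of i] by (auto simp: cells_def k_def A_def)
        then show ?thesis by auto
      qed
      ultimately show False using I by blast
    qed
    then obtain i r where ir: "(i, Suc r) \<in> I" "(i, r) \<notin> I" by blast
    then have x: "(i, r) \<in> ?X - I" "i \<in> {1..N}" using I by (auto simp: cells_def)
    have "\<phi> (q_string t (i, Suc r) / q_string t (i, r)) = 0"
      using t[OF x(2)] by (simp add: q_string_def \<phi>_def)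
    then have "(\<Prod>y\<in>?X - I. \<phi> (q_string t (i, Suc r) / q_string t y)) = 0"
      using x by (intro prod_zero) auto
    then have "(\<Prod>x\<in>I. \<Prod>y\<in>?X - I. \<phi> (q_string t x / q_string t y)) = 0"
      using fin ir by (intro prod_zero) auto
    then show ?thesis by (simp add: subset_term_def)
  qed
  have "cells N k \<subseteq> ?X" if "k \<in> box N m" for k
    using box_le[OF that] by (force simp: cells_def)
  then have "S ?X (q_string t) a u v = (\<Sum>I\<in>cells N ` box N m. ?f I)"
    unfolding S_def using zero by (intro sum.mono_neutral_right) auto
  then show ?thesis
    by (simp add: sum.reindex[OF inj] card_cells)
qed

text \<open>Along a string the products of \<open>e1\<close> and \<open>e0\<close> are quotients of
  shifted factorials with base points moved by q^K. Splitting factorials of index K + m and K + k in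
  two ways produces the factors of V, and leaves a quotient of factorials of index m that does not
  depend on k and comes out of the sum.\<close>

lemma string_factor:
  fixes a t :: complex
  assumes nz: "\<And>r. \<theta> (a * t * q ^ r) \<noteq> 0" "\<And>r. \<theta> (a * b * t * q ^ r) \<noteq> 0" "\<And>r. \<theta> (a * q * t / b * q ^ r) \<noteq> 0"
    and "k \<le> m"
  shows "\<theta> (a * t * q ^ (k + K)) / \<theta> (a * t) * (poch (a * t) K * poch (a * b * q ^ m * t) K / (poch (a * q * t / b) K * poch (a * q ^ (m + 1) * t) K))
      * (poch (a * q * t / b) (k + K) / poch (a * b * t) (k + K))
    = poch (a * q * t) m / poch (a * b * t) m * ((\<Prod>r<k. e1 (a * q ^ K * (t * q ^ r))) * (\<Prod>r\<in>{k..<m}. e0 (a * q ^ K * (t * q ^ r))))"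
proof -
  let ?A = "a * q ^ K"
  have pnz: "poch (a * t * q ^ r) n \<noteq> 0" "poch (a * b * t * q ^ r) n \<noteq> 0" "poch (a * q * t / b * q ^ r) n \<noteq> 0" for r n
    using nz[of "r + j" for j] by (auto simp: tsf_nat_def power_add mult.assoc)
  have e1p: "(\<Prod>r<k. e1 (?A * (t * q ^ r))) = poch (a * q * t / b * q ^ K) k / poch (a * t * q ^ K) k"
    by (simp add: e1_def tsf_nat_def prod_dividef mult_ac)
  have split: "(\<Prod>r\<in>{k..<m}. f r) = (\<Prod>r<m. f r) / (\<Prod>r<k. f r)" if "\<And>r. f r \<noteq> 0" for f :: "nat \<Rightarrow> complex"
    using prod.atLeastLessThan_concat[of 0 k m f] \<open>k \<le> m\<close> that by (simp add: lessThan_atLeast0 field_simps)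
  have e0p: "(\<Prod>r\<in>{k..<m}. e0 (?A * (t * q ^ r))) = (poch (a * b * t * q ^ K) m / poch (a * b * t * q ^ K) k)
      / (poch (a * t * q ^ Suc K) m / poch (a * t * q ^ Suc K) k)"
  proof -
    have "(\<Prod>r\<in>{k..<m}. e0 (?A * (t * q ^ r))) = (\<Prod>r\<in>{k..<m}. \<theta> (a * b * t * q ^ K * q ^ r)) / (\<Prod>r\<in>{k..<m}. \<theta> (a * t * q ^ Suc K * q ^ r))"
      by (simp add: e0_def prod_dividef mult_ac)
    also have "\<dots> = (poch (a * b * t * q ^ K) m / poch (a * b * t * q ^ K) k) / (poch (a * t * q ^ Suc K) m / poch (a * t * q ^ Suc K) k)"
      using nz(2)[of "K + r" for r] nz(1)[of "Suc K + r" for r]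
      by (subst (1 2) split) (simp_all add: tsf_nat_def power_add mult_ac)
    finally show ?thesis .
  qed
  have t1: "\<theta> (a * t * q ^ (k + K)) * poch (a * t) K * poch (a * t * q ^ K) k = \<theta> (a * t) * poch (a * t * q) K * poch (a * t * q ^ Suc K) k"
  proof -
    have "poch (a * t) (Suc (K + k)) = poch (a * t) K * poch (a * t * q ^ K) k * \<theta> (a * t * q ^ (k + K))"
      by (simp add: poch_Suc poch_add add.commute)
    moreover have "poch (a * t) (Suc (K + k)) = \<theta> (a * t) * (poch (a * t * q) K * poch (a * t * q ^ Suc K) k)"
      by (simp only: poch_Suc' poch_add) (simp add: mult_ac)
    ultimately show ?thesis by (simp add: mult_ac)
  qed
  have t2: "poch (a * q * t / b) (k + K) = poch (a * q * t / b) K * poch (a * q * t / b * q ^ K) k"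
    "poch (a * b * t) (k + K) = poch (a * b * t) K * poch (a * b * t * q ^ K) k"
    by (simp_all add: add.commute[of k] poch_add)
  have t3: "poch (a * b * t) K * poch (a * b * t * q ^ K) m = poch (a * b * t) m * poch (a * b * q ^ m * t) K"
    using poch_add[of "a * b * t" K m] poch_add[of "a * b * t" m K] by (simp add: add.commute mult_ac)
  have t4: "poch (a * t * q) K * poch (a * t * q ^ Suc K) m = poch (a * q * t) m * poch (a * q ^ (m + 1) * t) K"
    using poch_add[of "a * t * q" K m] poch_add[of "a * t * q" m K] by (simp add: add.commute mult_ac)
  note n = pnz(1)[of 0 K] pnz(1)[of K k] pnz(1)[of "Suc K" k] pnz(1)[of "Suc K" m] pnz(1)[of 1 K] pnz(1)[of 1 m] pnz(1)[of "m + 1" K]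
    pnz(2)[of 0 K] pnz(2)[of K k] pnz(2)[of K m] pnz(2)[of 0 m] pnz(2)[of m K] pnz(3)[of 0 K] pnz(3)[of K k] nz(1)[of 0] nz(1)[of "k + K"]
  have alg: "\<theta>1 / \<theta>0 * (p1 * p2 / (p3 * p4)) * ((p3 * p5) / (p6 * p7)) = p8 / p9 * ((p5 / p10) * ((p11 / p7) / (p12 / p13)))"
    if "\<theta>1 * p1 * p10 = \<theta>0 * p14 * p13" "p6 * p11 = p9 * p2" "p14 * p12 = p8 * p4"
      "\<theta>0 \<noteq> 0" "p3 \<noteq> 0" "p4 \<noteq> 0" "p6 \<noteq> 0" "p7 \<noteq> 0" "p9 \<noteq> 0" "p10 \<noteq> 0" "p12 \<noteq> 0" "p13 \<noteq> 0"
    for \<theta>1 \<theta>0 p1 p2 p3 p4 p5 p6 p7 p8 p9 p10 p11 p12 p13 p14 :: complex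
  proof -
    have "p8 = p14 * p12 / p4" "p11 = p9 * p2 / p6" "\<theta>1 * p1 = \<theta>0 * p14 * p13 / p10"
      using that by (simp_all add: field_simps)
    then have "\<theta>1 / \<theta>0 * (p1 * p2 / (p3 * p4)) * ((p3 * p5) / (p6 * p7)) = (\<theta>0 * p14 * p13 / p10) * p2 * p5 / (\<theta>0 * p4 * p6 * p7)"
      using that(4-) by (simp add: field_simps)
    also have "\<dots> = p14 * p12 / p4 / p9 * ((p5 / p10) * ((p9 * p2 / p6 / p7) / (p12 / p13)))"
      using that(4-) by (simp add: field_simps)
    finally show ?thesis
      using \<open>p8 = p14 * p12 / p4\<close> \<open>p11 = p9 * p2 / p6\<close> by simp
  qed
  show ?thesis
    unfolding t2 e1p e0p
    by (rule alg[OF t1 t3 t4]) (use n in \<open>simp_all add: mult_ac\<close>)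
qed

text \<open>Both factorials with q^(k-l) in the base are reversed; the monomials that appear have
  ratio (b/q)^l.\<close>

lemma poch_ratio_reflect:
  assumes "x \<noteq> 0"
  shows "poch (b * x * q powi (int k - int l)) l * poch (q powi (- int k) / x) l
    = (b / q) ^ l * (poch (q * x * q powi (int k - int l)) l * poch (q powi (1 - int k) / (b * x)) l)"
proof -
  have 1: "q powi (1 - int l) / (b * x * q powi (int k - int l)) = q powi (1 - int k) / (b * x)"
    "q powi (1 - int l) / (q * x * q powi (int k - int l)) = q powi (- int k) / x"
    by (simp_all add: power_int_diff power_int_minus field_simps)
  have "(\<Prod>r<l. - (b * x * q powi (int k - int l)) * q ^ r) = (b / q) ^ l * (\<Prod>r<l. - (q * x * q powi (int k - int l)) * q ^ r)"
  proof -
    have "(b / q) ^ l = (\<Prod>r<l. b / q)" by simp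
    then show ?thesis
      unfolding prod.distrib[symmetric] by (simp only: prod.distrib[symmetric]) (rule prod.cong, simp_all)
  qed
  note 2 = this
  have 3: "poch (b * x * q powi (int k - int l)) l = (\<Prod>r<l. - (b * x * q powi (int k - int l)) * q ^ r) * poch (q powi (1 - int k) / (b * x)) l"
    "poch (q * x * q powi (int k - int l)) l = (\<Prod>r<l. - (q * x * q powi (int k - int l)) * q ^ r) * poch (q powi (- int k) / x) l"
    using poch_reflect[of "b * x * q powi (int k - int l)" l] poch_reflect[of "q * x * q powi (int k - int l)" l] assms
    unfolding 1 by simp_all
  show ?thesis
    unfolding 3 2 by (simp only: mult_ac)
qed

text \<open>The boundary value at the lower end of the telescoping product in
  \<open>pair_product\<close>. In the factor for (i, j) it is divided by the one for (j, i), so it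
  disappears from the product over all pairs.\<close>

definition cross_factor where "cross_factor x k l = poch (q powi (- int l) * x) k / poch (q powi (1 - int l) * x / b) k"

lemma prod_telescope:
  fixes g :: "nat \<Rightarrow> complex"
  assumes "l \<le> m" "\<And>n. n \<in> {l..m} \<Longrightarrow> g n \<noteq> 0"
  shows "(\<Prod>n\<in>{l..<m}. g (Suc n) / g n) = g m / g l"
  using assms by (induction m rule: dec_induct) auto

text \<open>As a function of r' the factor \<phi> is a quotient g(r' + 1)/g(r'), so the inner
  product telescopes and only the ends l and m remain.\<close>

lemma pair_product:
  assumes "l \<le> m" and nz: "\<And>r r'. r < k \<Longrightarrow> r' \<le> m \<Longrightarrow> l \<le> r' \<Longrightarrow> \<theta> (x * q powi (int r - int r')) \<noteq> 0"
    "\<And>r. \<theta> (x * q powi r / b) \<noteq> 0"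
  shows "(\<Prod>r<k. \<Prod>r'\<in>{l..<m}. \<phi> (x * q ^ r / q ^ r'))
    = poch (q powi (- int m) * x) k / poch (q powi (1 - int m) * x / b) k / cross_factor x k l"
proof -
  have "(\<Prod>r'\<in>{l..<m}. \<phi> (x * q ^ r / q ^ r')) =
     (\<theta> (q powi (- int m) * x * q ^ r) / \<theta> (q powi (1 - int m) * x / b * q ^ r))
      / (\<theta> (q powi (- int l) * x * q ^ r) / \<theta> (q powi (1 - int l) * x / b * q ^ r))" if "r < k" for r
  proof -
    define g where "g n = \<theta> (q powi (- int n) * x * q ^ r) / \<theta> (q powi (1 - int n) * x / b * q ^ r)" for n
    have g: "\<phi> (x * q ^ r / q ^ n) = g (Suc n) / g n" for n
    proof -
      have "x * q ^ r / q ^ n / q = q powi (- int (Suc n)) * x * q ^ r"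
        "q * (x * q ^ r / q ^ n) / b = q powi (1 - int n) * x / b * q ^ r"
        "x * q ^ r / q ^ n = q powi (- int n) * x * q ^ r"
        "x * q ^ r / q ^ n / b = q powi (1 - int (Suc n)) * x / b * q ^ r"
        by (simp_all add: power_int_minus power_int_diff power_int_add field_simps)
      note eqs = this
      show ?thesis unfolding \<phi>_def eqs(1,2,4) unfolding eqs(3) g_def by simp
    qed
    have "g n \<noteq> 0" if "n \<in> {l..m}" for n
    proof -
      have "q powi (- int n) * x * q ^ r = x * q powi (int r - int n)"
        "q powi (1 - int n) * x / b * q ^ r = x * q powi (1 - int n + int r) / b"
        by (simp_all add: power_int_minus power_int_diff power_int_add field_simps)
      note eqs = this
      show ?thesis
        unfolding g_def eqs using nz(1)[OF \<open>r < k\<close>, of n] nz(2) that by simp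
    qed
    then have "(\<Prod>n\<in>{l..<m}. g (Suc n) / g n) = g m / g l"
      by (rule prod_telescope[OF \<open>l \<le> m\<close>])
    then show ?thesis unfolding g by (simp add: g_def)
  qed
  then have "(\<Prod>r<k. \<Prod>r'\<in>{l..<m}. \<phi> (x * q ^ r / q ^ r')) = (\<Prod>r<k. (\<theta> (q powi (- int m) * x * q ^ r) / \<theta> (q powi (1 - int m) * x / b * q ^ r))
      / (\<theta> (q powi (- int l) * x * q ^ r) / \<theta> (q powi (1 - int l) * x / b * q ^ r)))"
    by (intro prod.cong) auto
  then show ?thesis
    by (simp add: prod_dividef prod.distrib cross_factor_def tsf_nat_def)
qed

text \<open>The flag \<open>same\<close> stands for i = j: then the ratio is 1 and k = l, and theta
  is nonzero only for nontrivial exponents. The m-dependent factors come from the upper end of the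
  telescoping product, the factors with index k - l from its lower end and a reflection that costs
  (b/q)^l.\<close>

lemma pair_factor:
  fixes ti tj :: complex
  assumes t: "ti \<noteq> 0" "tj \<noteq> 0" and lm: "l \<le> m" and same: "same \<Longrightarrow> k = l"
    and nz1: "\<And>e r. (same \<Longrightarrow> e \<noteq> 0 \<or> r \<noteq> 0) \<Longrightarrow> \<theta> (b powi e * q powi r * ti / tj) \<noteq> 0"
    and nz2: "\<And>e r. (same \<Longrightarrow> e \<noteq> 0 \<or> r \<noteq> 0) \<Longrightarrow> \<theta> (b powi e * q powi r * tj / ti) \<noteq> 0"
  shows "tsfs q p [q powi (- int m) * ti / tj, b * ti / tj] (int k) / tsfs q p [q powi (1 - int m) * ti / (b * tj), q * ti / tj] (int k)
      * (tsf q p (q * ti / tj) (int k - int l) / tsf q p (b * ti / tj) (int k - int l))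
    = (\<Prod>r<k. \<Prod>r'\<in>{l..<m}. \<phi> (ti * q ^ r / (tj * q ^ r'))) * (cross_factor (ti / tj) k l / cross_factor (tj / ti) l k) * (b / q) ^ l"
    and "cross_factor (ti / tj) k l \<noteq> 0" "cross_factor (tj / ti) l k \<noteq> 0"
proof -
  define x where "x = ti / tj"
  have x: "x \<noteq> 0" "tj / ti = 1 / x" "ti / tj = x" using t by (auto simp: x_def)
  have xb: "b * ti / tj = b * x" "q * ti / tj = q * x" "q powi (- int m) * ti / tj = q powi (- int m) * x"
    "q powi (1 - int m) * ti / (b * tj) = q powi (1 - int m) * x / b" "ti * q ^ r / (tj * q ^ r') = x * q ^ r / q ^ r'" for r r'
    by (simp_all add: x_def)
  have pz: "poch y n \<noteq> 0" if y: "y = b powi e * q powi r * x" and s: "\<And>s. s < n \<Longrightarrow> same \<Longrightarrow> e \<noteq> 0 \<or> r + int s \<noteq> 0" for y e r n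
  proof -
    have "\<theta> (y * q ^ s) \<noteq> 0" if "s < n" for s
    proof -
      have "y * q ^ s = b powi e * q powi (r + int s) * ti / tj"
        by (simp add: y x_def power_int_add mult_ac)
      then show ?thesis using nz1[of e "r + int s"] s[OF that] by simp
    qed
    then show ?thesis by (simp add: tsf_nat_def)
  qed
  have pz': "poch y n \<noteq> 0" if y: "y = b powi e * q powi r / x" and s: "\<And>s. s < n \<Longrightarrow> same \<Longrightarrow> e \<noteq> 0 \<or> r + int s \<noteq> 0" for y e r n
  proof -
    have "\<theta> (y * q ^ s) \<noteq> 0" if "s < n" for s
    proof -
      have "y * q ^ s = b powi e * q powi (r + int s) * tj / ti"
        by (simp add: y x_def power_int_add mult_ac)
      then show ?thesis using nz2[of e "r + int s"] s[OF that] by simp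
    qed
    then show ?thesis by (simp add: tsf_nat_def)
  qed
  have nz: "poch (b * x * q powi (int k - int l)) l \<noteq> 0" "poch (b * x) k \<noteq> 0" "poch (q * x * q powi (int k - int l)) l \<noteq> 0" "poch (q * x) k \<noteq> 0"
    "poch (q powi (- int l) * x) k \<noteq> 0" "poch (q powi (1 - int l) * x / b) k \<noteq> 0"
    by (rule pz[of _ 1 "int k - int l"] pz[of _ 1 0] pz[of _ 0 "1 + int k - int l"] pz[of _ 0 1] pz[of _ 0 "- int l"] pz[of _ "-1" "1 - int l"];
        use same in \<open>force simp: power_int_add power_int_diff power_int_minus field_simps\<close>)+
  have nz': "poch (q powi (- int k) / x) l \<noteq> 0" "poch (q powi (1 - int k) / (b * x)) l \<noteq> 0"
    by (rule pz'[of _ 0 "- int k"] pz'[of _ "-1" "1 - int k"]; use same in \<open>force simp: power_int_minus field_simps\<close>)+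
  show F: "cross_factor (ti / tj) k l \<noteq> 0" "cross_factor (tj / ti) l k \<noteq> 0"
    unfolding x cross_factor_def using nz nz' by (simp_all add: mult_ac)
  have phi: "(\<Prod>r<k. \<Prod>r'\<in>{l..<m}. \<phi> (x * q ^ r / q ^ r')) =
      poch (q powi (- int m) * x) k / poch (q powi (1 - int m) * x / b) k / cross_factor x k l"
  proof (rule pair_product[OF lm])
    fix r r' assume "r < k" "r' \<le> m" "l \<le> r'"
    then have "\<theta> (b powi 0 * q powi (int r - int r') * ti / tj) \<noteq> 0"
      by (intro nz1) (use same in simp)
    then show "\<theta> (x * q powi (int r - int r')) \<noteq> 0"
      by (simp add: x_def mult_ac)
  next
    show "\<theta> (x * q powi r / b) \<noteq> 0" for r
      using nz1[of "-1" r] by (simp add: x_def power_int_minus divide_inverse mult_ac)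
  qed
  have F': "cross_factor (1 / x) l k = poch (q powi (- int k) / x) l / poch (q powi (1 - int k) / (b * x)) l"
    by (simp add: cross_factor_def mult_ac)
  let ?B = "poch (b * x * q powi (int k - int l)) l" and ?Q = "poch (q * x * q powi (int k - int l)) l"
  have "?B = (b / q) ^ l * ?Q * poch (q powi (1 - int k) / (b * x)) l / poch (q powi (- int k) / x) l"
    using poch_ratio_reflect[OF x(1), of k l] nz nz' by (simp add: field_simps)
  then have BQ: "?B / ?Q = (b / q) ^ l / cross_factor (1 / x) l k"
    unfolding F' using nz nz' by simp
  have td: "tsf q p (q * x) (int k - int l) = poch (q * x) k / ?Q" "tsf q p (b * x) (int k - int l) = poch (b * x) k / ?B"
    by (rule tsf_diff; rule nz)+
  have "poch (q powi (- int m) * x) k * poch (b * x) k / (poch (q powi (1 - int m) * x / b) k * poch (q * x) k)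
      * ((poch (q * x) k / ?Q) / (poch (b * x) k / ?B)) = poch (q powi (- int m) * x) k / poch (q powi (1 - int m) * x / b) k * (?B / ?Q)"
    using nz by simp
  also have "\<dots> = poch (q powi (- int m) * x) k / poch (q powi (1 - int m) * x / b) k / cross_factor x k l * (cross_factor x k l / cross_factor (1 / x) l k) * (b / q) ^ l"
    unfolding BQ using F by (simp add: x)
  finally show "tsfs q p [q powi (- int m) * ti / tj, b * ti / tj] (int k) / tsfs q p [q powi (1 - int m) * ti / (b * tj), q * ti / tj] (int k)
      * (tsf q p (q * ti / tj) (int k - int l) / tsf q p (b * ti / tj) (int k - int l))
    = (\<Prod>r<k. \<Prod>r'\<in>{l..<m}. \<phi> (ti * q ^ r / (tj * q ^ r'))) * (cross_factor (ti / tj) k l / cross_factor (tj / ti) l k) * (b / q) ^ l"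
    unfolding xb x(2,3) phi td tsfs_of_nat by simp
qed

lemma prod_SIGMA:
  assumes "finite A" "\<And>i. i \<in> A \<Longrightarrow> finite (B i)"
  shows "(\<Prod>x\<in>Sigma A B. f x) = (\<Prod>i\<in>A. \<Prod>r\<in>B i. f (i, r))"
  using assms by (subst prod.Sigma) (auto simp: split_beta)

lemma subset_term_cells:
  assumes k: "k \<in> box N m"
  shows "subset_term (cells N m) (q_string t) u v A (cells N k) =
    (\<Prod>i=1..N. (\<Prod>r<k i. \<psi> u v (t i * q ^ r)) * ((\<Prod>r<k i. e1 (A * (t i * q ^ r))) * (\<Prod>r\<in>{k i..<m i}. e0 (A * (t i * q ^ r)))))
    * (\<Prod>i=1..N. \<Prod>j=1..N. \<Prod>r<k i. \<Prod>r'\<in>{k j..<m j}. \<phi> (t i * q ^ r / (t j * q ^ r')))"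
proof -
  have diff: "cells N m - cells N k = (SIGMA i:{1..N}. {k i..<m i})"
    by (auto simp: cells_def)
  have "(\<Prod>i=1..N. \<Prod>r<k i. \<Prod>j=1..N. \<Prod>r'\<in>{k j..<m j}. \<phi> (t i * q ^ r / (t j * q ^ r')))
     = (\<Prod>i=1..N. \<Prod>j=1..N. \<Prod>r<k i. \<Prod>r'\<in>{k j..<m j}. \<phi> (t i * q ^ r / (t j * q ^ r')))"
    by (intro prod.cong refl prod.swap)
  then show ?thesis
    unfolding subset_term_def diff unfolding cells_def q_string_def
    by (simp add: prod_SIGMA prod.distrib mult_ac del: prod.cl_ivl_Suc)
qed

text \<open>The pairs contribute (b/q)^(N|k|) in total, which reduces the power (q/b)^((N+1)|k|) in
  V to the (q/b)^|k| contained in \<open>w\<close>. This accounts for the exponent (N+1)|k| in the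
  series.\<close>

lemma V_eq_S:
  assumes g: "generic_strings a (a * b / c) (a * b / d) N t" and nz: "c \<noteq> 0" "d \<noteq> 0"
  shows "V q p N m a b c d t = (\<Prod>i=1..N. poch (a * q * t i) (m i) / poch (a * b * t i) (m i))
    * S (cells N m) (q_string t) a (a * b / c) (a * b / d)"
proof -
  let ?u = "a * b / c" and ?v = "a * b / d"
  note gn = generic_stringsD[OF g]
  let ?C = "\<Prod>i=1..N. poch (a * q * t i) (m i) / poch (a * b * t i) (m i)"
  have "V_term q p N m a b c d t k = ?C * (w a ?u ?v (weight N k) * subset_term (cells N m) (q_string t) ?u ?v (a * q ^ weight N k) (cells N k))"
    if k: "k \<in> box N m" for k
  proof -
    let ?K = "weight N k" let ?A = "a * q ^ ?K"
    let ?H = "\<lambda>i. (\<Prod>r<k i. \<psi> ?u ?v (t i * q ^ r)) * ((\<Prod>r<k i. e1 (?A * (t i * q ^ r))) * (\<Prod>r\<in>{k i..<m i}. e0 (?A * (t i * q ^ r))))"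
    let ?W = "\<lambda>i j. tsfs q p [q powi (- int (m j)) * t i / t j, b * t i / t j] (int (k i))
        / tsfs q p [q powi (1 - int (m j)) * t i / (b * t j), q * t i / t j] (int (k i))
      * (tsf q p (q * t i / t j) (int (k i) - int (k j)) / tsf q p (b * t i / t j) (int (k i) - int (k j)))"
    let ?\<Phi> = "\<lambda>i j. \<Prod>r<k i. \<Prod>r'\<in>{k j..<m j}. \<phi> (t i * q ^ r / (t j * q ^ r'))"
    let ?F = "\<lambda>i j. cross_factor (t i / t j) (k i) (k j)"
    have single: "etheta p (a * t i * q ^ (k i + ?K)) / etheta p (a * t i)
      * (tsfs q p [a * b * t i / c, a * b * t i / d] (int (k i)) / tsfs q p [a * q * t i / c, a * q * t i / d] (int (k i)))
      * (tsfs q p [a * t i, a * b * q ^ m i * t i] (int ?K) / tsfs q p [a * q * t i / b, a * q ^ (m i + 1) * t i] (int ?K))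
      * (tsf q p (a * q * t i / b) (int (k i + ?K)) / tsf q p (a * b * t i) (int (k i + ?K)))
      = poch (a * q * t i) (m i) / poch (a * b * t i) (m i)
       * ?H i"
      if i: "i \<in> {1..N}" for i
    proof -
      have n: "\<theta> (a * t i * q ^ r) \<noteq> 0" "\<theta> (a * b * t i * q ^ r) \<noteq> 0" "\<theta> (a * q * t i / b * q ^ r) \<noteq> 0" for r
        using gn(6)[OF i, of "(1, 0, 0, 0, int r)"] gn(6)[OF i, of "(1, 1, 0, 0, int r)"] gn(6)[OF i, of "(1, -1, 0, 0, int r + 1)"]
        by (simp_all add: monomial_def power_int_minus power_int_add divide_inverse mult_ac)
      have psi: "(\<Prod>r<k i. \<psi> ?u ?v (t i * q ^ r)) = poch (a * b * t i / c) (k i) * poch (a * b * t i / d) (k i)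
          / (poch (a * q * t i / c) (k i) * poch (a * q * t i / d) (k i))"
        unfolding tsf_nat_def prod.distrib[symmetric] prod_dividef[symmetric]
        by (intro prod.cong) (simp_all add: \<psi>_def mult_ac)
      have ts: "tsfs q p [x, y] (int n) = poch x n * poch y n" for x y n
        by (simp add: tsfs_of_nat)
      have alg: "x1 * x2 * x3 * x4 = C * (x2 * E)" if "x1 * x3 * x4 = C * E" for x1 x2 x3 x4 C E :: complex
      proof -
        have "x1 * x2 * x3 * x4 = (x1 * x3 * x4) * x2" by (simp only: mult_ac)
        also have "\<dots> = C * (x2 * E)" unfolding that by (simp only: mult_ac)
        finally show ?thesis .
      qed
      show ?thesis
        unfolding ts tsf_of_nat psi by (rule alg[OF string_factor[OF n box_le[OF k i]]])
    qed
    have pair: "?W i j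
      = ?\<Phi> i j * (?F i j / ?F j i) * (b / q) ^ k j
      \<and> ?F i j \<noteq> 0"
      if i: "i \<in> {1..N}" and j: "j \<in> {1..N}" for i j
    proof -
      show ?thesis
        using pair_factor[of "t i" "t j" "k j" "m j" "i = j" "k i", OF gn(5)[OF i] gn(5)[OF j] box_le[OF k j] _
            generic_strings_ratio[OF g i j] generic_strings_ratio[OF g j i]]
        by blast
    qed
    let ?P = "\<Prod>i=1..N. \<Prod>j=1..N. ?\<Phi> i j"
    have "(\<Prod>i=1..N. \<Prod>j=1..N. ?W i j)
      = (\<Prod>i=1..N. \<Prod>j=1..N. ?\<Phi> i j
         * (?F i j / ?F j i) * (b / q) ^ k j)"
      using pair by (intro prod.cong refl) blast
    also have "\<dots> = ?P * ((\<Prod>i=1..N. \<Prod>j=1..N. ?F i j) / (\<Prod>i=1..N. \<Prod>j=1..N. ?F j i))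
        * (\<Prod>i=1..N. \<Prod>j=1..N. (b / q) ^ k j)"
      by (simp add: prod.distrib prod_dividef del: prod.cl_ivl_Suc)
    also have "(\<Prod>i=1..N. \<Prod>j=1..N. ?F j i) = (\<Prod>i=1..N. \<Prod>j=1..N. ?F i j)"
      by (rule prod.swap)
    also have "(\<Prod>i=1..N. \<Prod>j=1..N. ?F i j) / (\<Prod>i=1..N. \<Prod>j=1..N. ?F i j) = 1"
      using pair by (intro divide_self) (simp del: prod.cl_ivl_Suc)
    also have "(\<Prod>i=1..N. \<Prod>j=1..N. (b / q) ^ k j) = (b / q) ^ (N * ?K)"
      by (simp add: power_sum[symmetric] weight_def power_mult[symmetric] mult.commute del: prod.cl_ivl_Suc sum.cl_ivl_Suc)
    finally have pairs: "(\<Prod>i=1..N. \<Prod>j=1..N. ?W i j) = ?P * (b / q) ^ (N * ?K)"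
      by simp
    have pw: "(q / b) ^ ((N + 1) * ?K) * (b / q) ^ (N * ?K) = (q / b) ^ ?K"
      by (simp add: power_add power_divide)
    have wK: "w a ?u ?v ?K = (q / b) ^ ?K * (tsfs q p [c, d] (int ?K) / tsfs q p [c * q / b, d * q / b] (int ?K))"
      using gn(1) nz by (simp add: w_def tsfs_of_nat mult_ac)
    have alg: "C * E * W * Q1 * (P * Q2) = C * ((Q3 * W) * (E * P))" if "Q1 * Q2 = Q3" for C E W P Q1 Q2 Q3 :: complex
      unfolding that[symmetric] by (simp only: mult_ac)
    let ?E = "\<Prod>i=1..N. ?H i"
    have "V_term q p N m a b c d t k = (\<Prod>i=1..N. poch (a * q * t i) (m i) / poch (a * b * t i) (m i)
       * ?H i)
       * (tsfs q p [c, d] (int ?K) / tsfs q p [c * q / b, d * q / b] (int ?K)) * (q / b) ^ ((N + 1) * ?K) * (?P * (b / q) ^ (N * ?K))"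
      unfolding V_term_def pairs by (intro arg_cong2[where f = "(*)"] prod.cong refl single)
    also have "\<dots> = ?C * ?E * (tsfs q p [c, d] (int ?K) / tsfs q p [c * q / b, d * q / b] (int ?K)) * (q / b) ^ ((N + 1) * ?K) * (?P * (b / q) ^ (N * ?K))"
      by (subst prod.distrib) (rule refl)
    finally show ?thesis
      unfolding subset_term_cells[OF k] wK alg[OF pw] .
  qed
  moreover have "S (cells N m) (q_string t) a ?u ?v = (\<Sum>k\<in>box N m. w a ?u ?v (weight N k) * subset_term (cells N m) (q_string t) ?u ?v (a * q ^ weight N k) (cells N k))"
    by (rule S_q_string) (use gn(5) in blast)
  ultimately show ?thesis
    by (simp add: V_def sum_distrib_left)
qed

subsection \<open>The transformation for generic parameters\<close>

lemma w_0 [simp]: "w a u v 0 = 1"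
  by (simp add: w_def)

lemma dual_mult_q: "dual (Suc n) a u v * q = dual n a u v"
  by (simp add: dual_def)

text \<open>\<open>w_\<kappa>2_dual\<close> iterated: the factors of \<open>w\<close> at the dual
  point, taken from the front, undo those at \<open>a\<close>, taken from the back. With this the
  weights of a subset and of its complement can be compared.\<close>

lemma w_reverse:
  assumes g: "generic a u v X t"
  shows "w a u v m = w a u v (m + K) * w (dual (m + K) a u v) u v K"
proof (induction K)
  case (Suc K)
  note nz = generic_nz[OF g]
  have "w a u v (m + K) = w a u v (Suc (m + K)) * \<kappa>2 (dual (Suc (m + K)) a u v) u v"
  proof (rule w_\<kappa>2_dual[OF nz(1-3)])
    show "dual (Suc (m + K)) a u v = u * v / (a * b * q ^ Suc (m + K))" by (simp add: dual_def)
  qed (rule generic_const_nz[OF g])+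
  then show ?case
    using Suc by (simp add: w_Suc_\<kappa>2 dual_mult_q mult.assoc)
qed simp

lemma e1_reflect: "y \<noteq> 0 \<Longrightarrow> e1 (1 / (q * y)) = (q / b) * e0 y"
  using \<theta>_swap[of 1 "y * b"] \<theta>_swap[of 1 "q * y"] by (simp add: e1_def e0_def mult.commute[of y b])

lemma e0_reflect: "y \<noteq> 0 \<Longrightarrow> e0 (1 / (q * y)) = (b / q) * e1 y"
  using \<theta>_swap[of b "q * y"] \<theta>_swap[of 1 y] by (simp add: e1_def e0_def)

lemma \<psi>_reflect:
  assumes "u \<noteq> 0" "v \<noteq> 0" "x \<noteq> 0"
  shows "\<psi> (b / v) (b / u) (1 / (q * x)) = (b / q) ^ 2 / \<psi> u v x"
proof -
  have r: "\<theta> (b / v * (1 / (q * x))) = - (b / (q * v * x)) * \<theta> (q * v * x / b)"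
    "\<theta> (b / u * (1 / (q * x))) = - (b / (q * u * x)) * \<theta> (q * u * x / b)"
    "\<theta> (q * (b / v) * (1 / (q * x)) / b) = - (1 / (v * x)) * \<theta> (v * x)"
    "\<theta> (q * (b / u) * (1 / (q * x)) / b) = - (1 / (u * x)) * \<theta> (u * x)"
    using \<theta>_swap[of b "q * v * x"] \<theta>_swap[of b "q * u * x"] \<theta>_swap[of 1 "v * x"] \<theta>_swap[of 1 "u * x"] assms
    by (simp_all add: mult_ac)
  show ?thesis
    unfolding \<psi>_def r using assms by (simp add: divide_simps power2_eq_square)
qed

text \<open>Inverting the variables exchanges \<open>e1\<close> with \<open>e0\<close> up to powers
  of b/q, and turns \<psi> into its reciprocal. Together with complementation of subsets this brings
  the dual sum of \<open>S_dual\<close> back to the original form. The permutation \<pi> is present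
  because inversion reverses the order within a q-string.\<close>

lemma S_reflect:
  assumes fin: "finite X" and \<pi>: "bij_betw \<pi> X X" and s: "\<And>x. x \<in> X \<Longrightarrow> s x = 1 / (q * t (\<pi> x))"
    and g: "generic a u v X t"
  shows "S X t a u v = (q / b) ^ card X * (\<Prod>x\<in>X. \<psi> u v (t x)) * S X s (a * b / (u * v)) (b / v) (b / u)"
proof -
  note nz = generic_nz[OF g]
  let ?n = "card X" and ?a = "a * b / (u * v)"
  define a' where "a' = dual ?n a u v"
  have a': "a' \<noteq> 0" using nz by (simp add: a'_def dual_def)
  have inj: "inj_on \<pi> X" and img: "\<pi> ` X = X" using \<pi> by (auto simp: bij_betw_def)
  have \<psi>nz: "\<psi> u v (t x) \<noteq> 0" if "x \<in> X" for x
  proof -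
    have "\<theta> (u * t x) \<noteq> 0" "\<theta> (v * t x) \<noteq> 0"
      by (rule generic_var[OF g that, of _ 0 0 1 0 0] generic_var[OF g that, of _ 0 0 0 1 0]; simp)+
    then show ?thesis using generic_var_nz(2,3)[OF g that] by (simp add: \<psi>_def)
  qed
  have term_eq: "(q / b) ^ ?n * (\<Prod>x\<in>X. \<psi> u v (t x)) * (w ?a (b / v) (b / u) (card J) * subset_term X s (b / v) (b / u) (?a * q ^ card J) J)
      = w a u v ?n * (w a' u v (card (X - \<pi> ` J)) * subset_term X t u v (a' * q ^ card (X - \<pi> ` J)) (X - \<pi> ` J))"
    if J: "J \<in> Pow X" for J
  proof -
    let ?I = "X - \<pi> ` J" let ?K = "card ?I"
    have finJ: "finite J" using J fin finite_subset by auto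
    have JX: "J \<subseteq> X" "\<pi> ` J \<subseteq> X" "?I \<subseteq> X" "X - ?I = \<pi> ` J" using J img by auto
    have I: "\<pi> ` (X - J) = ?I"
      using inj_on_image_set_diff[OF inj, of X J] JX img by auto
    have cJ: "card (\<pi> ` J) = card J" using inj JX by (intro card_image) (auto intro: inj_on_subset)
    have K: "?n = card J + ?K"
      using card_Diff_subset[of "\<pi> ` J" X] card_mono[OF fin JX(2)] finJ JX cJ by simp
    have injs: "inj_on \<pi> J" "inj_on \<pi> (X - J)" by (rule inj_on_subset[OF inj JX(1)], rule inj_on_subset[OF inj Diff_subset])
    have aq: "?a * q ^ card J = 1 / (a' * q ^ ?K)"
      using nz by (simp add: a'_def dual_def K power_add)
    have arg: "?a * q ^ card J * s x = 1 / (q * (a' * q ^ ?K * t (\<pi> x)))" if "x \<in> X" for x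
      unfolding aq s[OF that] by simp
    have \<pi>X: "\<pi> x \<in> X" if "x \<in> X" for x using that img by auto
    have y: "a' * q ^ ?K * t z \<noteq> 0" if "z \<in> X" for z using that nz a' by simp
    have P1: "(\<Prod>x\<in>J. \<psi> (b / v) (b / u) (s x) * e1 (?a * q ^ card J * s x)) = (\<Prod>z\<in>\<pi> ` J. (b / q) * (e0 (a' * q ^ ?K * t z) / \<psi> u v (t z)))"
    proof (subst prod.reindex[OF injs(1)], rule prod.cong[OF refl])
      fix x assume "x \<in> J"
      then have x: "x \<in> X" using JX by auto
      show "\<psi> (b / v) (b / u) (s x) * e1 (?a * q ^ card J * s x) = ((\<lambda>z. (b / q) * (e0 (a' * q ^ ?K * t z) / \<psi> u v (t z))) \<circ> \<pi>) x"
        unfolding arg[OF x] e1_reflect[OF y[OF \<pi>X[OF x]]] unfolding s[OF x] \<psi>_reflect[OF nz(2,3) nz(4)[OF \<pi>X[OF x]]]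
        by (simp add: power2_eq_square)
    qed
    have P2: "(\<Prod>x\<in>X - J. e0 (?a * q ^ card J * s x)) = (\<Prod>z\<in>?I. (b / q) * e1 (a' * q ^ ?K * t z))"
      unfolding I[symmetric]
    proof (subst prod.reindex[OF injs(2)], rule prod.cong[OF refl])
      fix x assume "x \<in> X - J"
      then have x: "x \<in> X" by auto
      show "e0 (?a * q ^ card J * s x) = ((\<lambda>z. (b / q) * e1 (a' * q ^ card (\<pi> ` (X - J)) * t z)) \<circ> \<pi>) x"
        unfolding arg[OF x] e0_reflect[OF y[OF \<pi>X[OF x]]] I by simp
    qed
    have P3: "(\<Prod>x\<in>J. \<Prod>x'\<in>X - J. \<phi> (s x / s x')) = (\<Prod>z\<in>?I. \<Prod>z'\<in>\<pi> ` J. \<phi> (t z / t z'))"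
    proof -
      have "(\<Prod>z\<in>?I. \<Prod>z'\<in>\<pi> ` J. \<phi> (t z / t z')) = (\<Prod>z'\<in>\<pi> ` J. \<Prod>z\<in>\<pi> ` (X - J). \<phi> (t z / t z'))"
        unfolding I by (rule prod.swap)
      also have "\<dots> = (\<Prod>x\<in>J. \<Prod>x'\<in>X - J. \<phi> (t (\<pi> x') / t (\<pi> x)))"
        by (simp add: prod.reindex[OF injs(1)] prod.reindex[OF injs(2)])
      also have "\<dots> = (\<Prod>x\<in>J. \<Prod>x'\<in>X - J. \<phi> (s x / s x'))"
        using JX s by (intro prod.cong refl) auto
      finally show ?thesis by simp
    qed
    have split: "(\<Prod>x\<in>X. \<psi> u v (t x)) = (\<Prod>z\<in>\<pi> ` J. \<psi> u v (t z)) * (\<Prod>z\<in>?I. \<psi> u v (t z))"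
      using prod.subset_diff[OF JX(3) fin, of "\<lambda>z. \<psi> u v (t z)"] JX(4) by simp
    have nzp: "(\<Prod>z\<in>\<pi> ` J. \<psi> u v (t z)) \<noteq> 0" using \<psi>nz JX finJ by (auto simp: prod_zero_iff)
    \<comment> \<open>\<open>w\<close> depends only on a b/u, a b/v, a q/u and a q/v, and each of
      these keeps its value under the new parameters.\<close>
    have W: "w ?a (b / v) (b / u) (card J) = w a u v ?n * w a' u v ?K"
    proof -
      have "w ?a (b / v) (b / u) (card J) = w a u v (card J)"
        unfolding w_def using nz by (simp add: mult_ac)
      then show ?thesis
        using w_reverse[OF g, of "card J" ?K] K by (simp add: a'_def)
    qed
    have pw: "(q / b) ^ ?n * ((b / q) ^ card J * (b / q) ^ ?K) = 1"
      by (simp add: K power_add power_divide)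
    have "(q / b) ^ ?n * (\<Prod>x\<in>X. \<psi> u v (t x)) * (w ?a (b / v) (b / u) (card J) * subset_term X s (b / v) (b / u) (?a * q ^ card J) J)
      = ((q / b) ^ ?n * ((b / q) ^ card J * (b / q) ^ ?K)) * (w a u v ?n * w a' u v ?K)
       * ((\<Prod>z\<in>?I. \<psi> u v (t z)) * (\<Prod>z\<in>?I. e1 (a' * q ^ ?K * t z)) * (\<Prod>z\<in>\<pi> ` J. e0 (a' * q ^ ?K * t z)) * (\<Prod>z\<in>?I. \<Prod>z'\<in>\<pi> ` J. \<phi> (t z / t z')))"
      unfolding subset_term_def P1 P2 P3 split W
      unfolding prod.distrib prod_constant prod_dividef cJ
      using nzp by simp
    also have "\<dots> = w a u v ?n * (w a' u v ?K * subset_term X t u v (a' * q ^ ?K) ?I)"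
      unfolding pw subset_term_def JX(4) prod.distrib by (simp only: mult_1_left mult.assoc)
    finally show ?thesis .
  qed
  have bij: "bij_betw (\<lambda>J. X - \<pi> ` J) (Pow X) (Pow X)"
  proof (rule bij_betwI')
    show "X - \<pi> ` J = X - \<pi> ` J' \<longleftrightarrow> J = J'" if "J \<in> Pow X" "J' \<in> Pow X" for J J'
    proof
      assume "X - \<pi> ` J = X - \<pi> ` J'"
      then have "\<pi> ` J = \<pi> ` J'" using that img by (metis Pow_iff double_diff image_mono subset_refl)
      then show "J = J'" using inj_on_image_eq_iff[OF inj] that by auto
    qed auto
    show "\<exists>J\<in>Pow X. I = X - \<pi> ` J" if "I \<in> Pow X" for I
    proof (rule bexI[of _ "{x \<in> X. \<pi> x \<notin> I}"])
      show "I = X - \<pi> ` {x \<in> X. \<pi> x \<notin> I}" using that img by auto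
    qed auto
  qed auto
  have "S X t a u v = w a u v ?n * S X t a' u v"
    unfolding a'_def by (rule S_dual[OF fin g])
  also have "\<dots> = (\<Sum>I\<in>Pow X. w a u v ?n * (w a' u v (card I) * subset_term X t u v (a' * q ^ card I) I))"
    by (simp add: S_def sum_distrib_left)
  also have "\<dots> = (\<Sum>J\<in>Pow X. w a u v ?n * (w a' u v (card (X - \<pi> ` J)) * subset_term X t u v (a' * q ^ card (X - \<pi> ` J)) (X - \<pi> ` J)))"
    by (rule sum.reindex_bij_betw[OF bij, symmetric])
  also have "\<dots> = (q / b) ^ ?n * (\<Prod>x\<in>X. \<psi> u v (t x)) * S X s ?a (b / v) (b / u)"
    unfolding S_def sum_distrib_left using term_eq by (intro sum.cong refl) (rule sym, blast)
  finally show ?thesis .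
qed

lemma generic_strings_reflect:
  assumes g: "generic_strings a u v N t" and s: "\<And>i. i \<in> {1..N} \<Longrightarrow> s i = q powi (- int (m i)) / t i"
  shows "generic_strings (a * b / (u * v)) (b / v) (b / u) N s"
  unfolding generic_strings_def
proof (intro conjI allI ballI impI)
  note gn = generic_stringsD[OF g]
  have m: "monomial (a * b / (u * v)) (b / v) (b / u) (i, j, k, l, r) = monomial a u v (i, i + j + k + l, - i - l, - i - k, r)" for i j k l r
    using gn(1-3) by (simp add: monomial_def power_int_mult_distrib power_int_divide_distrib power_int_add power_int_diff
        power_int_minus field_simps)
  show "\<theta> (monomial (a * b / (u * v)) (b / v) (b / u) e) \<noteq> 0" if "e \<noteq> (0, 0, 0, 0, 0)" for e
  proof -
    obtain i j k l r where e: "e = (i, j, k, l, r)" by (cases e) auto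
    show ?thesis unfolding e m by (rule gn(4)) (use that e in auto)
  qed
  fix x assume x: "x \<in> {1..N}"
  show "s x \<noteq> 0" using s[OF x] gn(5)[OF x] by simp
  show "\<theta> (monomial (a * b / (u * v)) (b / v) (b / u) e * s x) \<noteq> 0" for e
  proof -
    obtain i j k l r where e: "e = (i, j, k, l, r)" by (cases e) auto
    have "monomial (a * b / (u * v)) (b / v) (b / u) e * s x = 1 / (monomial a u v (- i, - (i + j + k + l), i + l, i + k, - r + int (m x)) * t x)"
      using gn(1-3) gn(5)[OF x] unfolding e m s[OF x]
      by (simp add: monomial_def power_int_add power_int_diff power_int_minus field_simps)
    moreover have "monomial a u v (- i, - (i + j + k + l), i + l, i + k, - r + int (m x)) * t x \<noteq> 0"
      using gn(1-3) gn(5)[OF x] by (simp add: monomial_def)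
    ultimately show ?thesis
      using gn(6)[OF x] etheta_inverse[OF p] by simp
  qed
  fix y j r assume y: "y \<in> {1..N}" and "x \<noteq> y"
  have "b powi j * q powi r * s x / s y = b powi j * q powi (r - int (m x) + int (m y)) * t y / t x"
    using gn(5)[OF x] gn(5)[OF y] unfolding s[OF x] s[OF y]
    by (simp add: power_int_add power_int_diff power_int_minus field_simps)
  then show "\<theta> (b powi j * q powi r * s x / s y) \<noteq> 0"
    using gn(7)[OF y x, of j "r - int (m x) + int (m y)"] \<open>x \<noteq> y\<close> by simp
qed (use generic_stringsD(1-3)[OF g] in auto)

lemma V_transformation_generic:
  assumes nz: "c \<noteq> 0" "d \<noteq> 0" and g: "generic_strings a (a * b / c) (a * b / d) N t"
    and s: "\<And>i. i \<in> {1..N} \<Longrightarrow> s i = q powi (- int (m i)) / t i" and ahat: "ahat = c * d / (a * b)"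
  shows "V q p N m a b c d t = V q p N m ahat b c d s
    * (\<Prod>i=1..N. tsfs q p [a * q * t i, ahat * q * s i / c, ahat * q * s i / d, a * q * t i / (c * d)] (int (m i))
        / tsfs q p [ahat * q * s i, a * q * t i / c, a * q * t i / d, ahat * q * s i / (c * d)] (int (m i)))"
proof -
  note gn = generic_stringsD[OF g]
  let ?pre = "\<lambda>i. tsfs q p [a * q * t i, ahat * q * s i / c, ahat * q * s i / d, a * q * t i / (c * d)] (int (m i))
        / tsfs q p [ahat * q * s i, a * q * t i / c, a * q * t i / d, ahat * q * s i / (c * d)] (int (m i))"
  let ?l = "\<lambda>i. poch (a * q * t i) (m i) / poch (a * b * t i) (m i)"
    and ?r = "\<lambda>i. poch (ahat * q * s i) (m i) / poch (ahat * b * s i) (m i)"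
  let ?u = "a * b / c" and ?v = "a * b / d" and ?X = "cells N m"
  have hats: "a * b / (?u * ?v) = ahat" "b / ?v = ahat * b / c" "b / ?u = ahat * b / d"
    using nz gn(1) by (simp_all add: ahat)
  have gs: "generic_strings ahat (ahat * b / c) (ahat * b / d) N s"
    using generic_strings_reflect[OF g s] unfolding hats by blast
  note gsn = generic_stringsD[OF gs]
  \<comment> \<open>Since s_i t_i = q^(-m_i), the inverse 1/(q t_i q^r) is s_i q^(m_i - 1 - r): the
    inverted string of t_i is the string of s_i read backwards.\<close>
  define \<pi> where "\<pi> = (\<lambda>(i, r). (i, m i - Suc r))"
  have bij: "bij_betw \<pi> ?X ?X"
    by (rule bij_betw_byWitness[where f' = \<pi>]) (auto simp: \<pi>_def cells_def)
  have str: "q_string s x = 1 / (q * q_string t (\<pi> x))" if "x \<in> ?X" for x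
  proof -
    obtain i r where xi: "x = (i, r)" by (cases x)
    then have x: "x = (i, r)" "i \<in> {1..N}" "r < m i" using that by (auto simp: cells_def)
    have "q powi (- int (m i)) * q ^ r * q ^ Suc (m i - Suc r) = q powi (- int (m i) + int r + int (Suc (m i - Suc r)))"
    proof -
      have "q powi (- int (m i) + int r + int n) = q powi (- int (m i)) * q ^ r * q ^ n" for n
        by (simp add: power_int_add power_int_diff power_int_minus field_simps)
      then show ?thesis by metis
    qed
    also have "- int (m i) + int r + int (Suc (m i - Suc r)) = 0" using x by simp
    finally have "q powi (- int (m i)) * q ^ r = 1 / (q * q ^ (m i - Suc r))"
      by (simp add: divide_simps mult_ac)
    then have "q powi (- int (m i)) / t i * q ^ r = 1 / (q * q ^ (m i - Suc r)) / t i"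
      by simp
    then show ?thesis
      unfolding q_string_def \<pi>_def x(1) prod.case s[OF x(2)] by (simp add: mult_ac)
  qed
  have R: "S ?X (q_string t) a ?u ?v = (q / b) ^ card ?X * (\<Prod>x\<in>?X. \<psi> ?u ?v (q_string t x))
      * S ?X (q_string s) ahat (ahat * b / c) (ahat * b / d)"
    using S_reflect[OF finite_cells bij str generic_q_string[OF g]] unfolding hats .
  have "V q p N m a b c d t = (\<Prod>i=1..N. ?l i)
    * ((q / b) ^ card ?X * (\<Prod>x\<in>?X. \<psi> ?u ?v (q_string t x)) * S ?X (q_string s) ahat (ahat * b / c) (ahat * b / d))"
    unfolding V_eq_S[OF g nz] R by (rule refl)
  also have "(q / b) ^ card ?X = (\<Prod>i=1..N. (q / b) ^ m i)"
    by (simp add: card_cells weight_def power_sum)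
  also have "(\<Prod>x\<in>?X. \<psi> ?u ?v (q_string t x)) = (\<Prod>i=1..N. \<Prod>r<m i. \<psi> ?u ?v (t i * q ^ r))"
    by (simp add: cells_def prod_SIGMA q_string_def)
  finally have V1: "V q p N m a b c d t = (\<Prod>i=1..N. ?l i * (q / b) ^ m i
     * (\<Prod>r<m i. \<psi> ?u ?v (t i * q ^ r))) * S ?X (q_string s) ahat (ahat * b / c) (ahat * b / d)"
    by (simp only: prod.distrib mult.assoc)
  have V2: "V q p N m ahat b c d s = (\<Prod>i=1..N. ?r i)
    * S ?X (q_string s) ahat (ahat * b / c) (ahat * b / d)"
    by (rule V_eq_S[OF gs nz])
  have factor: "?l i * (q / b) ^ m i * (\<Prod>r<m i. \<psi> ?u ?v (t i * q ^ r))
    = ?r i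
     * ?pre i"
    if i: "i \<in> {1..N}" for i
  proof -
    let ?M = "m i" and ?t = "t i"
    let ?R = "\<lambda>y. \<Prod>r<?M. - y * q ^ r"
    have tn: "?t \<noteq> 0" "a \<noteq> 0" using gn(5)[OF i] gn(1) by auto
    have ar: "q powi (1 - int ?M) / (a * b * ?t / d) = ahat * q * s i / c" "q powi (1 - int ?M) / (a * b * ?t / c) = ahat * q * s i / d"
      "q powi (1 - int ?M) / (a * b * ?t) = ahat * q * s i / (c * d)" "q powi (1 - int ?M) / (a * q * ?t / (c * d)) = ahat * b * s i"
      using tn nz unfolding s[OF i] ahat by (simp_all add: power_int_diff power_int_minus field_simps)
    have refl4: "poch (a * b * ?t / d) ?M = ?R (a * b * ?t / d) * poch (ahat * q * s i / c) ?M"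
      "poch (a * b * ?t / c) ?M = ?R (a * b * ?t / c) * poch (ahat * q * s i / d) ?M"
      "poch (a * b * ?t) ?M = ?R (a * b * ?t) * poch (ahat * q * s i / (c * d)) ?M"
      "poch (a * q * ?t / (c * d)) ?M = ?R (a * q * ?t / (c * d)) * poch (ahat * b * s i) ?M"
      unfolding ar[symmetric] by (rule poch_reflect; use tn nz in simp)+
    have psi: "(\<Prod>r<?M. \<psi> ?u ?v (?t * q ^ r)) = poch (a * b * ?t / c) ?M * poch (a * b * ?t / d) ?M
          / (poch (a * q * ?t / c) ?M * poch (a * q * ?t / d) ?M)"
      unfolding tsf_nat_def prod.distrib[symmetric] prod_dividef[symmetric]
      by (intro prod.cong) (simp_all add: \<psi>_def mult_ac)
    \<comment> \<open>Factor by factor this is (q/b) (a b t/c) (a b t/d) = (a q t/(c d)) (a b t);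
      the monomials produced by the four reflections thus cancel against (q/b)^(m_i).\<close>
    have R: "(q / b) ^ ?M * ?R (a * b * ?t / c) * ?R (a * b * ?t / d) = ?R (a * q * ?t / (c * d)) * ?R (a * b * ?t)"
    proof -
      have "(q / b) ^ ?M = (\<Prod>r<?M. q / b)" by simp
      then show ?thesis
        unfolding prod.distrib[symmetric] by (simp only: prod.distrib[symmetric]) (rule prod.cong, use nz in \<open>simp_all add: field_simps\<close>)
    qed
    have Rnz: "?R (a * b * ?t) \<noteq> 0" using tn by simp
    have "\<theta> (ahat * q * s i * q ^ r) \<noteq> 0" "\<theta> (ahat * b * s i * q ^ r) \<noteq> 0" for r
      using gsn(6)[OF i, of "(1, 0, 0, 0, int (Suc r))"] gsn(6)[OF i, of "(1, 1, 0, 0, int r)"]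
      by (simp only: monomial_def prod.case power_int_of_nat; simp add: mult_ac)+
    then have pn: "poch (ahat * q * s i) ?M \<noteq> 0" "poch (ahat * b * s i) ?M \<noteq> 0"
      by (simp_all add: tsf_nat_def)
    have alg: "U / (R1 * x1) * Q * ((R3 * x3) * (R2 * x2) / D) = H / x4 * (U * x2 * x3 * (R4 * x4) / (H * D * x1))"
      if "Q * R3 * R2 = R4 * R1" "R1 \<noteq> 0" "H \<noteq> 0" "x4 \<noteq> 0" for U R1 R2 R3 R4 x1 x2 x3 x4 Q H D :: complex
    proof -
      have "R4 = Q * R3 * R2 / R1" using that by (simp add: field_simps)
      then show ?thesis using that(2-) by (simp add: mult_ac)
    qed
    have ts: "tsfs q p [x, y, z, z'] (int n) = poch x n * poch y n * poch z n * poch z' n" for x y z z' n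
      by (simp add: tsfs_of_nat)
    have "tsfs q p [ahat * q * s i, a * q * ?t / c, a * q * ?t / d, ahat * q * s i / (c * d)] (int ?M)
        = poch (ahat * q * s i) ?M * (poch (a * q * ?t / c) ?M * poch (a * q * ?t / d) ?M) * poch (ahat * q * s i / (c * d)) ?M"
      unfolding ts by (simp only: mult.assoc)
    then show ?thesis
      unfolding ts psi refl4 using alg[OF R Rnz pn] by simp
  qed
  have "(\<Prod>i=1..N. ?l i * (q / b) ^ m i * (\<Prod>r<m i. \<psi> ?u ?v (t i * q ^ r)))
    = (\<Prod>i=1..N. ?r i) *
     (\<Prod>i=1..N. ?pre i)"
    unfolding prod.distrib[symmetric] by (intro prod.cong refl) (use factor in \<open>simp only: prod.distrib\<close>)
  then show ?thesis
    unfolding V1 V2 by (simp only: mult_ac)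
qed

end

section \<open>Removing the genericity\<close>

lemma countable_roots_int_coeffs:
  "countable {z :: real. \<exists>P. P \<noteq> 0 \<and> (\<forall>n. coeff P n \<in> \<int>) \<and> poly P z = 0}"
proof -
  let ?Z = "{P :: real poly. P \<noteq> 0 \<and> (\<forall>n. coeff P n \<in> \<int>)}"
  have "countable (\<int> :: real set)"
    unfolding Ints_def by (rule countable_image) simp
  then have "countable (lists (\<int> :: real set))"
    by (rule countable_lists)
  moreover have "coeffs ` ?Z \<subseteq> lists \<int>"
    by (auto simp: coeffs_def)
  ultimately have "countable (coeffs ` ?Z)"
    by (rule countable_subset[rotated])
  then have "countable ?Z"
    by (rule countable_image_inj_on) (rule inj_onI, rule iffD2[OF coeffs_eq_iff])
  then have "countable (\<Union>P\<in>?Z. {z. poly P z = 0})"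
    by (rule countable_UN) (simp add: countable_finite poly_roots_finite)
  moreover have "(\<Union>P\<in>?Z. {z. poly P z = 0}) = {z. \<exists>P. P \<noteq> 0 \<and> (\<forall>n. coeff P n \<in> \<int>) \<and> poly P z = 0}"
    by auto
  ultimately show ?thesis by simp
qed

text \<open>Exponents for a one-parameter deformation: the weights of \<open>a, b, u, v, q, t\<^sub>1, t\<^sub>2, \<dots>\<close> are
  the powers of a transcendental number, so that no nontrivial monomial stays constant.\<close>

lemma exists_transcendental:
  obtains z :: real where "\<And>P. P \<noteq> 0 \<Longrightarrow> (\<And>n. coeff P n \<in> \<int>) \<Longrightarrow> poly P z \<noteq> 0"
proof -
  have "{z :: real. \<exists>P. P \<noteq> 0 \<and> (\<forall>n. coeff P n \<in> \<int>) \<and> poly P z = 0} \<noteq> UNIV"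
    using countable_roots_int_coeffs uncountable_UNIV_real by metis
  then show thesis using that by blast
qed

lemma coeff_Ints_pCons: "c \<in> \<int> \<Longrightarrow> (\<And>n. coeff P n \<in> \<int>) \<Longrightarrow> coeff (pCons c P) n \<in> \<int>"
  by (simp add: coeff_pCons split: nat.splits)

definition exponent_weight :: "real \<Rightarrow> int \<times> int \<times> int \<times> int \<times> int \<Rightarrow> real" where
  "exponent_weight z = (\<lambda>(i, j, k, l, r). of_int i + of_int j * z + of_int k * z ^ 2 + of_int l * z ^ 3 + of_int r * z ^ 4)"

text \<open>Each quantity is the value at z of a nonzero polynomial with integer coefficients. The
  condition x > 0 separates z^(4+x) from the powers up to z^4 that belong to \<open>a\<close>,
  \<open>b\<close>, \<open>u\<close>, \<open>v\<close>, \<open>q\<close>, so the coefficient at 4 +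
  x is 1.\<close>

lemma exponent_weight_nz:
  fixes z :: real and x y :: nat
  assumes z: "\<And>P. P \<noteq> 0 \<Longrightarrow> (\<And>n. coeff P n \<in> \<int>) \<Longrightarrow> poly P z \<noteq> 0"
  shows "e \<noteq> (0, 0, 0, 0, 0) \<Longrightarrow> exponent_weight z e \<noteq> 0"
    and "x > 0 \<Longrightarrow> exponent_weight z e + z ^ (4 + x) \<noteq> 0"
    and "x > 0 \<Longrightarrow> x \<noteq> y \<Longrightarrow> exponent_weight z e + z ^ (4 + x) - z ^ (4 + y) \<noteq> 0"
proof -
  obtain i j k l r where e: "e = (i, j, k, l, r)" by (cases e)
  define P :: "real poly" where "P = [:of_int i, of_int j, of_int k, of_int l, of_int r:]"
  have P: "coeff P n \<in> \<int>" for n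
    unfolding P_def by (intro coeff_Ints_pCons) auto
  have ev: "exponent_weight z e = poly P z"
    by (simp add: exponent_weight_def P_def e algebra_simps power2_eq_square power3_eq_cube power4_eq_xxxx)
  have P0: "coeff P (4 + x) = 0" if "x > 0"
    using that by (cases x) (simp_all add: P_def coeff_pCons numeral_eq_Suc)
  have nz: "poly (P + Q) z \<noteq> 0" if "\<And>n. coeff Q n \<in> \<int>" "coeff (P + Q) m \<noteq> 0" for Q m
    by (rule z) (use that P in \<open>metis coeff_0, simp add: Ints_add\<close>)
  show "exponent_weight z e \<noteq> 0" if "e \<noteq> (0, 0, 0, 0, 0)"
    unfolding ev by (rule z) (use that P in \<open>auto simp: P_def e\<close>)
  show "exponent_weight z e + z ^ (4 + x) \<noteq> 0" if "x > 0"
    using nz[of "monom 1 (4 + x)" "4 + x"] P0[OF that] unfolding ev by (simp add: poly_monom)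
  show "exponent_weight z e + z ^ (4 + x) - z ^ (4 + y) \<noteq> 0" if "x > 0" "x \<noteq> y"
    using nz[of "monom 1 (4 + x) - monom 1 (4 + y)" "4 + x"] P0[OF that(1)] that(2) unfolding ev
    by (simp add: poly_monom)
qed

definition deform :: "real \<Rightarrow> real \<Rightarrow> complex" where
  "deform w \<epsilon> = exp (of_real (w * \<epsilon>))"

lemma deform_nz [simp]: "deform w \<epsilon> \<noteq> 0"
  by (simp add: deform_def)

lemma deform_powi: "deform w \<epsilon> powi k = deform (of_int k * w) \<epsilon>"
  by (simp add: deform_def exp_power_int mult_ac)

lemma deform_mult: "deform w \<epsilon> * deform w' \<epsilon> = deform (w + w') \<epsilon>"
  by (simp add: deform_def exp_add[symmetric] distrib_right)

lemma deform_divide: "deform w \<epsilon> / deform w' \<epsilon> = deform (w - w') \<epsilon>"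
  by (simp add: deform_def exp_diff[symmetric] left_diff_distrib)

lemma tendsto_deform: "(\<epsilon> \<longlongrightarrow> 0) F \<Longrightarrow> ((\<lambda>n. c * deform w (\<epsilon> n)) \<longlongrightarrow> c) F"
  unfolding deform_def by (rule tendsto_eq_intros refl | assumption)+ simp

context
  fixes p :: complex
  assumes p: "norm p < 1"
begin

text \<open>Each condition has a nonzero weight and so excludes only countably many \<epsilon>.
  There are countably many conditions, hence an admissible \<epsilon> exists in every interval (0,
  1/(n+1)).\<close>

lemma exists_generic_deformation:
  fixes a b u v q :: complex
  assumes nz: "a \<noteq> 0" "b \<noteq> 0" "u \<noteq> 0" "v \<noteq> 0" "q \<noteq> 0" and t: "\<And>i. i \<in> {1..N} \<Longrightarrow> t i \<noteq> 0"
  obtains \<epsilon> :: "nat \<Rightarrow> real" and z :: real where "\<epsilon> \<longlonglongrightarrow> 0"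
    "\<And>n. theta_params.generic_strings p (q * deform (z ^ 4) (\<epsilon> n)) (b * deform z (\<epsilon> n)) (a * deform 1 (\<epsilon> n))
      (u * deform (z ^ 2) (\<epsilon> n)) (v * deform (z ^ 3) (\<epsilon> n)) N (\<lambda>i. t i * deform (z ^ (4 + i)) (\<epsilon> n))"
proof -
  obtain z :: real where z: "\<And>P. P \<noteq> 0 \<Longrightarrow> (\<And>n. coeff P n \<in> \<int>) \<Longrightarrow> poly P z \<noteq> 0"
    using exists_transcendental by metis
  let ?wt = "exponent_weight z"
  note wt = exponent_weight_nz[OF z]
  define M where "M = (\<lambda>(i, j, k, l, r). a powi i * b powi j * u powi k * v powi l * q powi r)"
  let ?bad = "\<lambda>c w. {\<epsilon>. etheta p (c * deform w \<epsilon>) = 0}"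
  have cb: "countable (?bad c w)" if "c \<noteq> 0" "w \<noteq> 0" for c w
    unfolding deform_def by (rule countable_etheta_exp_zero[OF p that])
  define Bad where "Bad = (\<Union>e\<in>- {(0, 0, 0, 0, 0)}. ?bad (M e) (?wt e))
    \<union> (\<Union>x\<in>{1..N}. \<Union>e. ?bad (M e * t x) (?wt e + z ^ (4 + x)))
    \<union> (\<Union>x\<in>{1..N}. \<Union>y\<in>{1..N} - {x}. \<Union>e. ?bad (M e * t x / t y) (?wt e + z ^ (4 + x) - z ^ (4 + y)))"
  have Mnz: "M e \<noteq> 0" for e using nz by (cases e) (simp add: M_def)
  have "countable Bad"
    unfolding Bad_def
    by (intro countable_Un countable_UN; (rule cb[OF _ wt(1)] cb[OF _ wt(2)] cb[OF _ wt(3)])?) (use Mnz t in auto)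
  have "\<exists>\<epsilon>. \<epsilon> \<notin> Bad \<and> 0 < \<epsilon> \<and> \<epsilon> < 1 / real (Suc n)" for n
  proof (rule ccontr)
    assume "\<nexists>\<epsilon>. \<epsilon> \<notin> Bad \<and> 0 < \<epsilon> \<and> \<epsilon> < 1 / real (Suc n)"
    then have "{0<..<1 / real (Suc n)} \<subseteq> Bad" by auto
    then have "countable {0<..<1 / real (Suc n)}" using \<open>countable Bad\<close> by (rule countable_subset)
    then show False using uncountable_open_interval[of 0 "1 / real (Suc n)"] by simp
  qed
  then obtain \<epsilon> where \<epsilon>: "\<And>n. \<epsilon> n \<notin> Bad" "\<And>n. 0 < \<epsilon> n" "\<And>n. \<epsilon> n < 1 / real (Suc n)"
    by metis
  have "\<epsilon> \<longlonglongrightarrow> 0"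
  proof (rule tendsto_sandwich[OF _ _ tendsto_const])
    show "(\<lambda>n. 1 / real (Suc n)) \<longlonglongrightarrow> 0"
      using LIMSEQ_inverse_real_of_nat by (simp add: inverse_eq_divide)
  qed (use \<epsilon> in \<open>auto intro!: always_eventually less_imp_le\<close>)
  moreover have "theta_params.generic_strings p (q * deform (z ^ 4) \<epsilon>) (b * deform z \<epsilon>) (a * deform 1 \<epsilon>)
      (u * deform (z ^ 2) \<epsilon>) (v * deform (z ^ 3) \<epsilon>) N (\<lambda>i. t i * deform (z ^ (4 + i)) \<epsilon>)" if good: "\<epsilon> \<notin> Bad" for \<epsilon>
  proof -
    interpret E: theta_params p "q * deform (z ^ 4) \<epsilon>" "b * deform z \<epsilon>"
      by unfold_locales (use p nz in auto)
    let ?monomial = "E.monomial (a * deform 1 \<epsilon>) (u * deform (z ^ 2) \<epsilon>) (v * deform (z ^ 3) \<epsilon>)"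
    have m: "?monomial e = M e * deform (?wt e) \<epsilon>" for e
    proof -
      obtain i j k l r where e: "e = (i, j, k, l, r)" by (cases e) auto
      have "deform (?wt e) \<epsilon> = deform 1 \<epsilon> powi i * deform z \<epsilon> powi j * deform (z ^ 2) \<epsilon> powi k * deform (z ^ 3) \<epsilon> powi l * deform (z ^ 4) \<epsilon> powi r"
        by (simp add: deform_powi deform_mult exponent_weight_def e)
      then show ?thesis
        by (simp add: E.monomial_def M_def e power_int_mult_distrib mult_ac)
    qed
    have good_x: "etheta p (M e * t x * deform (?wt e + z ^ (4 + x)) \<epsilon>) \<noteq> 0" if "x \<in> {1..N}" for e x
      using good that unfolding Bad_def by blast
    have good_xy: "etheta p (M e * t x / t y * deform (?wt e + z ^ (4 + x) - z ^ (4 + y)) \<epsilon>) \<noteq> 0"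
      if "x \<in> {1..N}" "y \<in> {1..N} - {x}" for e x y
    proof
      assume "etheta p (M e * t x / t y * deform (?wt e + z ^ (4 + x) - z ^ (4 + y)) \<epsilon>) = 0"
      then have "\<epsilon> \<in> (\<Union>e. ?bad (M e * t x / t y) (?wt e + z ^ (4 + x) - z ^ (4 + y)))" by blast
      then have "\<epsilon> \<in> Bad" unfolding Bad_def by (intro UnI2 UN_I[OF that(1)] UN_I[OF that(2)])
      then show False using good by blast
    qed
    show ?thesis
      unfolding E.generic_strings_def m
    proof (intro conjI allI ballI impI)
      show "etheta p (M e * deform (?wt e) \<epsilon>) \<noteq> 0" if "e \<noteq> (0, 0, 0, 0, 0)" for e
        using good that by (auto simp: Bad_def)
      fix x assume x: "x \<in> {1..N}"
      show "t x * deform (z ^ (4 + x)) \<epsilon> \<noteq> 0" using t[OF x] by simp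
      show "etheta p (M e * deform (?wt e) \<epsilon> * (t x * deform (z ^ (4 + x)) \<epsilon>)) \<noteq> 0" for e
        using good_x[OF x, of e] by (simp add: deform_mult[symmetric] mult_ac)
      fix y and j r :: int assume y: "y \<in> {1..N}" and xy: "x \<noteq> y"
      let ?e = "(0 :: int, j, 0 :: int, 0 :: int, r)"
      have "(b * deform z \<epsilon>) powi j * (q * deform (z ^ 4) \<epsilon>) powi r = ?monomial ?e"
        by (simp add: E.monomial_def)
      then have "(b * deform z \<epsilon>) powi j * (q * deform (z ^ 4) \<epsilon>) powi r * (t x * deform (z ^ (4 + x)) \<epsilon>) / (t y * deform (z ^ (4 + y)) \<epsilon>)
        = M ?e * t x / t y * deform (?wt ?e + z ^ (4 + x) - z ^ (4 + y)) \<epsilon>"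
        unfolding m deform_divide[symmetric] deform_mult[symmetric] by simp
      moreover have "y \<in> {1..N} - {x}" using y xy by simp
      ultimately show "etheta p ((b * deform z \<epsilon>) powi j * (q * deform (z ^ 4) \<epsilon>) powi r * (t x * deform (z ^ (4 + x)) \<epsilon>) / (t y * deform (z ^ (4 + y)) \<epsilon>)) \<noteq> 0"
        using good_xy[OF x] by metis
    qed (use nz in auto)
  qed
  ultimately show thesis
    using that[of \<epsilon> z] \<epsilon>(1) by blast
qed

section \<open>Continuity of the series in its parameters\<close>

lemma tendsto_tsf_nat [tendsto_intros]:
  assumes "(f \<longlongrightarrow> x) F" "(g \<longlongrightarrow> q) F" "x \<noteq> 0" "q \<noteq> 0"
  shows "((\<lambda>n. tsf_nat (g n) p (f n) k) \<longlongrightarrow> tsf_nat q p x k) F"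
  unfolding tsf_nat_def using assms by (intro tendsto_intros p) auto

lemma tendsto_tsf:
  assumes "(f \<longlongrightarrow> x) F" "(g \<longlongrightarrow> q) F" "x \<noteq> 0" "q \<noteq> 0" "tsf_num_ok q p x k"
  shows "((\<lambda>n. tsf (g n) p (f n) k) \<longlongrightarrow> tsf q p x k) F"
proof (cases "0 \<le> k")
  case True
  then show ?thesis using assms by (simp add: tsf_def tendsto_tsf_nat)
next
  case False
  then show ?thesis
    using assms by (simp add: tsf_def tsf_num_ok_def) (intro tendsto_intros; simp)
qed

lemma tendsto_tsf_int:
  assumes "(f \<longlongrightarrow> x) F" "(g \<longlongrightarrow> q) F" "x \<noteq> 0" "q \<noteq> 0"
  shows "((\<lambda>n. tsf (g n) p (f n) (int k)) \<longlongrightarrow> tsf q p x (int k)) F"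
  using assms by (intro tendsto_tsf) (simp_all add: tsf_num_ok_def)

text \<open>For a negative index the reciprocal is the product \<open>tsf_nat\<close> itself, which
  is continuous; where this product vanishes the equality persists, as both 1/0 and 1/(1/0) are 0.
  Hence it is the reciprocal, not the factorial, that is shown to converge.\<close>

lemma tendsto_inverse_tsf:
  assumes "(f \<longlongrightarrow> x) F" "(g \<longlongrightarrow> q) F" "x \<noteq> 0" "q \<noteq> 0" "tsf_den_ok q p x k"
  shows "((\<lambda>n. 1 / tsf (g n) p (f n) k) \<longlongrightarrow> 1 / tsf q p x k) F"
proof (cases "0 \<le> k")
  case True
  then show ?thesis
    using assms by (simp add: tsf_def tsf_den_ok_def) (intro tendsto_intros; simp)
next
  case False
  then show ?thesis
    using assms by (simp add: tsf_def) (intro tendsto_intros; simp)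
qed

lemma tendsto_divide_tsf:
  assumes "(h \<longlongrightarrow> y) F" "(f \<longlongrightarrow> x) F" "(g \<longlongrightarrow> q) F" "x \<noteq> 0" "q \<noteq> 0" "tsf_den_ok q p x k"
  shows "((\<lambda>n. h n / tsf (g n) p (f n) k) \<longlongrightarrow> y / tsf q p x k) F"
  using tendsto_mult[OF assms(1) tendsto_inverse_tsf[OF assms(2-)]] by simp

lemma tsf_den_okD: "tsf_den_ok q p x (int k) \<Longrightarrow> tsf q p x (int k) \<noteq> 0"
  by (simp add: tsf_den_ok_def tsf_def)

lemma tendsto_V:
  assumes lims: "(q' \<longlongrightarrow> q) F" "(a' \<longlongrightarrow> a) F" "(b' \<longlongrightarrow> b) F" "(c' \<longlongrightarrow> c) F" "(d' \<longlongrightarrow> d) F"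
    and tlim: "\<And>i. i \<in> {1..N} \<Longrightarrow> ((\<lambda>n. t' n i) \<longlongrightarrow> t i) F"
    and nz: "a \<noteq> 0" "b \<noteq> 0" "c \<noteq> 0" "d \<noteq> 0" "q \<noteq> 0" "\<And>i. i \<in> {1..N} \<Longrightarrow> t i \<noteq> 0"
    and wd: "V_well_defined q p N m a b c d t"
  shows "((\<lambda>n. V (q' n) p N m (a' n) (b' n) (c' n) (d' n) (t' n)) \<longlongrightarrow> V q p N m a b c d t) F"
  unfolding V_def
proof (rule tendsto_sum)
  fix k assume k: "k \<in> box N m"
  note w = wd[unfolded V_well_defined_def, rule_format, OF k]
  have w1: "etheta p (a * t i) \<noteq> 0" "tsf_den_ok q p (a * q * t i / c) (int (k i))"
        "tsf_den_ok q p (a * q * t i / d) (int (k i))"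
        "tsf_den_ok q p (a * q * t i / b) (int (weight N k))"
        "tsf_den_ok q p (a * q ^ (m i + 1) * t i) (int (weight N k))"
        "tsf_den_ok q p (a * b * t i) (int (k i + weight N k))" if "i \<in> {1..N}" for i
    using w that by auto
  have w2: "tsf_den_ok q p (c * q / b) (int (weight N k))" "tsf_den_ok q p (d * q / b) (int (weight N k))"
    using w by auto
  have w3: "tsf_den_ok q p (q powi (1 - int (m j)) * t i / (b * t j)) (int (k i))"
        "tsf_den_ok q p (q * t i / t j) (int (k i))"
        "tsf_num_ok q p (q * t i / t j) (int (k i) - int (k j))"
        "tsf_den_ok q p (b * t i / t j) (int (k i) - int (k j))" if "i \<in> {1..N}" "j \<in> {1..N}" for i j
    using w that by auto
  show "((\<lambda>n. V_term (q' n) p N m (a' n) (b' n) (c' n) (d' n) (t' n) k) \<longlongrightarrow> V_term q p N m a b c d t k) F"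
    unfolding V_term_def tsfs_def list.map prod_list.Cons prod_list.Nil mult_1_right
  proof (intro tendsto_mult tendsto_prod, goal_cases)
    case (1 i)
    then show ?case
      by (intro tendsto_intros p lims tlim) (use nz w1 in auto)
  next
    case (2 i)
    then show ?case
      by (intro tendsto_divide tendsto_mult tendsto_tsf_int lims tlim tendsto_power) (use nz w1[of i] tsf_den_okD in auto)
  next
    case (3 i)
    then show ?case
      by (intro tendsto_divide tendsto_mult tendsto_tsf_int lims tlim tendsto_power) (use nz w1[of i] tsf_den_okD in auto)
  next
    case (4 i)
    then show ?case
      by (intro tendsto_divide_tsf tendsto_divide tendsto_mult tendsto_tsf_int lims tlim tendsto_power w1) (use nz in auto)
  next
    case 5
    then show ?case
      by (intro tendsto_divide tendsto_mult tendsto_tsf_int lims tendsto_power) (use nz w2 tsf_den_okD in auto)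
  next
    case 6
    then show ?case
      by (intro tendsto_power tendsto_divide lims nz)
  next
    case (7 i j)
    then show ?case
      by (intro tendsto_divide tendsto_mult tendsto_tsf_int lims tlim tendsto_power_int tendsto_const) (use nz w3[of i j] tsf_den_okD in auto)
  next
    \<comment> \<open>The index k_i - k_j may be negative, where well-definedness allows the
      denominator to stand for a product that vanishes; the limit is therefore taken of the
      reciprocal.\<close>
    case (8 i j)
    then show ?case
      by (intro tendsto_divide_tsf tendsto_tsf tendsto_divide tendsto_mult lims tlim w3) (use nz in auto)
  qed
qed

end

theorem theorem4p1:
  fixes p q a b c d ahat :: complex
    and N :: nat
    and m :: "nat \<Rightarrow> nat"
    and t s :: "nat \<Rightarrow> complex"
  assumes p: "norm p < 1"
    and N: "N \<ge> 1"
    and nonzero: "a \<noteq> 0" "b \<noteq> 0" "c \<noteq> 0" "d \<noteq> 0" "q \<noteq> 0"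
    and t_nonzero: "\<forall>i\<in>{1..N}. t i \<noteq> 0"
    and ahat: "ahat = c * d / (a * b)"
    and s: "\<forall>i\<in>{1..N}. s i * t i = q powi (- int (m i))"
    and lhs_wd: "V_well_defined q p N m a b c d t"
    and rhs_wd: "V_well_defined q p N m ahat b c d s"
    and prefactor_wd: "\<forall>i\<in>{1..N}.
        tsf_den_ok q p (ahat * q * s i) (int (m i))
      \<and> tsf_den_ok q p (a * q * t i / c) (int (m i))
      \<and> tsf_den_ok q p (a * q * t i / d) (int (m i))
      \<and> tsf_den_ok q p (ahat * q * s i / (c * d)) (int (m i))"
  shows "V q p N m a b c d t =
    V q p N m ahat b c d s
    * (\<Prod>i=1..N.
        tsfs q p [a * q * t i, ahat * q * s i / c, ahat * q * s i / d, a * q * t i / (c * d)]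
          (int (m i))
        / tsfs q p [ahat * q * s i, a * q * t i / c, a * q * t i / d, ahat * q * s i / (c * d)]
          (int (m i)))"
proof -
  \<comment> \<open>The deformation moves \<open>u\<close> and \<open>v\<close> independently; c, d,
    ahat and s along the sequence are computed from the deformed parameters, so that the relations
    between them persist for every n.\<close>
  define u v where "u = a * b / c" and "v = a * b / d"
  have uv: "u \<noteq> 0" "v \<noteq> 0" "c = a * b / u" "d = a * b / v" using nonzero by (auto simp: u_def v_def)
  have tnz: "t i \<noteq> 0" if "i \<in> {1..N}" for i using t_nonzero that by blast
  have s_eq: "s i = q powi (- int (m i)) / t i" if "i \<in> {1..N}" for i
    using s tnz that by (simp add: eq_divide_eq)
  have snz: "s i \<noteq> 0" if "i \<in> {1..N}" for i using s_eq[OF that] tnz[OF that] nonzero by simp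
  have ahat_nz: "ahat \<noteq> 0" using nonzero ahat by simp
  obtain \<epsilon> z where \<epsilon>: "\<epsilon> \<longlonglongrightarrow> 0"
    and gen: "\<And>n. theta_params.generic_strings p (q * deform (z ^ 4) (\<epsilon> n)) (b * deform z (\<epsilon> n)) (a * deform 1 (\<epsilon> n))
      (u * deform (z ^ 2) (\<epsilon> n)) (v * deform (z ^ 3) (\<epsilon> n)) N (\<lambda>i. t i * deform (z ^ (4 + i)) (\<epsilon> n))"
    by (rule exists_generic_deformation[OF p nonzero(1,2) uv(1,2) nonzero(5), of N t]) (use tnz in blast)+
  define a' b' u' v' q' where defs: "a' = (\<lambda>n. a * deform 1 (\<epsilon> n))" "b' = (\<lambda>n. b * deform z (\<epsilon> n))"
    "u' = (\<lambda>n. u * deform (z ^ 2) (\<epsilon> n))" "v' = (\<lambda>n. v * deform (z ^ 3) (\<epsilon> n))" "q' = (\<lambda>n. q * deform (z ^ 4) (\<epsilon> n))"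
  define t' where "t' = (\<lambda>n i. t i * deform (z ^ (4 + i)) (\<epsilon> n))"
  define c' d' where cd': "c' = (\<lambda>n. a' n * b' n / u' n)" "d' = (\<lambda>n. a' n * b' n / v' n)"
  define ahat' where "ahat' = (\<lambda>n. c' n * d' n / (a' n * b' n))"
  define s' where "s' = (\<lambda>n i. q' n powi (- int (m i)) / t' n i)"
  have nz': "a' n \<noteq> 0" "b' n \<noteq> 0" "u' n \<noteq> 0" "v' n \<noteq> 0" "q' n \<noteq> 0" "c' n \<noteq> 0" "d' n \<noteq> 0" for n
    using nonzero uv by (auto simp: defs cd')
  let ?P = "\<lambda>q a c d ahat t s. \<Prod>i=1..N.
        tsfs q p [a * q * t i, ahat * q * s i / c, ahat * q * s i / d, a * q * t i / (c * d)] (int (m i))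
        / tsfs q p [ahat * q * s i, a * q * t i / c, a * q * t i / d, ahat * q * s i / (c * d)] (int (m i))"
  have eq: "V (q' n) p N m (a' n) (b' n) (c' n) (d' n) (t' n)
      = V (q' n) p N m (ahat' n) (b' n) (c' n) (d' n) (s' n) * ?P (q' n) (a' n) (c' n) (d' n) (ahat' n) (t' n) (s' n)" for n
  proof -
    interpret E: theta_params p "q' n" "b' n"
      by unfold_locales (use p nz' in auto)
    have "a' n * b' n / c' n = u' n" "a' n * b' n / d' n = v' n"
      using nz' by (simp_all add: cd')
    then have "E.generic_strings (a' n) (a' n * b' n / c' n) (a' n * b' n / d' n) N (t' n)"
      using gen[of n] by (simp add: defs t'_def)
    from E.V_transformation_generic[OF nz'(6,7) this, of "s' n" m "ahat' n"] show ?thesis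
      by (simp add: s'_def ahat'_def)
  qed
  have lim: "a' \<longlonglongrightarrow> a" "b' \<longlonglongrightarrow> b" "u' \<longlonglongrightarrow> u" "v' \<longlonglongrightarrow> v" "q' \<longlonglongrightarrow> q"
    unfolding defs by (rule tendsto_deform[OF \<epsilon>])+
  have limt: "(\<lambda>n. t' n i) \<longlonglongrightarrow> t i" for i
    unfolding t'_def by (rule tendsto_deform[OF \<epsilon>])
  have limcd: "c' \<longlonglongrightarrow> c" "d' \<longlonglongrightarrow> d"
    unfolding cd' uv(3,4) using uv(1,2) by (intro tendsto_intros lim; simp)+
  have limahat: "ahat' \<longlonglongrightarrow> ahat"
    unfolding ahat'_def ahat using nonzero by (intro tendsto_intros lim limcd) auto
  have lims: "(\<lambda>n. s' n i) \<longlonglongrightarrow> s i" if "i \<in> {1..N}" for i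
    unfolding s'_def s_eq[OF that] using nonzero tnz[OF that] by (intro tendsto_intros lim limt) auto
  have "(\<lambda>n. V (q' n) p N m (a' n) (b' n) (c' n) (d' n) (t' n)) \<longlonglongrightarrow> V q p N m a b c d t"
    by (rule tendsto_V[OF p]) (use lim limt limcd nonzero tnz lhs_wd in auto)
  moreover have "(\<lambda>n. V (q' n) p N m (ahat' n) (b' n) (c' n) (d' n) (s' n)) \<longlonglongrightarrow> V q p N m ahat b c d s"
    by (rule tendsto_V[OF p]) (use lim lims limcd limahat nonzero snz ahat_nz rhs_wd in auto)
  moreover have "(\<lambda>n. ?P (q' n) (a' n) (c' n) (d' n) (ahat' n) (t' n) (s' n)) \<longlonglongrightarrow> ?P q a c d ahat t s"
    unfolding tsfs_def list.map prod_list.Cons prod_list.Nil mult_1_right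
    by (intro tendsto_prod tendsto_divide tendsto_mult tendsto_tsf_int[OF p] lim limt limcd limahat lims)
      (use nonzero tnz snz ahat_nz prefactor_wd tsf_den_okD[OF p] in auto)
  ultimately have "(\<lambda>n. V (q' n) p N m (a' n) (b' n) (c' n) (d' n) (t' n)) \<longlonglongrightarrow> V q p N m ahat b c d s * ?P q a c d ahat t s"
    unfolding eq by (intro tendsto_mult)
  then show ?thesis
    using \<open>(\<lambda>n. V (q' n) p N m (a' n) (b' n) (c' n) (d' n) (t' n)) \<longlonglongrightarrow> V q p N m a b c d t\<close> LIMSEQ_unique by blast
qed

end
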